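(* Let $\Phi$ be a rank two root system with simple root basis $\{\alpha,\beta\}$ ($\alpha$ is short), associated fundamental weights $\{\omega_\alpha,\omega_\beta\}$, and associated Cartan matrix $M_\Phi$. Let $P$ be a two-color grid poset with vertex color set $\{\alpha,\beta\}$. Let $L:=\mathbf{J}_{color}(P)$, and let $\lambda=a\omega_\alpha+b\omega_\beta$ be the (dominant) weight $wt(\mathbf{max})$ of the unique maximal element $\mathbf{max}$ of $L$. Suppose that $P$ has the max property and that $L$ is $M_\Phi$-structured. Then $L$ is a splitting distributive lattice for the $\Phi$-Weyl bialternant $\chi_\lambda$. In particular $\mathrm{WGF}(L)=\chi_\lambda$, $L$ is rank symmetric and rank unimodal, and $$\mathrm{RGF}(L,q)=\prod_{\gamma\in\Phi^+}\frac{1-q^{\langle\lambda+\varrho,\gamma^\vee\rangle}}{1-q^{\langle\varrho,\gamma^\vee\rangle}}.$$ The latter identity particularizes as follows for the four distinct rank two root systems: $$\mathrm{RGF}(L,q)=\frac{(1-q^{a+1})(1-q^{b+1})}{(1-q)(1-q)}\quad\text{if }\Phi=A_1\oplus A_1,$$ $$\mathrm{RGF}(L,q)=\frac{(1-q^{a+1})(1-q^{b+1})(1-q^{a+b+2})}{(1-q)(1-q)(1-q^2)}\quad\text{if }\Phi=A_2,$$ $$\mathrm{RGF}(L,q)=\frac{(1-q^{a+1})(1-q^{b+1})(1-q^{a+b+2})(1-q^{a+2b+3})}{(1-q)(1-q)(1-q^2)(1-q^3)}\quad\text{if }\Phi=C_2,$$ $$\mathrm{RGF}(L,q)=\frac{(1-q^{a+1})(1-q^{b+1})(1-q^{a+b+2})(1-q^{a+2b+3})(1-q^{a+3b+4})(1-q^{2a+3b+5})}{(1-q)(1-q)(1-q^2)(1-q^3)(1-q^4)(1-q^5)}\quad\text{if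 }\Phi=G_2.$$
   Context: **Root system data.** $\Phi$ is a finite root system of rank two in a 2-dimensional Euclidean space with inner product $\langle\cdot,\cdot\rangle$, with simple roots $\alpha,\beta$, positive roots $\Phi^+$, coroots $\gamma^\vee=\frac{2}{\langle\gamma,\gamma\rangle}\gamma$, and Cartan matrix $M_\Phi=(\langle\alpha_i,\alpha_j^\vee\rangle)_{i,j}$ where $\alpha_1=\alpha$, $\alpha_2=\beta$. With $\alpha$ short, the possibilities for $M_\Phi$ are $A_1\oplus A_1$: $\begin{pmatrix}2&0\\0&2\end{pmatrix}$; $A_2$: $\begin{pmatrix}2&-1\\-1&2\end{pmatrix}$; $C_2$: $\begin{pmatrix}2&-1\\-2&2\end{pmatrix}$; $G_2$: $\begin{pmatrix}2&-1\\-3&2\end{pmatrix}$. The fundamental weights $\omega_\alpha,\omega_\beta$ form the basis dual to $\alpha^\vee,\beta^\vee$; $\Lambda=\mathbb{Z}\omega_\alpha+\mathbb{Z}\omega_\beta$ is the weight lattice, dominant weights are those with nonnegative coefficients, $\varrho=\omega_\alpha+\omega_\beta=\frac12\sum_{\gamma\in\Phi^+}\gamma$, and $W$ is the Weyl group. **Weyl bialternants.** $\mathbb{Z}[\Lambda]$ is the group ring with $\mathbb{Z}$-basis the formal exponentials $e^\mu$ ($\mu\in\Lambda$), with $W$ acting by $\sigma.e^\mu=e^{\sigma\mu}$. Put $\mathcal{A}(\varphi):=\sum_{\sigma\in W}\det(\sigma)\,\sigma.\varphi$. For dominant $\lambda$, the Weyl bialternant $\chi_\lambda$ is the unique element of $\mathbb{Z}[\Lambda]$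 with $\mathcal{A}(e^\varrho)\chi_\lambda=\mathcal{A}(e^{\lambda+\varrho})$. **Two-color grid posets.** All posets are finite; $u\to v$ means that $v$ covers $u$; $[m]=\{1,\dots,m\}$. A *chain function* for a poset $P$ is a function $\mathbf{chain}:P\to[m]$ (some $m\ge1$) such that (1) each $\mathbf{chain}^{-1}(i)$ is a (possibly empty) chain in $P$, and (2) whenever $u\to v$ in $P$, either $\mathbf{chain}(u)=\mathbf{chain}(v)$ or $\mathbf{chain}(u)=\mathbf{chain}(v)+1$. A *grid poset* is a finite poset together with a chain function; chain functions are assumed surjective throughout. A *two-color function* for a grid poset is a function $\mathbf{color}:P\to\Delta$ such that (1) $|\Delta|=2$; (2) $\mathbf{color}(u)=\mathbf{color}(v)$ if $\mathbf{chain}(u)=\mathbf{chain}(v)$; (3) if $u,v$ lie in the same connected component of $P$ and $\mathbf{chain}(u)=\mathbf{chain}(v)+1$, then $\mathbf{color}(u)\ne\mathbf{color}(v)$. A *two-color grid poset* is a grid poset together with a two-color function; here $\Delta=\{\alpha,\beta\}$. It has the *max property* if (1) $\mathbf{chain}(u)\le2$ for every maximal element $u$ of $P$ and (2) $\mathbf{color}(u)\ne\mathbf{color}(v)$ whenever $u,v$ are distinct maximal elements of $P$. **The lattice $\mathbf{J}_{color}(P)$.** This is the distributive lattice of order ideals (down-sets) of $P$ ordered by inclusion, whose covering edges are colored: if $\mathbf{t}$ covers $\mathbf{s}$ with $\mathbf{t}\setminus\mathbf{s}=\{u\}$, the edge has color $\mathbf{color}(u)=:i$, written $\mathbf{s}\stackrel{i}{\to}\mathbf{t}$.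 **Weights and generating functions.** For $R$ a ranked poset whose covering edges are colored by $\{\alpha,\beta\}$, and $\mathbf{x}\in R$, $i\in\{\alpha,\beta\}$, let $\mathbf{comp}_i(\mathbf{x})$ be the $i$-component of $\mathbf{x}$, i.e. the connected component containing $\mathbf{x}$ of the graph having only the color $i$ edges; let $\rho_i(\mathbf{x})$ be the rank of $\mathbf{x}$ in it and $l_i(\mathbf{x})$ the length of that component. Put $m_i(\mathbf{x})=2\rho_i(\mathbf{x})-l_i(\mathbf{x})$ and $wt(\mathbf{x})=m_\alpha(\mathbf{x})\omega_\alpha+m_\beta(\mathbf{x})\omega_\beta$. $R$ is *$M_\Phi$-structured* if $wt(\mathbf{s})+i=wt(\mathbf{t})$ whenever $\mathbf{s}\stackrel{i}{\to}\mathbf{t}$ in $R$, $i\in\{\alpha,\beta\}$. $\mathrm{WGF}(R)=\sum_{\mathbf{x}\in R}e^{wt(\mathbf{x})}$. $R$ is a *splitting poset* for $\chi$ if it is $M_\Phi$-structured and $\mathrm{WGF}(R)=\chi$; a *splitting distributive lattice* is a splitting poset that is a distributive lattice. If $\rho:R\to\{0,\dots,l\}$ is the (surjective) rank function, $\mathrm{RGF}(R,q)=\sum_{i=0}^l|\rho^{-1}(i)|q^i$; for $L=\mathbf{J}_{color}(P)$ the rank of an order ideal is its cardinality. $R$ is *rank symmetric* (resp. *rank unimodal* ) if the coefficients $a_0,\dots,a_l$ of $\mathrm{RGF}(R,q)$ satisfy $a_i=a_{l-i}$ for all $i$ (resp. $a_0\le\cdots\le a_p\ge\cdots\ge a_l$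 for some $p$). *)

theory Defs
  imports
    "HOL-Analysis.Analysis"
    "HOL-Library.Poly_Mapping"
    "HOL-Computational_Algebra.Polynomial_Factorial"
    "HOL-Algebra.Lattice"
begin

definition coroot :: "'v::euclidean_space \<Rightarrow> 'v" where
  "coroot \<gamma> = (2 / (\<gamma> \<bullet> \<gamma>)) *\<^sub>R \<gamma>"

definition root_reflection :: "'v::euclidean_space \<Rightarrow> 'v \<Rightarrow> 'v" where
  "root_reflection \<gamma> v = v - (v \<bullet> coroot \<gamma>) *\<^sub>R \<gamma>"

text \<open>Root systems are reduced and crystallographic; the rank is the dimension of the space.\<close>

definition root_system :: "'v::euclidean_space set \<Rightarrow> bool" where
  "root_system \<Phi> \<longleftrightarrow>
     finite \<Phi> \<and> span \<Phi> = UNIV \<and> 0 \<notin> \<Phi> \<and>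
     (\<forall>\<gamma>\<in>\<Phi>. root_reflection \<gamma> ` \<Phi> = \<Phi>) \<and>
     (\<forall>\<gamma>\<in>\<Phi>. \<forall>\<delta>\<in>\<Phi>. \<gamma> \<bullet> coroot \<delta> \<in> \<int>) \<and>
     (\<forall>\<gamma>\<in>\<Phi>. \<forall>c. c *\<^sub>R \<gamma> \<in> \<Phi> \<longrightarrow> c = 1 \<or> c = - 1)"

definition nat_combs :: "'v::euclidean_space \<Rightarrow> 'v \<Rightarrow> 'v set" where
  "nat_combs x y = {real m *\<^sub>R x + real n *\<^sub>R y | m n :: nat. True}"

definition simple_roots :: "'v::euclidean_space set \<Rightarrow> 'v \<Rightarrow> 'v \<Rightarrow> bool" where
  "simple_roots \<Phi> \<alpha> \<beta> \<longleftrightarrow>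
     \<alpha> \<in> \<Phi> \<and> \<beta> \<in> \<Phi> \<and> \<alpha> \<noteq> \<beta> \<and> independent {\<alpha>, \<beta>} \<and> span {\<alpha>, \<beta>} = UNIV \<and>
     (\<forall>\<gamma>\<in>\<Phi>. \<gamma> \<in> nat_combs \<alpha> \<beta> \<or> - \<gamma> \<in> nat_combs \<alpha> \<beta>)"

definition positive_roots :: "'v::euclidean_space set \<Rightarrow> 'v \<Rightarrow> 'v \<Rightarrow> 'v set" where
  "positive_roots \<Phi> \<alpha> \<beta> = \<Phi> \<inter> nat_combs \<alpha> \<beta>"

definition cartan_matrix :: "'v::euclidean_space \<Rightarrow> 'v \<Rightarrow> real^2^2" where
  "cartan_matrix \<alpha> \<beta> =
     vector [vector [\<alpha> \<bullet> coroot \<alpha>, \<alpha> \<bullet> coroot \<beta>],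
             vector [\<beta> \<bullet> coroot \<alpha>, \<beta> \<bullet> coroot \<beta>]]"

definition type_A1A1 :: "'v::euclidean_space \<Rightarrow> 'v \<Rightarrow> bool" where
  "type_A1A1 \<alpha> \<beta> \<longleftrightarrow> cartan_matrix \<alpha> \<beta> = vector [vector [2, 0], vector [0, 2]]"

definition type_A2 :: "'v::euclidean_space \<Rightarrow> 'v \<Rightarrow> bool" where
  "type_A2 \<alpha> \<beta> \<longleftrightarrow> cartan_matrix \<alpha> \<beta> = vector [vector [2, - 1], vector [- 1, 2]]"

definition type_C2 :: "'v::euclidean_space \<Rightarrow> 'v \<Rightarrow> bool" where
  "type_C2 \<alpha> \<beta> \<longleftrightarrow> cartan_matrix \<alpha> \<beta> = vector [vector [2, - 1], vector [- 2, 2]]"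

definition type_G2 :: "'v::euclidean_space \<Rightarrow> 'v \<Rightarrow> bool" where
  "type_G2 \<alpha> \<beta> \<longleftrightarrow> cartan_matrix \<alpha> \<beta> = vector [vector [2, - 1], vector [- 3, 2]]"

text \<open>
  The fundamental weight of the first argument: \<open>\<omega>\<^sub>\<alpha>\<close> is \<open>fund_weight \<alpha> \<beta>\<close>
  and \<open>\<omega>\<^sub>\<beta>\<close> is \<open>fund_weight \<beta> \<alpha>\<close>.
\<close>

definition fund_weight :: "'v::euclidean_space \<Rightarrow> 'v \<Rightarrow> 'v" where
  "fund_weight i j = (THE w. w \<bullet> coroot i = 1 \<and> w \<bullet> coroot j = 0)"

definition weight_lattice :: "'v::euclidean_space \<Rightarrow> 'v \<Rightarrow> 'v set" where
  "weight_lattice \<alpha> \<beta> =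
     {of_int m *\<^sub>R fund_weight \<alpha> \<beta> + of_int n *\<^sub>R fund_weight \<beta> \<alpha> | m n :: int. True}"

definition dominant :: "'v::euclidean_space \<Rightarrow> 'v \<Rightarrow> 'v \<Rightarrow> bool" where
  "dominant \<alpha> \<beta> \<mu> \<longleftrightarrow> \<mu> \<in> nat_combs (fund_weight \<alpha> \<beta>) (fund_weight \<beta> \<alpha>)"

definition rho :: "'v::euclidean_space \<Rightarrow> 'v \<Rightarrow> 'v" where
  "rho \<alpha> \<beta> = fund_weight \<alpha> \<beta> + fund_weight \<beta> \<alpha>"

inductive_set weyl_group :: "'v::euclidean_space set \<Rightarrow> ('v \<Rightarrow> 'v) set"
  for \<Phi> :: "'v set" where
  "id \<in> weyl_group \<Phi>"
| "\<lbrakk>\<gamma> \<in> \<Phi>; \<sigma> \<in> weyl_group \<Phi>\<rbrakk> \<Longrightarrow> root_reflection \<gamma> \<circ> \<sigma> \<in> weyl_group \<Phi>"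

text \<open>
  The library determinant is only for matrices; this is its Leibniz formula for the matrix of an
  endomorphism in the orthonormal basis \<open>Basis\<close>.
\<close>

definition endo_det :: "('v::euclidean_space \<Rightarrow> 'v) \<Rightarrow> real" where
  "endo_det f = (\<Sum>p | p permutes Basis. of_int (sign p) * (\<Prod>b\<in>Basis. f b \<bullet> p b))"

text \<open>
  The group ring \<open>\<int>[\<Lambda>]\<close> is the subring \<open>group_ring \<Lambda>\<close> of the convolution ring
  \<^typ>\<open>'v \<Rightarrow>\<^sub>0 int\<close>, with \<open>e\<^sup>\<mu>\<close> being \<open>formal_exp \<mu>\<close>.
\<close>

definition group_ring :: "'v::euclidean_space set \<Rightarrow> ('v \<Rightarrow>\<^sub>0 int) set" where
  "group_ring \<Lambda> = {\<phi>. Poly_Mapping.keys \<phi> \<subseteq> \<Lambda>}"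

definition formal_exp :: "'v::euclidean_space \<Rightarrow> 'v \<Rightarrow>\<^sub>0 int" where
  "formal_exp \<mu> = Poly_Mapping.single \<mu> 1"

definition exp_act :: "('v::euclidean_space \<Rightarrow> 'v) \<Rightarrow> ('v \<Rightarrow>\<^sub>0 int) \<Rightarrow> 'v \<Rightarrow>\<^sub>0 int" where
  "exp_act \<sigma> \<phi> = (\<Sum>\<mu>\<in>Poly_Mapping.keys \<phi>. of_int (Poly_Mapping.lookup \<phi> \<mu>) * formal_exp (\<sigma> \<mu>))"

text \<open>The floor only turns the determinant, which is \<open>1\<close> or \<open>- 1\<close>, into an integer.\<close>

definition alternator :: "'v::euclidean_space set \<Rightarrow> ('v \<Rightarrow>\<^sub>0 int) \<Rightarrow> 'v \<Rightarrow>\<^sub>0 int" where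
  "alternator \<Phi> \<phi> = (\<Sum>\<sigma>\<in>weyl_group \<Phi>. of_int \<lfloor>endo_det \<sigma>\<rfloor> * exp_act \<sigma> \<phi>)"

definition weyl_bialternant :: "'v::euclidean_space set \<Rightarrow> 'v \<Rightarrow> 'v \<Rightarrow> 'v \<Rightarrow> 'v \<Rightarrow>\<^sub>0 int" where
  "weyl_bialternant \<Phi> \<alpha> \<beta> \<mu> =
     (THE \<xi>. \<xi> \<in> group_ring (weight_lattice \<alpha> \<beta>) \<and>
        alternator \<Phi> (formal_exp (rho \<alpha> \<beta>)) * \<xi> =
        alternator \<Phi> (formal_exp (\<mu> + rho \<alpha> \<beta>)))"

text \<open>
  A poset is a subset of a type of class \<open>order\<close>, with the induced order.
\<close>

definition covers_in :: "'a::order set \<Rightarrow> 'a \<Rightarrow> 'a \<Rightarrow> bool" where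
  "covers_in R x y \<longleftrightarrow> x \<in> R \<and> y \<in> R \<and> x < y \<and> \<not> (\<exists>z\<in>R. x < z \<and> z < y)"

definition maximal_in :: "'a::order set \<Rightarrow> 'a \<Rightarrow> bool" where
  "maximal_in R x \<longleftrightarrow> x \<in> R \<and> \<not> (\<exists>y\<in>R. x < y)"

definition chain_function :: "'a::order set \<Rightarrow> nat \<Rightarrow> ('a \<Rightarrow> nat) \<Rightarrow> bool" where
  "chain_function P m chn \<longleftrightarrow>
     chn ` P = {1..m} \<and>
     (\<forall>i\<in>{1..m}. Complete_Partial_Order.chain (\<le>) {u \<in> P. chn u = i}) \<and>
     (\<forall>u v. covers_in P u v \<longrightarrow> chn u = chn v \<or> chn u = chn v + 1)"

definition grid_poset :: "'a::order set \<Rightarrow> ('a \<Rightarrow> nat) \<Rightarrow> bool" where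
  "grid_poset P chn \<longleftrightarrow> finite P \<and> (\<exists>m\<ge>1. chain_function P m chn)"

definition two_color_function ::
  "'a::order set \<Rightarrow> ('a \<Rightarrow> nat) \<Rightarrow> 'c set \<Rightarrow> ('a \<Rightarrow> 'c) \<Rightarrow> bool" where
  "two_color_function P chn \<Delta> col \<longleftrightarrow>
     card \<Delta> = 2 \<and> col \<in> P \<rightarrow> \<Delta> \<and>
     (\<forall>u\<in>P. \<forall>v\<in>P. chn u = chn v \<longrightarrow> col u = col v) \<and>
     (\<forall>u\<in>P. \<forall>v\<in>P. equivclp (covers_in P) u v \<and> chn u = chn v + 1 \<longrightarrow> col u \<noteq> col v)"

definition two_color_grid_poset ::
  "'a::order set \<Rightarrow> ('a \<Rightarrow> nat) \<Rightarrow> 'c set \<Rightarrow> ('a \<Rightarrow> 'c) \<Rightarrow> bool" where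
  "two_color_grid_poset P chn \<Delta> col \<longleftrightarrow> grid_poset P chn \<and> two_color_function P chn \<Delta> col"

definition max_property :: "'a::order set \<Rightarrow> ('a \<Rightarrow> nat) \<Rightarrow> ('a \<Rightarrow> 'c) \<Rightarrow> bool" where
  "max_property P chn col \<longleftrightarrow>
     (\<forall>u. maximal_in P u \<longrightarrow> chn u \<le> 2) \<and>
     (\<forall>u v. maximal_in P u \<and> maximal_in P v \<and> u \<noteq> v \<longrightarrow> col u \<noteq> col v)"

definition order_ideals :: "'a::order set \<Rightarrow> 'a set set" where
  "order_ideals P = {I. I \<subseteq> P \<and> (\<forall>x\<in>I. \<forall>y\<in>P. y \<le> x \<longrightarrow> y \<in> I)}"

text \<open>
  For a covering edge \<open>s \<rightarrow> t\<close> of \<open>order_ideals P\<close> the difference \<open>t - s\<close> is a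
  singleton; the values on other pairs are irrelevant.
\<close>

definition ideal_edge_color :: "('a \<Rightarrow> 'c) \<Rightarrow> 'a set \<Rightarrow> 'a set \<Rightarrow> 'c" where
  "ideal_edge_color col s t = col (the_elem (t - s))"

definition is_rank_function :: "('a \<Rightarrow> 'a \<Rightarrow> bool) \<Rightarrow> 'a set \<Rightarrow> ('a \<Rightarrow> nat) \<Rightarrow> nat \<Rightarrow> bool" where
  "is_rank_function E C r l \<longleftrightarrow>
     r ` C = {0..l} \<and> (\<forall>x\<in>C. \<forall>y\<in>C. E x y \<longrightarrow> r y = r x + 1)"

text \<open>
  Rank and length with respect to the edge relation \<open>E\<close>; well defined when \<open>C\<close> is
  connected by \<open>E\<close> and has a rank function, which is then unique on \<open>C\<close>.
\<close>

definition rank_wrt :: "('a \<Rightarrow> 'a \<Rightarrow> bool) \<Rightarrow> 'a set \<Rightarrow> 'a \<Rightarrow> nat" where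
  "rank_wrt E C x = (THE k. \<exists>r l. is_rank_function E C r l \<and> r x = k)"

definition length_wrt :: "('a \<Rightarrow> 'a \<Rightarrow> bool) \<Rightarrow> 'a set \<Rightarrow> nat" where
  "length_wrt E C = (THE l. \<exists>r. is_rank_function E C r l)"

definition ranked_poset :: "'a::order set \<Rightarrow> bool" where
  "ranked_poset R \<longleftrightarrow> (\<exists>r l. is_rank_function (covers_in R) R r l)"

definition color_edge :: "'a::order set \<Rightarrow> ('a \<Rightarrow> 'a \<Rightarrow> 'c) \<Rightarrow> 'c \<Rightarrow> 'a \<Rightarrow> 'a \<Rightarrow> bool" where
  "color_edge R ec i s t \<longleftrightarrow> covers_in R s t \<and> ec s t = i"

definition color_comp :: "'a::order set \<Rightarrow> ('a \<Rightarrow> 'a \<Rightarrow> 'c) \<Rightarrow> 'c \<Rightarrow> 'a \<Rightarrow> 'a set" where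
  "color_comp R ec i x = {y \<in> R. equivclp (color_edge R ec i) x y}"

definition color_weight :: "'a::order set \<Rightarrow> ('a \<Rightarrow> 'a \<Rightarrow> 'c) \<Rightarrow> 'c \<Rightarrow> 'a \<Rightarrow> int" where
  "color_weight R ec i x =
     2 * int (rank_wrt (color_edge R ec i) (color_comp R ec i x) x)
       - int (length_wrt (color_edge R ec i) (color_comp R ec i x))"

text \<open>The edge colors are the simple roots themselves.\<close>

definition wt ::
  "'a::order set \<Rightarrow> ('a \<Rightarrow> 'a \<Rightarrow> 'v) \<Rightarrow> 'v::euclidean_space \<Rightarrow> 'v \<Rightarrow> 'a \<Rightarrow> 'v" where
  "wt R ec \<alpha> \<beta> x =
     of_int (color_weight R ec \<alpha> x) *\<^sub>R fund_weight \<alpha> \<beta> +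
     of_int (color_weight R ec \<beta> x) *\<^sub>R fund_weight \<beta> \<alpha>"

definition M_structured ::
  "'a::order set \<Rightarrow> ('a \<Rightarrow> 'a \<Rightarrow> 'v) \<Rightarrow> 'v::euclidean_space \<Rightarrow> 'v \<Rightarrow> bool" where
  "M_structured R ec \<alpha> \<beta> \<longleftrightarrow>
     (\<forall>i\<in>{\<alpha>, \<beta>}. \<forall>s t. color_edge R ec i s t \<longrightarrow> wt R ec \<alpha> \<beta> s + i = wt R ec \<alpha> \<beta> t)"

definition WGF ::
  "'a::order set \<Rightarrow> ('a \<Rightarrow> 'a \<Rightarrow> 'v) \<Rightarrow> 'v::euclidean_space \<Rightarrow> 'v \<Rightarrow> 'v \<Rightarrow>\<^sub>0 int" where
  "WGF R ec \<alpha> \<beta> = (\<Sum>x\<in>R. formal_exp (wt R ec \<alpha> \<beta> x))"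

definition splitting_poset ::
  "'a::order set \<Rightarrow> ('a \<Rightarrow> 'a \<Rightarrow> 'v) \<Rightarrow> 'v::euclidean_space \<Rightarrow> 'v \<Rightarrow> ('v \<Rightarrow>\<^sub>0 int) \<Rightarrow> bool" where
  "splitting_poset R ec \<alpha> \<beta> \<xi> \<longleftrightarrow>
     finite R \<and> ranked_poset R \<and> (\<forall>s t. covers_in R s t \<longrightarrow> ec s t \<in> {\<alpha>, \<beta>}) \<and>
     M_structured R ec \<alpha> \<beta> \<and> WGF R ec \<alpha> \<beta> = \<xi>"

definition poset_gorder :: "'a::order set \<Rightarrow> 'a gorder" where
  "poset_gorder R = \<lparr>carrier = R, eq = (=), le = (\<le>)\<rparr>"

definition distributive_lattice :: "'a gorder \<Rightarrow> bool" where
  "distributive_lattice G \<longleftrightarrow>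
     Lattice.lattice G \<and>
     (\<forall>x\<in>carrier G. \<forall>y\<in>carrier G. \<forall>z\<in>carrier G.
        x \<sqinter>\<^bsub>G\<^esub> (y \<squnion>\<^bsub>G\<^esub> z) = (x \<sqinter>\<^bsub>G\<^esub> y) \<squnion>\<^bsub>G\<^esub> (x \<sqinter>\<^bsub>G\<^esub> z))"

definition splitting_distributive_lattice ::
  "'a::order set \<Rightarrow> ('a \<Rightarrow> 'a \<Rightarrow> 'v) \<Rightarrow> 'v::euclidean_space \<Rightarrow> 'v \<Rightarrow> ('v \<Rightarrow>\<^sub>0 int) \<Rightarrow> bool" where
  "splitting_distributive_lattice R ec \<alpha> \<beta> \<xi> \<longleftrightarrow>
     splitting_poset R ec \<alpha> \<beta> \<xi> \<and> distributive_lattice (poset_gorder R)"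

definition poset_length :: "'a::order set \<Rightarrow> nat" where
  "poset_length R = length_wrt (covers_in R) R"

definition RGF :: "'a::order set \<Rightarrow> int poly" where
  "RGF R = (\<Sum>i\<le>poset_length R.
     monom (int (card {x \<in> R. rank_wrt (covers_in R) R x = i})) i)"

definition rank_symmetric :: "'a::order set \<Rightarrow> bool" where
  "rank_symmetric R \<longleftrightarrow>
     (\<forall>i\<le>poset_length R. coeff (RGF R) i = coeff (RGF R) (poset_length R - i))"

definition rank_unimodal :: "'a::order set \<Rightarrow> bool" where
  "rank_unimodal R \<longleftrightarrow>
     (\<exists>p\<le>poset_length R.
        (\<forall>i<p. coeff (RGF R) i \<le> coeff (RGF R) (i + 1)) \<and>
        (\<forall>i. p \<le> i \<and> i < poset_length R \<longrightarrow> coeff (RGF R) (i + 1) \<le> coeff (RGF R) i))"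

text \<open>The indeterminate \<open>q\<close>, in the field of fractions of \<open>\<int>[q]\<close>.\<close>

definition qvar :: "int poly fract" where
  "qvar = to_fract [:0, 1:]"

end

theory Submission
  imports Defs
begin

text \<open>
  Record an order ideal by the heights that it reaches in the chains. The structure condition makes
  the reflection of these heights along one color realize a simple reflection of the weights, so the
  weights form a Weyl invariant multiset. In the product of \<open>\<A>(e\<^sup>\<rho>)\<close> with the weight
  generating function all terms but those of the maximal ideal cancel, by an involution that reflects
  the heights up to a critical chain. Hence the generating function is the bialternant, and grading
  the weights by height gives the rank generating function through the denominator identity;
  the longest Weyl group element gives rank symmetry. For unimodality, the irreducible module with
  highest weight \<open>\<lambda>\<close> is realized on functions on words; the numbers of ideals of a given weight
  satisfy Freudenthal's recursion and so are its weight multiplicities, and raising operators of the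
  principal three-dimensional subalgebra force these to increase up to the middle level.
\<close>

section \<open>Highest weight modules on words\<close>

text \<open>Functions on words form the module coinduced from the free algebra of the raising
  operators: \<open>E i\<close> strips a letter, and \<open>F i\<close> is then forced. A function
  is determined by the values at the empty word of its images under products of raising operators,
  so the only singular vectors are multiples of \<open>vac\<close>. Hence the \<open>F i\<close>
  obey the Serre relations without passing to a quotient, and the weight spaces of the submodule
  generated by \<open>vac\<close> are spans of monomials. The obstacle is that the lattice carries
  no evident action of the Lie algebra; its weights can only be counted. The bridge is the Weyl
  denominator: its product with the counting function lives on the orbit of \<lambda> + \<rho>,
  where the Casimir eigenvalue vanishes, and this suffices for Freudenthal's recursion. The
  recursion determines the counts because the eigenvalue is positive at all weights below the
  highest one. The max property enters twice: it makes colors alternate along the chains even across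
  connected components, so that a color is a parity, and it makes the maximal ideal the only one
  without a critical chain.\<close>

typedef word_fun = "UNIV :: (bool list \<Rightarrow> real) set"
  morphisms at_word Word_fun by simp

setup_lifting type_definition_word_fun

instantiation word_fun :: real_vector
begin
lift_definition zero_word_fun :: word_fun is "\<lambda>_. 0" .
lift_definition plus_word_fun :: "word_fun \<Rightarrow> word_fun \<Rightarrow> word_fun" is "\<lambda>f g w. f w + g w" .
lift_definition minus_word_fun :: "word_fun \<Rightarrow> word_fun \<Rightarrow> word_fun" is "\<lambda>f g w. f w - g w" .
lift_definition uminus_word_fun :: "word_fun \<Rightarrow> word_fun" is "\<lambda>f w. - f w" .
lift_definition scaleR_word_fun :: "real \<Rightarrow> word_fun \<Rightarrow> word_fun" is "\<lambda>c f w. c * f w" .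
instance by standard (transfer, simp add: fun_eq_iff algebra_simps)+
end

lemma word_fun_eqI: "(\<And>w. at_word f w = at_word g w) \<Longrightarrow> f = g"
  by transfer auto

lemma at_word_simps [simp]:
  "at_word 0 w = 0" "at_word (f + g) w = at_word f w + at_word g w"
  "at_word (f - g) w = at_word f w - at_word g w" "at_word (- f) w = - at_word f w"
  "at_word (c *\<^sub>R f) w = c * at_word f w"
  by (transfer, simp)+

text \<open>Bundling the linear endomorphisms into an algebra type lets commutator identities be
  computed by ring simplification; \<open>app\<close> leads back to functions.\<close>

typedef word_op = "{f :: word_fun \<Rightarrow> word_fun. linear f}"
  morphisms app Word_op by (rule exI[of _ id]) (simp add: id_def linear_iff)

setup_lifting type_definition_word_op

instantiation word_op :: real_algebra_1
begin
lift_definition zero_word_op :: word_op is "\<lambda>_. 0" by (simp add: linear_iff)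
lift_definition one_word_op :: word_op is "\<lambda>f. f" by (simp add: linear_iff)
lift_definition plus_word_op :: "word_op \<Rightarrow> word_op \<Rightarrow> word_op" is "\<lambda>x y f. x f + y f"
  by (simp add: linear_iff algebra_simps)
lift_definition minus_word_op :: "word_op \<Rightarrow> word_op \<Rightarrow> word_op" is "\<lambda>x y f. x f - y f"
  by (simp add: linear_iff algebra_simps)
lift_definition uminus_word_op :: "word_op \<Rightarrow> word_op" is "\<lambda>x f. - x f"
  by (simp add: linear_iff algebra_simps)
lift_definition times_word_op :: "word_op \<Rightarrow> word_op \<Rightarrow> word_op" is "\<lambda>x y f. x (y f)"
  by (simp add: linear_iff algebra_simps)
lift_definition scaleR_word_op :: "real \<Rightarrow> word_op \<Rightarrow> word_op" is "\<lambda>c x f. c *\<^sub>R x f"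
  by (simp add: linear_iff algebra_simps)
instance
proof
  show "(0::word_op) \<noteq> 1"
  proof
    assume "(0::word_op) = 1"
    then have "(0::word_fun) = Word_fun (\<lambda>_. 1)" by transfer meson
    then have "(\<lambda>_. 0::real) = (\<lambda>_::bool list. 1)" by transfer
    then show False by (simp add: fun_eq_iff)
  qed
qed (transfer, simp add: fun_eq_iff algebra_simps linear_iff)+
end

lemma linear_app [simp]: "linear (app x)"
  using app by blast

lemma app_simps [simp]:
  "app 0 f = 0" "app 1 f = f" "app (x + y) f = app x f + app y f" "app (x - y) f = app x f - app y f"
  "app (- x) f = - app x f" "app (x * y) f = app x (app y f)" "app (c *\<^sub>R x) f = c *\<^sub>R app x f"
  by (simp_all add: zero_word_op.rep_eq one_word_op.rep_eq plus_word_op.rep_eq minus_word_op.rep_eq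
      uminus_word_op.rep_eq times_word_op.rep_eq scaleR_word_op.rep_eq)

lemma app_linear [simp]:
  "app x 0 = 0" "app x (f + g) = app x f + app x g" "app x (f - g) = app x f - app x g"
  "app x (- f) = - app x f" "app x (c *\<^sub>R f) = c *\<^sub>R app x f"
  using linear_app[of x] by (simp_all add: linear_0 linear_add linear_diff linear_neg linear_cmul)

lemma word_op_eqI: "(\<And>f w. at_word (app x f) w = at_word (app y f) w) \<Longrightarrow> x = y"
  using word_fun_eqI by (metis app_inverse ext)

definition br :: "word_op \<Rightarrow> word_op \<Rightarrow> word_op" where
  "br x y = x * y - y * x"

lemma br_simps:
  "br (x + y) z = br x z + br y z" "br x (y + z) = br x y + br x z"
  "br (x - y) z = br x z - br y z" "br x (y - z) = br x y - br x z"
  "br (- x) z = - br x z" "br x (- z) = - br x z"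
  "br (c *\<^sub>R x) z = c *\<^sub>R br x z" "br x (c *\<^sub>R z) = c *\<^sub>R br x z"
  "br x x = 0" "br 0 z = 0" "br x 0 = 0"
  by (simp_all add: br_def algebra_simps)

lemma br_swap: "br x y = - br y x"
  by (simp add: br_def)

lemma jacobi_left: "br (br x y) z = br (br x z) y + br x (br y z)"
  and jacobi_right: "br x (br y z) = br (br x y) z + br y (br x z)"
  by (simp_all add: br_def algebra_simps)

section \<open>Raising, lowering and Cartan operators on functions on words\<close>

primrec word_weight :: "(bool \<Rightarrow> real) \<Rightarrow> (bool \<Rightarrow> bool \<Rightarrow> real) \<Rightarrow> bool \<Rightarrow> bool list \<Rightarrow> real" where
  "word_weight l A i [] = l i"
| "word_weight l A i (j # w) = word_weight l A i w - A i j"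

text \<open>The recursion is forced. Prepending the letter \<open>j\<close> to the argument is the
  raising operator, so the second clause is the relation that \<open>E j\<close> and
  \<open>F i\<close> commute up to \<open>H i\<close> when \<open>i = j\<close>, read at
  \<open>w\<close>; the first clause makes every lowered function vanish at the empty word.
  Unfolded, one occurrence of \<open>i\<close> is deleted at a time, weighted by the weight of the
  suffix behind it.\<close>

primrec lowering :: "(bool \<Rightarrow> real) \<Rightarrow> (bool \<Rightarrow> bool \<Rightarrow> real) \<Rightarrow> bool \<Rightarrow> bool list \<Rightarrow> (bool list \<Rightarrow> real) \<Rightarrow> real" where
  "lowering l A i [] g = 0"
| "lowering l A i (j # w) g =
     lowering l A i w (\<lambda>v. g (j # v)) + (if i = j then word_weight l A i w * g w else 0)"

lemma lowering_linear:
  "lowering l A i w (\<lambda>v. f v + g v) = lowering l A i w f + lowering l A i w g"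
  "lowering l A i w (\<lambda>v. c * g v) = c * lowering l A i w g"
  by (induction w arbitrary: f g) (auto simp: algebra_simps)

text \<open>The commutator of \<open>H i\<close> with \<open>F j\<close>, before operators are
  available. The constant \<open>c\<close> is carried along because each letter passed in the
  induction shifts the weight by an entry of \<open>A\<close>.\<close>

lemma lowering_weight:
  "lowering l A j w (\<lambda>v. (word_weight l A i v + c) * g v)
     = (word_weight l A i w + c + A i j) * lowering l A j w g"
proof (induction w arbitrary: c g)
  case (Cons k w)
  have "(\<lambda>v. (word_weight l A i v - A i k + c) * g (k # v)) = (\<lambda>v. (word_weight l A i v + (c - A i k)) * g (k # v))"
    by (simp add: algebra_simps)
  then have "lowering l A j w (\<lambda>v. (word_weight l A i v - A i k + c) * g (k # v))
      = (word_weight l A i w + (c - A i k) + A i j) * lowering l A j w (\<lambda>v. g (k # v))"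
    using Cons.IH[of "c - A i k" "\<lambda>v. g (k # v)"] by simp
  then show ?case
    by (simp only: lowering.simps word_weight.simps) (simp add: algebra_simps)
qed simp

locale word_module =
  fixes l :: "bool \<Rightarrow> real" and A :: "bool \<Rightarrow> bool \<Rightarrow> real"
begin

lift_definition F_fun :: "bool \<Rightarrow> word_fun \<Rightarrow> word_fun" is "\<lambda>i g w. lowering l A i w g" .
lift_definition E_fun :: "bool \<Rightarrow> word_fun \<Rightarrow> word_fun" is "\<lambda>i g w. g (i # w)" .
lift_definition H_fun :: "bool \<Rightarrow> word_fun \<Rightarrow> word_fun" is "\<lambda>i g w. word_weight l A i w * g w" .

lift_definition F :: "bool \<Rightarrow> word_op" is F_fun
  by (simp add: linear_iff, transfer, simp add: lowering_linear fun_eq_iff)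
lift_definition E :: "bool \<Rightarrow> word_op" is E_fun
  by (simp add: linear_iff, transfer, simp add: fun_eq_iff)
lift_definition H :: "bool \<Rightarrow> word_op" is H_fun
  by (simp add: linear_iff, transfer, simp add: fun_eq_iff algebra_simps)

lemma at_word_ops:
  "at_word (app (F i) g) w = lowering l A i w (at_word g)"
  "at_word (app (E i) g) w = at_word g (i # w)"
  "at_word (app (H i) g) w = word_weight l A i w * at_word g w"
  by (simp_all add: F.rep_eq E.rep_eq H.rep_eq F_fun.rep_eq E_fun.rep_eq H_fun.rep_eq)

lemma br_E_F: "br (E j) (F i) = (if i = j then H i else 0)"
  by (rule word_op_eqI) (auto simp: br_def at_word_ops algebra_simps E_fun.rep_eq E.rep_eq)

lemma br_H_F: "br (H i) (F j) = - A i j *\<^sub>R F j"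
proof (rule word_op_eqI)
  fix f w
  have "at_word (app (F j) (app (H i) f)) w = (word_weight l A i w + A i j) * lowering l A j w (at_word f)"
    using lowering_weight[of l A j w i 0 "at_word f"]
    by (simp add: at_word_ops(1) at_word_ops(3)[abs_def] H.rep_eq H_fun.rep_eq)
  then show "at_word (app (br (H i) (F j)) f) w = at_word (app (- A i j *\<^sub>R F j) f) w"
    by (simp add: br_def at_word_ops algebra_simps)
qed

lemma br_H_E: "br (H i) (E j) = A i j *\<^sub>R E j"
  by (rule word_op_eqI) (simp add: br_def at_word_ops algebra_simps)

text \<open>Reading a function at \<open>i # w\<close> is reading its image under \<open>E i\<close>
  at \<open>w\<close>, so an operator that commutes with both raising operators is determined by
  what it does at the empty word. This is the source of the Serre relations for the lowering
  operators.\<close>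

lemma central_eq_0:
  assumes "\<And>f. at_word (app T f) [] = 0" and "\<And>i. br (E i) T = 0"
  shows "T = 0"
proof (rule word_op_eqI)
  fix f w
  show "at_word (app T f) w = at_word (app 0 f) w"
  proof (induction w arbitrary: f)
    case Nil
    then show ?case using assms(1) by simp
  next
    case (Cons i w)
    have "E i * T = T * E i" using assms(2)[of i] by (simp add: br_def)
    then have "app (E i) (app T f) = app T (app (E i) f)"
      by (metis app_simps(6))
    then show ?case using Cons[of "app (E i) f"] by (metis at_word_ops(2) at_word_simps(1) app_simps(1))
  qed
qed

lift_definition vac :: word_fun is "\<lambda>w. if w = [] then 1 else 0" .

primrec mono :: "bool list \<Rightarrow> word_fun" where
  "mono [] = vac"
| "mono (i # w) = app (F i) (mono w)"

definition dg :: "bool \<Rightarrow> int \<times> int" where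
  "dg i = (if i then (1, 0) else (0, 1))"

primrec deg :: "bool list \<Rightarrow> int \<times> int" where
  "deg [] = 0"
| "deg (i # w) = deg w + dg i"

text \<open>The weight space, in the submodule generated by \<open>vac\<close>, for the highest
  weight minus the combination of simple roots with coefficients \<open>p\<close>.\<close>

definition V :: "int \<times> int \<Rightarrow> word_fun set" where
  "V p = span (mono ` {w. deg w = p})"

definition hw :: "bool \<Rightarrow> int \<times> int \<Rightarrow> real" where
  "hw i p = l i - A i True * of_int (fst p) - A i False * of_int (snd p)"

lemma hw_dg: "hw i (p + dg j) = hw i p - A i j"
  by (cases j) (simp_all add: hw_def dg_def algebra_simps)

lemma hw_deg: "word_weight l A i w = hw i (deg w)"
  by (induction w) (simp_all add: hw_dg, simp add: hw_def)

text \<open>The value at \<open>w\<close> involves \<open>g\<close> only at words obtained from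
  \<open>w\<close> by deleting one letter \<open>i\<close>.\<close>

lemma lowering_support:
  assumes "\<And>w. g w \<noteq> 0 \<Longrightarrow> deg w = p" and "lowering l A i w g \<noteq> 0"
  shows "deg w = p + dg i"
  using assms
proof (induction w arbitrary: g p)
  case (Cons j w)
  have "deg w = p + dg i - dg j \<or> i = j \<and> g w \<noteq> 0"
  proof (cases "lowering l A i w (\<lambda>v. g (j # v)) = 0")
    case True
    then show ?thesis using Cons.prems(2) by (auto split: if_splits)
  next
    case False
    have "\<And>v. g (j # v) \<noteq> 0 \<Longrightarrow> deg v = p - dg j" using Cons.prems(1) by fastforce
    from Cons.IH[OF this False] show ?thesis by simp
  qed
  then show ?case using Cons.prems(1) by auto
qed simp

lemma mono_support: "at_word (mono u) w \<noteq> 0 \<Longrightarrow> deg w = deg u"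
proof (induction u arbitrary: w)
  case Nil
  then show ?case by (simp add: vac.rep_eq split: if_splits)
next
  case (Cons i u)
  show ?case
    using lowering_support[of "at_word (mono u)" "deg u" i w] Cons by (auto simp: at_word_ops)
qed

lemma subspace_V: "subspace (V p)"
  by (simp add: V_def)

lemma V_support:
  assumes "f \<in> V p" and "at_word f w \<noteq> 0" shows "deg w = p"
proof -
  have "f \<in> {f. \<forall>w. at_word f w \<noteq> 0 \<longrightarrow> deg w = p}"
  proof (rule span_subspace_induct[OF assms(1)[unfolded V_def]])
    show "subspace {f. \<forall>w. at_word f w \<noteq> 0 \<longrightarrow> deg w = p}"
    proof (rule subspaceI)
      fix x y assume "x \<in> {f. \<forall>w. at_word f w \<noteq> 0 \<longrightarrow> deg w = p}" "y \<in> {f. \<forall>w. at_word f w \<noteq> 0 \<longrightarrow> deg w = p}"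
      then have "at_word x w = 0 \<and> at_word y w = 0" if "deg w \<noteq> p" for w using that by auto
      then show "x + y \<in> {f. \<forall>w. at_word f w \<noteq> 0 \<longrightarrow> deg w = p}" by fastforce
    qed auto
    show "f \<in> {f. \<forall>w. at_word f w \<noteq> 0 \<longrightarrow> deg w = p}" if "f \<in> mono ` {w. deg w = p}" for f
      using that by (auto dest: mono_support)
  qed
  then show ?thesis using assms(2) by blast
qed

lemma H_V:
  assumes "f \<in> V p" shows "app (H i) f = hw i p *\<^sub>R f"
proof (rule word_fun_eqI)
  fix w
  show "at_word (app (H i) f) w = at_word (hw i p *\<^sub>R f) w"
    using V_support[OF assms, of w] unfolding at_word_ops at_word_simps hw_deg by fastforce
qed

lemma mono_V: "mono w \<in> V (deg w)"
  unfolding V_def by (rule span_base) simp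

lemma op_V:
  assumes "\<And>w. deg w = p \<Longrightarrow> app x (mono w) \<in> V q" and "f \<in> V p"
  shows "app x f \<in> V q"
proof -
  have "f \<in> {f. app x f \<in> V q}"
  proof (rule span_subspace_induct[OF assms(2)[unfolded V_def]])
    show "subspace {f. app x f \<in> V q}"
      using subspace_V[of q] by (simp add: subspace_def)
  qed (use assms(1) in auto)
  then show ?thesis by simp
qed

lemma F_V: "f \<in> V p \<Longrightarrow> app (F i) f \<in> V (p + dg i)"
proof (rule op_V[where p = p])
  show "app (F i) (mono w) \<in> V (p + dg i)" if "deg w = p" for w
    using mono_V[of "i # w"] that by simp
qed

lemma E_vac: "app (E i) vac = 0"
  by (rule word_fun_eqI) (simp add: at_word_ops vac.rep_eq)

lemma E_F_app: "app (E j) (app (F i) f) = app (F i) (app (E j) f) + (if i = j then app (H i) f else 0)"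
proof -
  have "E j * F i = F i * E j + (if i = j then H i else 0)"
    using br_E_F[of j i] by (simp add: br_def algebra_simps)
  then have "app (E j * F i) f = app (F i * E j + (if i = j then H i else 0)) f" by simp
  then show ?thesis by (cases "i = j") simp_all
qed

lemma E_mono: "app (E j) (mono w) \<in> V (deg w - dg j)"
proof (induction w)
  case Nil
  then show ?case using subspace_V by (simp add: E_vac subspace_0)
next
  case (Cons i w)
  have "app (F i) (app (E j) (mono w)) \<in> V (deg (i # w) - dg j)"
    using F_V[OF Cons.IH, of i] by (simp add: algebra_simps)
  moreover have "i = j \<Longrightarrow> app (H i) (mono w) \<in> V (deg (i # w) - dg j)"
    using H_V[OF mono_V] mono_V subspace_V[of "deg w"] by (auto simp: subspace_def)
  moreover have "app (E j) (mono (i # w)) = app (F i) (app (E j) (mono w)) + (if i = j then app (H i) (mono w) else 0)"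
    by (simp only: mono.simps E_F_app)
  ultimately show ?case
    using subspace_add[OF subspace_V] by (cases "i = j") (simp_all only: if_True if_False add_0_right simp_thms)
qed

lemma E_V: "f \<in> V p \<Longrightarrow> app (E i) f \<in> V (p - dg i)"
proof (rule op_V[where p = p])
  show "app (E i) (mono w) \<in> V (p - dg i)" if "deg w = p" for w
    using E_mono[of i w] that by simp
qed

end

section \<open>Serre relations, local nilpotence and reflection of weights\<close>

context word_module begin

lemma br_app: "app x (app y f) = app y (app x f) + app (br x y) f"
  by (simp add: br_def)

fun adF :: "bool \<Rightarrow> bool \<Rightarrow> nat \<Rightarrow> word_op" where
  "adF i j 0 = F j"
| "adF i j (Suc k) = br (F i) (adF i j k)"

lemma adF_Nil: "at_word (app (adF i j k) f) [] = 0"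
  by (induction k arbitrary: f) (simp_all add: br_def at_word_ops)

lemma br_H_adF: "br (H h) (adF i j k) = - (A h j + real k * A h i) *\<^sub>R adF i j k"
proof (induction k)
  case (Suc k)
  show ?case
    by (rule word_op_eqI) (simp add: jacobi_right[of "H h"] br_H_F Suc br_simps algebra_simps)
qed (simp add: br_H_F)

text \<open>Every value at a nonempty word is a value of some \<open>app (E i) f\<close>. Singular
  vectors are therefore detected at the empty word, where everything that has been lowered
  vanishes.\<close>

lemma fun_eq_0:
  assumes "at_word f [] = 0" and "\<And>i. app (E i) f = 0" shows "f = 0"
proof (rule word_fun_eqI)
  fix w show "at_word f w = at_word 0 w"
  proof (cases w)
    case (Cons i v)
    then show ?thesis using at_word_ops(2)[of i f v] assms(2)[of i] by simp
  qed (simp add: assms(1))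
qed

definition ray :: "bool \<Rightarrow> int \<Rightarrow> int \<times> int" where
  "ray i n = (if i then (n, 0) else (0, n))"

lemma ray_simps: "ray i 0 = 0" "dg i = ray i 1" "ray i m + ray i n = ray i (m + n)"
  "ray i m - ray i n = ray i (m - n)"
  by (simp_all add: ray_def dg_def zero_prod_def)

lemma hw_ray: "hw i (p + ray j n) = hw i p - of_int n * A i j"
  by (cases j) (simp_all add: hw_def ray_def algebra_simps)

lemma F_pow_V:
  assumes "f \<in> V p" shows "(app (F i) ^^ n) f \<in> V (p + ray i (int n))"
proof (induction n)
  case (Suc n)
  have "p + ray i (int n) + dg i = p + ray i (int (Suc n))"
    by (simp add: ray_def dg_def)
  then show ?case using F_V[OF Suc.IH, of i] by (simp only: funpow.simps comp_apply)
qed (simp add: ray_simps assms)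

lemma E_pow_V:
  assumes "f \<in> V p" shows "(app (E i) ^^ n) f \<in> V (p - ray i (int n))"
proof (induction n)
  case (Suc n)
  have "p - ray i (int n) - dg i = p - ray i (int (Suc n))"
    by (simp add: ray_def dg_def)
  then show ?case using E_V[OF Suc.IH, of i] by (simp only: funpow.simps comp_apply)
qed (simp add: ray_simps assms)

end

locale cartan_module = word_module +
  fixes a :: "bool \<Rightarrow> nat" and N :: "bool \<Rightarrow> bool \<Rightarrow> nat"
  assumes l_eq: "l i = real (a i)" and A_diag: "A i i = 2"
    and A_off: "i \<noteq> j \<Longrightarrow> A i j = - real (N i j)" and N_zero: "i \<noteq> j \<Longrightarrow> N i j = 0 \<Longrightarrow> N j i = 0"
begin

text \<open>The usual string computation: under the adjoint action of the \<open>i\<close>-th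
  three-dimensional subalgebra, \<open>F j\<close> is a highest weight vector of weight
  \<open>N i j\<close>.\<close>

lemma br_E_adF_same:
  assumes "i \<noteq> j"
  shows "br (E i) (adF i j (Suc k)) = (real (Suc k) * (real (N i j) - real k)) *\<^sub>R adF i j k"
proof (induction k)
  case 0
  have "j \<noteq> i" using assms by blast
  then show ?case
    using assms by (simp only: adF.simps jacobi_right[of "E i"] br_E_F br_H_F A_off br_simps if_True if_False simp_thms) simp
next
  case (Suc k)
  have "br (E i) (adF i j (Suc (Suc k)))
      = br (H i) (adF i j (Suc k)) + br (F i) (br (E i) (adF i j (Suc k)))"
    by (subst adF.simps(2)) (simp only: jacobi_right[of "E i"] br_E_F if_True refl)
  also have "\<dots> = (real (N i j) - 2 * real (Suc k)) *\<^sub>R adF i j (Suc k)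
      + (real (Suc k) * (real (N i j) - real k)) *\<^sub>R adF i j (Suc k)"
    by (simp only: Suc br_simps br_H_adF A_off[OF assms] A_diag adF.simps(2)[symmetric]) (simp add: algebra_simps)
  also have "\<dots> = (real (Suc (Suc k)) * (real (N i j) - real (Suc k))) *\<^sub>R adF i j (Suc k)"
    by (simp only: scaleR_left_distrib[symmetric]) (simp add: algebra_simps)
  finally show ?case .
qed

lemma br_E_adF_other:
  assumes "i \<noteq> j"
  shows "br (E j) (adF i j (Suc k)) = (if k = 0 then A j i *\<^sub>R F i else 0)"
proof (induction k)
  case 0
  have "br (F i) (H j) = A j i *\<^sub>R F i" using br_H_F[of j i] by (simp add: br_swap[of "F i"])
  then show ?case
    using assms by (simp only: adF.simps jacobi_right[of "E j"] br_E_F br_simps if_True if_False add_0 simp_thms)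
next
  case (Suc k)
  have "br (E j) (adF i j (Suc (Suc k))) = br (F i) (br (E j) (adF i j (Suc k)))"
    using assms by (subst adF.simps(2)) (simp only: jacobi_right[of "E j"] br_E_F if_False br_simps add_0)
  then show ?case using Suc by (simp add: br_simps)
qed

text \<open>Both commutators with raising operators vanish: the one with \<open>E i\<close> through
  its factor \<open>N i j - k\<close> at \<open>k = N i j\<close>, the one with \<open>E j\<close>
  automatically if \<open>N i j\<close> is positive and through \<open>N_zero\<close>
  otherwise.\<close>

lemma serre_F:
  assumes "i \<noteq> j" shows "adF i j (Suc (N i j)) = 0"
proof (rule central_eq_0[OF adF_Nil])
  fix h
  consider "h = i" | "h = j" using assms by (cases h; cases i; cases j) auto
  then show "br (E h) (adF i j (Suc (N i j))) = 0"
  proof cases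
    case 1
    then show ?thesis using br_E_adF_same[OF assms, of "N i j"] by simp
  next
    case 2
    then show ?thesis
      using br_E_adF_other[OF assms, of "N i j"] N_zero[OF assms] A_off[OF assms[symmetric]] by simp
  qed
qed

lemma hw_0: "hw i 0 = real (a i)"
  by (simp add: hw_def l_eq)

definition nilp :: "bool \<Rightarrow> word_fun \<Rightarrow> bool" where
  "nilp i f \<longleftrightarrow> (\<exists>n. (app (F i) ^^ n) f = 0)"

lemma F_pow_0: "(app x ^^ n) 0 = 0"
  by (induction n) simp_all

lemma F_pow_mono: "(app x ^^ m) f = 0 \<Longrightarrow> m \<le> n \<Longrightarrow> (app x ^^ n) f = 0"
  by (metis F_pow_0 comp_apply funpow_add le_add_diff_inverse2)

lemma F_pow_linear: "(app x ^^ n) (f + g) = (app x ^^ n) f + (app x ^^ n) g"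
  "(app x ^^ n) (c *\<^sub>R f) = c *\<^sub>R (app x ^^ n) f"
  by (induction n) simp_all

lemma nilp_linear: "nilp i f \<Longrightarrow> nilp i g \<Longrightarrow> nilp i (f + g)" "nilp i f \<Longrightarrow> nilp i (c *\<^sub>R f)"
proof -
  assume "nilp i f" "nilp i g"
  then obtain m n where "(app (F i) ^^ m) f = 0" "(app (F i) ^^ n) g = 0" by (auto simp: nilp_def)
  then have "(app (F i) ^^ (max m n)) (f + g) = 0"
    by (simp add: F_pow_linear F_pow_mono)
  then show "nilp i (f + g)" by (auto simp: nilp_def)
qed (auto simp: nilp_def F_pow_linear)

text \<open>Downward induction on \<open>k\<close> from the Serre relation. Moving
  \<open>F i\<close> across \<open>adF i j k\<close> produces \<open>adF i j (Suc k)\<close>, which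
  is covered by the outer induction, while the nilpotency order of \<open>f\<close> drops in the
  inner one.\<close>

lemma nilp_adF:
  assumes "i \<noteq> j"
  shows "k \<le> Suc (N i j) \<Longrightarrow> nilp i f \<Longrightarrow> nilp i (app (adF i j k) f)"
proof (induction k arbitrary: f rule: inc_induct)
  case base
  then show ?case using serre_F[OF assms] by (auto simp: nilp_def intro: exI[of _ 0])
next
  case (step k)
  obtain n where "(app (F i) ^^ n) f = 0" using step.prems by (auto simp: nilp_def)
  then show ?case
  proof (induction n arbitrary: f)
    case 0
    then show ?case by (auto simp: nilp_def intro: exI[of _ 0])
  next
    case (Suc n)
    have f: "nilp i f" using Suc.prems unfolding nilp_def by blast
    have "(app (F i) ^^ n) (app (F i) f) = 0" using Suc.prems by (simp add: funpow_swap1)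
    then have "nilp i (app (adF i j k) (app (F i) f))" by (rule Suc.IH)
    moreover have "nilp i (app (adF i j (Suc k)) f)" using step.IH f by blast
    ultimately have "nilp i (app (F i) (app (adF i j k) f))"
      by (simp add: br_app[of "F i"] nilp_linear)
    then show ?case unfolding nilp_def by (metis comp_apply funpow_Suc_right)
  qed
qed

lemma E_F_pow_vac:
  "app (E i) ((app (F i) ^^ Suc n) vac) = (real (Suc n) * (real (a i) - real n)) *\<^sub>R (app (F i) ^^ n) vac"
proof (induction n)
  case 0
  have "vac \<in> V 0" using mono_V[of "[]"] by simp
  then show ?case by (simp add: E_F_app E_vac H_V[of vac 0] hw_0)
next
  case (Suc n)
  have "vac \<in> V 0" using mono_V[of "[]"] by simp
  then have "app (H i) ((app (F i) ^^ Suc n) vac) = hw i (0 + ray i (int (Suc n))) *\<^sub>R (app (F i) ^^ Suc n) vac"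
    by (rule H_V[OF F_pow_V])
  moreover have "hw i (0 + ray i (int (Suc n))) = real (a i) - 2 * real (Suc n)"
    unfolding hw_ray hw_0 A_diag by simp
  ultimately have "app (H i) ((app (F i) ^^ Suc n) vac) = (real (a i) - 2 * real (Suc n)) *\<^sub>R (app (F i) ^^ Suc n) vac"
    by (simp only:)
  moreover have "app (E i) ((app (F i) ^^ Suc (Suc n)) vac)
      = app (F i) (app (E i) ((app (F i) ^^ Suc n) vac)) + app (H i) ((app (F i) ^^ Suc n) vac)"
    using E_F_app[of i i "(app (F i) ^^ Suc n) vac"] by (simp only: funpow.simps(2)[of "Suc n"] comp_apply if_True simp_thms)
  moreover have "app (F i) (app (E i) ((app (F i) ^^ Suc n) vac))
      = (real (Suc n) * (real (a i) - real n)) *\<^sub>R (app (F i) ^^ Suc n) vac"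
    unfolding Suc.IH app_linear by simp
  ultimately have "app (E i) ((app (F i) ^^ Suc (Suc n)) vac)
      = (real (Suc n) * (real (a i) - real n)) *\<^sub>R (app (F i) ^^ Suc n) vac
        + (real (a i) - 2 * real (Suc n)) *\<^sub>R (app (F i) ^^ Suc n) vac"
    by (simp only:)
  also have "\<dots> = (real (Suc (Suc n)) * (real (a i) - real (Suc n))) *\<^sub>R (app (F i) ^^ Suc n) vac"
    by (simp only: scaleR_left_distrib[symmetric]) (simp add: algebra_simps)
  finally show ?case .
qed

lemma E_other_F_pow: "i \<noteq> j \<Longrightarrow> app (E j) f = 0 \<Longrightarrow> app (E j) ((app (F i) ^^ n) f) = 0"
  by (induction n) (simp_all add: E_F_app)

text \<open>At the exponent \<open>Suc (a i)\<close> the coefficient of \<open>E_F_pow_vac\<close>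
  is zero, so the vector is singular and vanishes at the empty word.\<close>

lemma nilp_vac: "nilp i vac"
proof -
  have "(app (F i) ^^ Suc (a i)) vac = 0"
  proof (rule fun_eq_0)
    show "at_word ((app (F i) ^^ Suc (a i)) vac) [] = 0" by (simp add: at_word_ops)
    fix j
    show "app (E j) ((app (F i) ^^ Suc (a i)) vac) = 0"
      using E_other_F_pow[of i j vac "Suc (a i)"] E_vac[of j] E_F_pow_vac[of i "a i"]
      by (cases "i = j") simp_all
  qed
  then show ?thesis unfolding nilp_def by blast
qed

lemma nilp_F:
  assumes "nilp i f" shows "nilp i (app (F j) f)"
proof (cases "i = j")
  case True
  obtain n where "(app (F i) ^^ n) f = 0" using assms by (auto simp: nilp_def)
  then have "(app (F i) ^^ n) (app (F i) f) = 0"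
    using F_pow_mono[of n "F i" f "Suc n"] unfolding funpow_Suc_right comp_apply by (metis Suc_n_not_le_n nat_le_linear)
  then show ?thesis using True unfolding nilp_def by blast
next
  case False
  then show ?thesis using nilp_adF[OF False, of 0 f] assms by simp
qed

lemma nilp_V: "f \<in> V p \<Longrightarrow> nilp i f"
proof -
  assume "f \<in> V p"
  have m: "nilp i (mono w)" for w by (induction w) (auto intro: nilp_F nilp_vac)
  have "f \<in> {f. nilp i f}"
  proof (rule span_subspace_induct[OF \<open>f \<in> V p\<close>[unfolded V_def]])
    have "nilp i 0" unfolding nilp_def by (rule exI[of _ 0]) simp
    then show "subspace {f. nilp i f}" by (simp add: subspace_def nilp_linear)
  qed (use m in auto)
  then show ?thesis by simp
qed

lemma F_E_pow:
  assumes "f \<in> V p" and "app (F i) f = 0" and "hw i p = - real P"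
  shows "app (F i) ((app (E i) ^^ Suc n) f) = (real (Suc n) * (real P - real n)) *\<^sub>R (app (E i) ^^ n) f"
proof -
  have FE: "app (F i) (app (E i) g) = app (E i) (app (F i) g) - app (H i) g" for g
    by (simp add: E_F_app)
  show ?thesis
  proof (induction n)
    case 0
    show ?case using assms H_V[OF assms(1)] by (simp add: FE)
  next
    case (Suc n)
    have hp: "hw i (p - ray i (int (Suc n))) = - real P + 2 * real (Suc n)"
      using hw_ray[of i "p - ray i (int (Suc n))" i "int (Suc n)"] assms(3)
      by (simp only: diff_add_cancel A_diag)
    have "app (F i) ((app (E i) ^^ Suc (Suc n)) f)
        = app (E i) (app (F i) ((app (E i) ^^ Suc n) f)) - app (H i) ((app (E i) ^^ Suc n) f)"
      using FE[of "(app (E i) ^^ Suc n) f"] by (simp only: funpow.simps(2)[of "Suc n"] comp_apply)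
    also have "\<dots> = (real (Suc n) * (real P - real n)) *\<^sub>R (app (E i) ^^ Suc n) f
        - (- real P + 2 * real (Suc n)) *\<^sub>R (app (E i) ^^ Suc n) f"
      by (simp only: Suc.IH app_linear H_V[OF E_pow_V[OF assms(1), where i = i and n = "Suc n"], of i] hp) simp
    also have "\<dots> = (real (Suc (Suc n)) * (real P - real (Suc n))) *\<^sub>R (app (E i) ^^ Suc n) f"
      by (simp only: scaleR_left_diff_distrib[symmetric]) (simp add: algebra_simps)
    finally show ?case .
  qed
qed

text \<open>Local nilpotence of \<open>F i\<close> gives the string through a vector of
  \<open>V p\<close> a lowest member, and climbing from there with \<open>E i\<close> gives nonzero
  vectors along the whole string, past the reflected weight.\<close>

lemma V_reflect:
  assumes "V p \<noteq> {0}" and "hw i p = - real k"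
  shows "V (p - ray i (int k)) \<noteq> {0}"
proof -
  obtain v where v: "v \<in> V p" "v \<noteq> 0" using assms(1) subspace_0[OF subspace_V] by blast
  obtain n where "(app (F i) ^^ n) v = 0" using nilp_V[OF v(1), of i] by (auto simp: nilp_def)
  then have "\<exists>s. (app (F i) ^^ Suc s) v = 0 \<and> (app (F i) ^^ s) v \<noteq> 0"
  proof (induction n)
    case (Suc n)
    then show ?case by (cases "(app (F i) ^^ n) v = 0") blast+
  qed (use v in simp)
  then obtain s where s: "(app (F i) ^^ Suc s) v = 0" "(app (F i) ^^ s) v \<noteq> 0"
    by blast
  define w where "w = (app (F i) ^^ s) v"
  \<comment> \<open>The lowest vector \<open>w\<close> has weight \<open>- P\<close>, so its string
    has \<open>P + 1\<close> members; climbing \<open>s\<close> steps undoes the descent and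
    \<open>k\<close> further steps reach the reflected weight.\<close>
  define P where "P = k + 2 * s"
  have w: "w \<in> V (p + ray i (int s))" "app (F i) w = 0" "w \<noteq> 0"
    unfolding w_def using F_pow_V[OF v(1)] s by simp_all
  have hP: "hw i (p + ray i (int s)) = - real P"
    unfolding hw_ray A_diag assms(2) P_def by simp
  have "(app (E i) ^^ n) w \<noteq> 0" if "n \<le> P" for n
    using that
  proof (induction n)
    case 0
    show ?case using w(3) by simp
  next
    case (Suc n)
    then have "(app (E i) ^^ n) w \<noteq> 0" "real P - real n \<noteq> 0" by simp_all
    then have "app (F i) ((app (E i) ^^ Suc n) w) \<noteq> 0"
      unfolding F_E_pow[OF w(1,2) hP] by simp
    then show ?case using app_linear(1)[of "F i"] by fastforce
  qed
  then have "(app (E i) ^^ (s + k)) w \<noteq> 0" unfolding P_def by simp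
  moreover have "(app (E i) ^^ (s + k)) w \<in> V (p + ray i (int s) - ray i (int (s + k)))"
    by (rule E_pow_V[OF w(1)])
  moreover have "p + ray i (int s) - ray i (int (s + k)) = p - ray i (int k)"
    unfolding ray_def by (cases p) simp
  ultimately show ?thesis by (simp only:) blast
qed

end

section \<open>Traces and Freudenthal's recursion\<close>

definition trace_on :: "'a::real_vector set \<Rightarrow> ('a \<Rightarrow> 'a) \<Rightarrow> real" where
  "trace_on B f = (\<Sum>b\<in>B. representation B (f b) b)"

lemma representation_sum_scale:
  assumes "independent B" "finite C" "\<And>c. c \<in> C \<Longrightarrow> h c \<in> span B"
  shows "representation B (\<Sum>c\<in>C. k c *\<^sub>R h c) b = (\<Sum>c\<in>C. k c * representation B (h c) b)"
  using assms(2,3)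
proof (induction C rule: finite_induct)
  case empty
  show ?case by (simp add: representation_zero)
next
  case (insert c C)
  have "k c *\<^sub>R h c \<in> span B" "(\<Sum>c\<in>C. k c *\<^sub>R h c) \<in> span B"
    using insert.prems by (auto intro!: span_scale span_sum)
  then show ?case
    using insert assms(1) by (simp add: representation_add representation_scale)
qed

text \<open>Cyclicity for maps between two different spaces; it moves a trace from one weight space
  to the next.\<close>

lemma trace_on_comp_commute:
  assumes B: "independent B" "finite B" and C: "independent C" "finite C"
    and f: "linear f" "\<And>b. b \<in> B \<Longrightarrow> f b \<in> span C" and g: "linear g" "\<And>c. c \<in> C \<Longrightarrow> g c \<in> span B"
  shows "trace_on B (\<lambda>v. g (f v)) = trace_on C (\<lambda>v. f (g v))"
proof -
  have "representation B (g (f b)) b = (\<Sum>c\<in>C. representation C (f b) c * representation B (g c) b)"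
    if "b \<in> B" for b
  proof -
    have "f b = (\<Sum>c\<in>C. representation C (f b) c *\<^sub>R c)"
      using sum_representation_eq[OF C(1) f(2)[OF that] C(2)] by simp
    then have "g (f b) = (\<Sum>c\<in>C. representation C (f b) c *\<^sub>R g c)"
      using linear_sum[OF g(1)] linear_cmul[OF g(1)] by (metis (no_types, lifting) sum.cong)
    then show ?thesis
      using representation_sum_scale[OF B(1) C(2) g(2)] by simp
  qed
  moreover have "representation C (f (g c)) c = (\<Sum>b\<in>B. representation B (g c) b * representation C (f b) c)"
    if "c \<in> C" for c
  proof -
    have "g c = (\<Sum>b\<in>B. representation B (g c) b *\<^sub>R b)"
      using sum_representation_eq[OF B(1) g(2)[OF that] B(2)] by simp
    then have "f (g c) = (\<Sum>b\<in>B. representation B (g c) b *\<^sub>R f b)"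
      using linear_sum[OF f(1)] linear_cmul[OF f(1)] by (metis (no_types, lifting) sum.cong)
    then show ?thesis
      using representation_sum_scale[OF C(1) B(2) f(2)] by simp
  qed
  ultimately have "trace_on B (\<lambda>v. g (f v)) = (\<Sum>b\<in>B. \<Sum>c\<in>C. representation C (f b) c * representation B (g c) b)"
    and "trace_on C (\<lambda>v. f (g v)) = (\<Sum>c\<in>C. \<Sum>b\<in>B. representation B (g c) b * representation C (f b) c)"
    unfolding trace_on_def by (auto intro!: sum.cong)
  then show ?thesis by (simp add: mult.commute sum.swap[of _ B C])
qed

lemma trace_on_add_scale:
  assumes "independent B" "finite B" "\<And>b. b \<in> B \<Longrightarrow> f b \<in> span B"
  shows "trace_on B (\<lambda>v. f v + k *\<^sub>R v) = trace_on B f + k * real (card B)"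
proof -
  have "representation B (f b + k *\<^sub>R b) b = representation B (f b) b + k" if "b \<in> B" for b
    using assms that
    by (simp add: representation_add representation_scale span_scale span_base representation_basis)
  then show ?thesis by (simp add: trace_on_def sum.distrib)
qed

lemma trace_on_sum:
  assumes "independent B" "finite I" "\<And>i b. i \<in> I \<Longrightarrow> b \<in> B \<Longrightarrow> f i b \<in> span B"
  shows "trace_on B (\<lambda>v. \<Sum>i\<in>I. f i v) = (\<Sum>i\<in>I. trace_on B (f i))"
proof -
  have "representation B (\<Sum>i\<in>I. f i b) b = (\<Sum>i\<in>I. representation B (f i b) b)" if "b \<in> B" for b
    using representation_sum_scale[OF assms(1,2), of "\<lambda>i. f i b" "\<lambda>_. 1" b] assms(3) that by simp
  then show ?thesis unfolding trace_on_def by (simp add: sum.swap[of _ I B])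
qed

lemma trace_on_scalar:
  assumes "independent B" "finite B" "\<And>b. b \<in> B \<Longrightarrow> f b = k *\<^sub>R b"
  shows "trace_on B f = k * real (card B)"
proof -
  have "representation B (f b) b = k" if "b \<in> B" for b
    using assms that by (simp add: representation_scale span_base representation_basis)
  then show ?thesis by (simp add: trace_on_def)
qed

context word_module begin

lemma deg_length: "fst (deg w) + snd (deg w) = int (length w)"
  by (induction w) (simp_all add: dg_def)

lemma finite_length: "finite {w :: bool list. int (length w) = k}"
proof (rule finite_subset)
  show "{w :: bool list. int (length w) = k} \<subseteq> {w. set w \<subseteq> UNIV \<and> length w = nat k}" by auto
qed (rule finite_lists_length_eq, rule finite)

lemma finite_deg: "finite {w. deg w = p}"
  by (rule finite_subset[OF _ finite_length[of "fst p + snd p"]]) (auto simp: deg_length)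

definition mult :: "int \<times> int \<Rightarrow> nat" where
  "mult p = dim (V p)"

definition basis :: "int \<times> int \<Rightarrow> word_fun set" where
  "basis p = (SOME B. B \<subseteq> V p \<and> independent B \<and> V p \<subseteq> span B \<and> card B = dim (V p))"

lemma basis: "basis p \<subseteq> V p" "independent (basis p)" "span (basis p) = V p"
  "card (basis p) = mult p" "finite (basis p)"
proof -
  have "\<exists>B. B \<subseteq> V p \<and> independent B \<and> V p \<subseteq> span B \<and> card B = dim (V p)"
    by (rule basis_exists[of "V p"]) blast
  then have b: "basis p \<subseteq> V p \<and> independent (basis p) \<and> V p \<subseteq> span (basis p) \<and> card (basis p) = dim (V p)"
    unfolding basis_def by (rule someI_ex)
  then show "basis p \<subseteq> V p" "independent (basis p)" "card (basis p) = mult p"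
    by (simp_all add: mult_def)
  show "span (basis p) = V p" using b subspace_V span_minimal by blast
  show "finite (basis p)"
    using independent_span_bound[of "mono ` {w. deg w = p}" "basis p"] b finite_deg[of p]
    by (auto simp: V_def)
qed

lemma mult_eq_0: "mult p = 0 \<longleftrightarrow> V p = {0}"
proof
  assume "mult p = 0"
  then have "basis p = {}" using basis(4,5)[of p] by simp
  then show "V p = {0}" using basis(3)[of p] by simp
next
  assume "V p = {0}"
  then show "mult p = 0" unfolding mult_def using dim_span_eq_card_independent[of "{}::word_fun set"] by (simp add: independent_empty)
qed

lemma mult_0: "mult 0 = 1"
proof -
  have "w = []" if "deg w = 0" for w using deg_length[of w] that by simp
  then have "{w. deg w = 0} = {[]}" by auto
  then have "V 0 = span {vac}" by (simp add: V_def)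
  moreover have "vac \<noteq> 0"
  proof
    assume "vac = 0"
    then have "at_word vac [] = at_word 0 []" by simp
    then show False by (simp add: vac.rep_eq)
  qed
  ultimately show ?thesis
    unfolding mult_def by (simp add: dim_eq_card_independent)
qed

lemma mult_neg: "fst p < 0 \<or> snd p < 0 \<Longrightarrow> mult p = 0"
proof -
  have nonneg: "0 \<le> fst (deg w) \<and> 0 \<le> snd (deg w)" for w by (induction w) (simp_all add: dg_def)
  have "deg w \<noteq> p" if "fst p < 0 \<or> snd p < 0" for w using nonneg[of w] that by auto
  then have "fst p < 0 \<or> snd p < 0 \<Longrightarrow> {w. deg w = p} = {}" by blast
  then show "fst p < 0 \<or> snd p < 0 \<Longrightarrow> mult p = 0" unfolding mult_eq_0 V_def by simp
qed

text \<open>Taking traces of a Casimir operator that acts by the scalar \<open>q p\<close> on \<open>V p\<close> gives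
  Freudenthal's recursion for the multiplicities.\<close>

lemma freudenthal:
  fixes X e :: "'i \<Rightarrow> word_op" and \<delta> :: "'i \<Rightarrow> int \<times> int"
  assumes I: "finite I"
    and X: "\<And>i p f. i \<in> I \<Longrightarrow> f \<in> V p \<Longrightarrow> app (X i) f \<in> V (p + \<delta> i)"
    and e: "\<And>i p f. i \<in> I \<Longrightarrow> f \<in> V p \<Longrightarrow> app (e i) f \<in> V (p - \<delta> i)"
    and K: "\<And>i p f. i \<in> I \<Longrightarrow> f \<in> V p \<Longrightarrow> app (br (e i) (X i)) f = K i p *\<^sub>R f"
    and q: "\<And>p f. f \<in> V p \<Longrightarrow> (\<Sum>i\<in>I. app (X i) (app (e i) f)) = q p *\<^sub>R f"
  obtains T where "\<And>i p. i \<in> I \<Longrightarrow> T i p = T i (p - \<delta> i) + K i (p - \<delta> i) * real (mult (p - \<delta> i))"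
    and "\<And>p. (\<Sum>i\<in>I. T i p) = q p * real (mult p)"
    and "\<And>i p. mult p = 0 \<Longrightarrow> T i p = (0::real)"
proof
  define T where "T i p = trace_on (basis p) (\<lambda>f. app (X i) (app (e i) f))" for i p
  note T_def' = T_def[abs_def]
  have bV: "b \<in> V p" if "b \<in> basis p" for b p using basis(1) that by blast
  have Xe: "app (X i) (app (e i) f) \<in> V p" if "i \<in> I" "f \<in> V p" for i p f
    using X[OF that(1) e[OF that]] by simp
  fix i p
  show "T i p = T i (p - \<delta> i) + K i (p - \<delta> i) * real (mult (p - \<delta> i))" if i: "i \<in> I"
  proof -
    let ?r = "p - \<delta> i"
    \<comment> \<open>Cyclicity moves the trace to the weight space of \<open>?r\<close>, where
      exchanging \<open>e i\<close> and \<open>X i\<close> costs the scalar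
      \<open>K i ?r\<close>.\<close>
    have "T i p = trace_on (basis ?r) (\<lambda>f. app (e i) (app (X i) f))"
      unfolding T_def
    proof (rule trace_on_comp_commute)
      show "app (e i) b \<in> span (basis ?r)" if "b \<in> basis p" for b
        unfolding basis(3) using e[OF i bV[OF that]] .
      show "app (X i) b \<in> span (basis p)" if "b \<in> basis ?r" for b
        unfolding basis(3) using X[OF i bV[OF that]] by simp
    qed (simp_all add: basis)
    also have "\<dots> = trace_on (basis ?r) (\<lambda>f. app (X i) (app (e i) f) + K i ?r *\<^sub>R f)"
      unfolding trace_on_def
    proof (rule sum.cong[OF refl])
      fix b assume b: "b \<in> basis ?r"
      have "app (e i) (app (X i) b) = app (X i) (app (e i) b) + K i ?r *\<^sub>R b"
        using br_app[of "e i" "X i" b] K[OF i bV[OF b]] by simp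
      then show "representation (basis ?r) (app (e i) (app (X i) b)) b
        = representation (basis ?r) (app (X i) (app (e i) b) + K i ?r *\<^sub>R b) b" by simp
    qed
    also have "\<dots> = trace_on (basis ?r) (\<lambda>f. app (X i) (app (e i) f)) + K i ?r * real (card (basis ?r))"
    proof (rule trace_on_add_scale)
      show "app (X i) (app (e i) b) \<in> span (basis ?r)" if "b \<in> basis ?r" for b
        unfolding basis(3) by (rule Xe[OF i bV[OF that]])
    qed (simp_all add: basis)
    finally show ?thesis by (simp add: T_def basis)
  qed
  have "(\<Sum>i\<in>I. T i p) = trace_on (basis p) (\<lambda>f. \<Sum>i\<in>I. app (X i) (app (e i) f))"
    unfolding T_def
  proof (rule trace_on_sum[symmetric])
    show "app (X i) (app (e i) b) \<in> span (basis p)" if "i \<in> I" "b \<in> basis p" for i b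
      unfolding basis(3) by (rule Xe[OF that(1) bV[OF that(2)]])
  qed (simp_all add: basis I)
  also have "\<dots> = q p * real (card (basis p))"
    by (rule trace_on_scalar) (simp_all add: basis q[OF bV])
  finally show "(\<Sum>i\<in>I. T i p) = q p * real (mult p)" by (simp add: basis)
  show "T i p = 0" if "mult p = 0"
  proof -
    have "basis p = {}" using basis(4,5)[of p] that by simp
    then show ?thesis by (simp add: T_def trace_on_def)
  qed
qed

end

section \<open>Level spaces and the principal three-dimensional subalgebra\<close>

lemma at_word_sum: "at_word (\<Sum>i\<in>I. f i) w = (\<Sum>i\<in>I. at_word (f i) w)"
  by (induction I rule: infinite_finite_induct) simp_all

context word_module begin

definition level :: "int \<Rightarrow> word_fun set" where
  "level k = span (mono ` {w. int (length w) = k})"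

lemma V_level: "fst p + snd p = k \<Longrightarrow> V p \<subseteq> level k"
  unfolding V_def level_def by (rule span_mono) (use deg_length in auto)

lemma op_level:
  assumes "\<And>w. int (length w) = k \<Longrightarrow> app x (mono w) = c *\<^sub>R mono w" and "f \<in> level k"
  shows "app x f = c *\<^sub>R f"
proof -
  have "f \<in> {f. app x f = c *\<^sub>R f}"
  proof (rule span_subspace_induct[OF assms(2)[unfolded level_def]])
    show "subspace {f. app x f = c *\<^sub>R f}"
      by (auto simp: subspace_def scaleR_add_right)
  qed (use assms(1) in auto)
  then show ?thesis by simp
qed

lemma op_level_mem:
  assumes "\<And>w. int (length w) = k \<Longrightarrow> app x (mono w) \<in> level k'" and "f \<in> level k"
  shows "app x f \<in> level k'"
proof -
  have "subspace (level k')" by (simp add: level_def)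
  have "f \<in> {f. app x f \<in> level k'}"
  proof (rule span_subspace_induct[OF assms(2)[unfolded level_def]])
    show "subspace {f. app x f \<in> level k'}"
      using \<open>subspace (level k')\<close> by (simp add: subspace_def)
  qed (use assms(1) in auto)
  then show ?thesis by simp
qed

lemma F_level:
  assumes "f \<in> level k" shows "app (F i) f \<in> level (k + 1)"
proof (rule op_level_mem[OF _ assms])
  show "app (F i) (mono w) \<in> level (k + 1)" if "int (length w) = k" for w
    unfolding level_def using that by (intro span_base image_eqI[where x = "i # w"]) simp_all
qed

lemma E_level:
  assumes "f \<in> level k" shows "app (E i) f \<in> level (k - 1)"
proof (rule op_level_mem[OF _ assms])
  show "app (E i) (mono w) \<in> level (k - 1)" if "int (length w) = k" for w
  proof (rule subsetD[OF V_level E_mono])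
    show "fst (deg w - dg i) + snd (deg w - dg i) = k - 1"
      using deg_length[of w] that by (simp add: dg_def)
  qed
qed

text \<open>Different weight spaces have disjoint supports on words, so the union of their bases is
  independent.\<close>

lemma dim_level: "dim (level k) = (\<Sum>m\<in>{0..k}. mult (m, k - m))"
proof -
  define P where "P = (\<lambda>m. (m, k - m)) ` {0..k}"
  define B where "B = (\<Union>p\<in>P. basis p)"
  have finB: "finite B" and finP: "finite P" using basis(5) by (simp_all add: B_def P_def)
  have bV: "b \<in> V p" if "b \<in> basis p" for b p using basis(1) that by blast
  have unique: "p = p'" if b: "b \<in> basis p" "b \<in> basis p'" for b p p'
  proof -
    have "b \<noteq> 0" using b(1) basis(2) dependent_zero by blast
    then obtain w where "at_word b w \<noteq> 0" using word_fun_eqI[of b 0] by auto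
    then show ?thesis using V_support[OF bV[OF b(1)]] V_support[OF bV[OF b(2)]] by blast
  qed
  have "independent B"
  proof
    assume "dependent B"
    then obtain u b where u: "(\<Sum>v\<in>B. u v *\<^sub>R v) = 0" "b \<in> B" "u b \<noteq> 0"
      unfolding dependent_finite[OF finB] by blast
    then obtain p where p: "p \<in> P" "b \<in> basis p" by (auto simp: B_def)
    have "(\<Sum>v\<in>basis p. u v *\<^sub>R v) = 0"
    proof (rule word_fun_eqI)
      fix w
      show "at_word (\<Sum>v\<in>basis p. u v *\<^sub>R v) w = at_word 0 w"
      proof (cases "deg w = p")
        case True
        have "at_word v w = 0" if v: "v \<in> B - basis p" for v
        proof -
          obtain p' where "v \<in> basis p'" "p' \<noteq> p" using v unfolding B_def by blast
          then show ?thesis using V_support[OF bV] True by blast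
        qed
        then have "at_word (\<Sum>v\<in>B. u v *\<^sub>R v) w = at_word (\<Sum>v\<in>basis p. u v *\<^sub>R v) w"
          unfolding at_word_sum by (intro sum.mono_neutral_right[OF finB]) (use p in \<open>auto simp: B_def\<close>)
        then show ?thesis using u by simp
      next
        case False
        then have "at_word v w = 0" if "v \<in> basis p" for v using V_support[OF bV[OF that]] by blast
        then show ?thesis by (simp add: at_word_sum)
      qed
    qed
    then have "dependent (basis p)"
      unfolding dependent_finite[OF basis(5)] using p(2) u(3) by blast
    then show False using basis(2) by blast
  qed
  moreover have "span B = level k"
  proof
    show "span B \<subseteq> level k"
    proof (rule span_minimal)
      show "B \<subseteq> level k" using bV V_level by (fastforce simp: B_def P_def)
    qed (simp add: level_def)
    have "mono w \<in> span B" if "int (length w) = k" for w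
    proof -
      have "0 \<le> fst (deg w) \<and> 0 \<le> snd (deg w)" by (induction w) (simp_all add: dg_def)
      then have "deg w \<in> P"
        using deg_length[of w] that unfolding P_def by (intro image_eqI[where x = "fst (deg w)"]) (auto simp: prod_eq_iff)
      then have "span (basis (deg w)) \<subseteq> span B" by (intro span_mono) (auto simp: B_def)
      then show ?thesis using mono_V[of w] basis(3) by blast
    qed
    then show "level k \<subseteq> span B" unfolding level_def by (intro span_minimal) auto
  qed
  ultimately have "dim (level k) = card B" using dim_span_eq_card_independent by metis
  also have "\<dots> = (\<Sum>p\<in>P. card (basis p))"
    unfolding B_def using unique by (intro card_UN_disjoint) (auto simp: finP basis)
  also have "\<dots> = (\<Sum>m\<in>{0..k}. mult (m, k - m))"
    unfolding P_def by (subst sum.reindex) (simp_all add: inj_on_def basis)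
  finally show ?thesis .
qed

text \<open>Level spaces are the weight spaces of a principal \<open>sl\<^sub>2\<close>, whose lowering operator is
  injective on positive weights.\<close>

lemma level_increasing:
  assumes c: "\<And>j. c True * A True j + c False * A False j = 2"
    and k: "0 \<le> k" "2 * real_of_int k < c True * l True + c False * l False"
  shows "dim (level k) \<le> dim (level (k + 1))"
proof -
  define M where "M = c True * l True + c False * l False"
  \<comment> \<open>The condition on \<open>c\<close> makes every letter count 2 under
    \<open>br X Y\<close>, so \<open>level n\<close> belongs to the eigenvalue
    \<open>M - 2 * n\<close>.\<close>
  define X where "X = c True *\<^sub>R E True + c False *\<^sub>R E False"
  define Y where "Y = F True + F False"
  have XY: "app X (app Y f) = app Y (app X f) + (M - 2 * of_int n) *\<^sub>R f" if "f \<in> level n" for f n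
  proof -
    have "app (br X Y) f = (M - 2 * of_int n) *\<^sub>R f"
    proof (rule op_level[OF _ that])
      fix w :: "bool list" assume w: "int (length w) = n"
      have "c True * hw True p + c False * hw False p
          = M - (c True * A True True + c False * A False True) * of_int (fst p)
              - (c True * A True False + c False * A False False) * of_int (snd p)" for p
        by (simp add: hw_def M_def algebra_simps)
      moreover have "real_of_int n = of_int (fst (deg w)) + of_int (snd (deg w))"
        using deg_length[of w] w by (metis of_int_add)
      ultimately have "c True * hw True (deg w) + c False * hw False (deg w) = M - 2 * of_int n"
        unfolding c by simp
      moreover have "br X Y = c True *\<^sub>R H True + c False *\<^sub>R H False"
        by (simp add: X_def Y_def br_simps br_E_F)
      ultimately show "app (br X Y) (mono w) = (M - 2 * of_int n) *\<^sub>R mono w"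
        by (simp add: H_V[OF mono_V] flip: scaleR_left_distrib)
    qed
    then show ?thesis by (simp add: br_app[of X Y])
  qed
  have XU: "app X f \<in> level (n - 1)" if "f \<in> level n" for f n
    unfolding X_def using E_level[OF that] by (simp add: level_def span_add span_scale)
  have YU: "app Y f \<in> level (n + 1)" if "f \<in> level n" for f n
    unfolding Y_def using F_level[OF that] by (simp add: level_def span_add)
  have Xpow: "(app X ^^ n) f \<in> level (k - int n)" if "f \<in> level k" for f n
  proof (induction n)
    case (Suc n)
    then show ?case using XU[OF Suc.IH] by (simp add: algebra_simps)
  qed (use that in simp)
  \<comment> \<open>If \<open>Y\<close> kills \<open>v\<close>, the coefficients in
    \<open>Yp\<close> are nonzero because \<open>M - 2 * k\<close> is positive. So \<open>v\<close>
    vanishes as soon as some power of \<open>X\<close> kills it, and the power \<open>k + 1\<close>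
    does, its value having negative level.\<close>
  have inj: "v = 0" if v: "v \<in> level k" "app Y v = 0" for v
  proof -
    have Yp: "app Y ((app X ^^ Suc n) v) = - (real (Suc n) * (M - 2 * of_int k + real n)) *\<^sub>R (app X ^^ n) v" for n
    proof (induction n)
      case 0
      have "app X (app Y v) = 0" using v by simp
      then show ?case using XY[OF v(1)] by (simp add: add_eq_0_iff algebra_simps)
    next
      case (Suc n)
      let ?f = "(app X ^^ Suc n) v"
      have "app Y (app X ?f) = app X (app Y ?f) - (M - 2 * of_int (k - int (Suc n))) *\<^sub>R ?f"
        using XY[OF Xpow[OF v(1), of "Suc n"]] by (simp only: add_diff_cancel_right')
      also have "app X (app Y ?f) = - (real (Suc n) * (M - 2 * of_int k + real n)) *\<^sub>R ?f"
        unfolding Suc.IH app_linear by simp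
      also have "\<dots> - (M - 2 * of_int (k - int (Suc n))) *\<^sub>R ?f
        = - (real (Suc (Suc n)) * (M - 2 * of_int k + real (Suc n))) *\<^sub>R ?f"
        by (simp only: scaleR_left_diff_distrib[symmetric]) (simp add: algebra_simps)
      finally show ?case by (simp only: funpow.simps(2)[of "Suc n"] comp_apply)
    qed
    have nz: "(app X ^^ n) v = 0" if "(app X ^^ Suc n) v = 0" for n
    proof -
      have "real (Suc n) * (M - 2 * of_int k + real n) > 0" using k by (simp add: M_def)
      moreover have "(real (Suc n) * (M - 2 * of_int k + real n)) *\<^sub>R (app X ^^ n) v = 0"
        using Yp[of n] unfolding that by simp
      ultimately show ?thesis by (metis less_irrefl scaleR_eq_0_iff)
    qed
    have "level (- 1) = {0}" by (simp add: level_def)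
    then have "(app X ^^ Suc (nat k)) v = 0" using Xpow[OF v(1), of "Suc (nat k)"] k by simp
    moreover have "(app X ^^ n) v = 0 \<Longrightarrow> v = 0" for n
      by (induction n) (use nz in auto)
    ultimately show "v = 0" by blast
  qed
  obtain B where B: "B \<subseteq> level k" "independent B" "level k \<subseteq> span B" "card B = dim (level k)"
    using basis_exists[of "level k"] by blast
  obtain C where C: "C \<subseteq> level (k + 1)" "independent C" "level (k + 1) \<subseteq> span C" "card C = dim (level (k + 1))"
    using basis_exists[of "level (k + 1)"] by blast
  have finC: "finite C"
    using independent_span_bound[OF _ C(2), of "mono ` {w. int (length w) = k + 1}"] C(1) finite_length
    by (auto simp: level_def)
  have "span B = level k" using B(1,3) span_minimal[of B "level k"] by (auto simp: level_def)
  have injY: "inj_on (app Y) (span B)"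
  proof (rule inj_onI)
    fix x y assume xy: "x \<in> span B" "y \<in> span B" "app Y x = app Y y"
    then have "x - y \<in> level k" "app Y (x - y) = 0"
      using span_diff[OF xy(1,2)] \<open>span B = level k\<close> by simp_all
    then show "x = y" using inj[of "x - y"] by simp
  qed
  have "independent (app Y ` B)"
    by (rule linear_independent_injective_image[OF linear_app B(2) injY])
  moreover have "app Y ` B \<subseteq> span C" using YU B(1) C(3) by blast
  ultimately have "card (app Y ` B) \<le> card C" using independent_span_bound[OF finC] by blast
  moreover have "card (app Y ` B) = card B"
    by (rule card_image) (rule inj_on_subset[OF injY span_superset])
  ultimately show ?thesis using B C by simp
qed

end

section \<open>Root vectors and the Casimir operator in rank two\<close>

lemma app_sum: "app (\<Sum>i\<in>I. x i) f = (\<Sum>i\<in>I. app (x i) f)"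
  by (induction I rule: infinite_finite_induct) simp_all

lemma br_times: "br (x * y) z = x * br y z + br x z * y"
  by (simp add: br_def algebra_simps)

context word_module begin

definition shifts :: "word_op \<Rightarrow> int \<times> int \<Rightarrow> bool" where
  "shifts x d \<longleftrightarrow> (\<forall>p f. f \<in> V p \<longrightarrow> app x f \<in> V (p + d))"

lemma shiftsD: "shifts x d \<Longrightarrow> f \<in> V p \<Longrightarrow> app x f \<in> V (p + d)"
  unfolding shifts_def by blast

lemma shifts_F: "shifts (F i) (dg i)"
  by (simp add: shifts_def F_V)

lemma shifts_E: "shifts (E i) (- dg i)"
  using E_V by (simp add: shifts_def)

lemma shifts_scale: "shifts x d \<Longrightarrow> shifts (c *\<^sub>R x) d"
  using subspace_V by (simp add: shifts_def subspace_scale)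

lemma shifts_br:
  assumes "shifts x d" and "shifts y d'" shows "shifts (br x y) (d + d')"
proof -
  have "app x (app y f) \<in> V (p + (d + d'))" "app y (app x f) \<in> V (p + (d + d'))" if "f \<in> V p" for f p
    using shiftsD[OF assms(1) shiftsD[OF assms(2) that]] shiftsD[OF assms(2) shiftsD[OF assms(1) that]]
    by (simp_all add: algebra_simps)
  then show ?thesis
    using subspace_V by (simp add: shifts_def br_def subspace_diff)
qed

lemma shifts_adF: "shifts (adF True False k) (int k, 1)"
proof (induction k)
  case 0
  show ?case using shifts_F[of False] by (simp add: dg_def)
next
  case (Suc k)
  have "dg True + (int k, 1) = (int (Suc k), 1)" by (simp add: dg_def)
  then show ?case using shifts_br[OF shifts_F[of True] Suc] by (simp only: adF.simps)
qed

text \<open>Bracketing on the right mirrors \<open>adF\<close>, so that the coefficients in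
  \<open>br_adE_FT\<close> agree with those in \<open>br_E_adF_same\<close>.\<close>

primrec adE :: "nat \<Rightarrow> word_op" where
  "adE 0 = E False"
| "adE (Suc k) = br (adE k) (E True)"

lemma shifts_adE: "shifts (adE k) (- int k, - 1)"
proof (induction k)
  case 0
  show ?case using shifts_E[of False] by (simp add: dg_def)
next
  case (Suc k)
  have "(- int k, - 1) + - dg True = (- int (Suc k), - 1)" by (simp add: dg_def)
  then show ?case using shifts_br[OF Suc shifts_E[of True]] by (simp only: adE.simps)
qed

lemma br_adE_H: "br (adE k) (H h) = - (A h False + real k * A h True) *\<^sub>R adE k"
proof (induction k)
  case 0
  show ?case by (simp add: br_swap[of "E False"] br_H_E)
next
  case (Suc k)
  have "br (E True) (H h) = - A h True *\<^sub>R E True" by (simp add: br_swap[of "E True"] br_H_E)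
  then show ?case
    by (intro word_op_eqI) (simp add: jacobi_left[of "adE k" "E True" "H h"] Suc br_simps algebra_simps)
qed

text \<open>The counterpart of \<open>central_eq_0\<close> on the submodule, which the lowering
  operators generate from \<open>vac\<close>. The Serre relation for raising operators is obtained
  in this form.\<close>

lemma vanish_on_V:
  assumes "app x vac = 0" and "\<And>i. br x (F i) = 0" and "f \<in> V p" shows "app x f = 0"
proof -
  have "app x (mono w) = 0" for w
  proof (induction w)
    case (Cons i w)
    then show ?case using br_app[of x "F i" "mono w"] assms(2)[of i] by simp
  qed (simp add: assms(1))
  then have "f \<in> {f. app x f = 0}"
    by (intro span_subspace_induct[OF assms(3)[unfolded V_def]]) (auto simp: subspace_def)
  then show ?thesis by simp
qed

text \<open>The Casimir operator without its Cartan part does not commute with \<open>F i\<close>;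
  the commutator is exactly the increment that \<open>q\<close> undergoes from \<open>p\<close> to
  \<open>p + dg i\<close>.\<close>

lemma casimir_scalar:
  assumes "app C vac = 0" "q 0 = 0" "\<And>i p. q (p + dg i) = q p + s i * hw i p"
    and "\<And>i p f. f \<in> V p \<Longrightarrow> app (br C (F i)) f = (s i * hw i p) *\<^sub>R app (F i) f"
    and "f \<in> V p"
  shows "app C f = q p *\<^sub>R f"
proof -
  have m: "app C (mono w) = q (deg w) *\<^sub>R mono w" for w
  proof (induction w)
    case (Cons i w)
    then show ?case
      using br_app[of C "F i" "mono w"] assms(4)[OF mono_V, of i w]
      by (simp add: assms(3) scaleR_left_distrib)
  qed (simp add: assms(1,2))
  have "f \<in> {f. app C f = q p *\<^sub>R f}"
  proof (rule span_subspace_induct[OF assms(5)[unfolded V_def]])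
    show "subspace {f. app C f = q p *\<^sub>R f}" by (auto simp: subspace_def scaleR_add_right)
  qed (use m in auto)
  then show ?thesis by simp
qed

end

text \<open>Simple roots are ordered as \<open>True\<close> (short) and \<open>False\<close> (long); \<open>n\<close> is the square of the
  ratio of their lengths, with \<open>n = 0\<close> for \<open>A\<^sub>1 \<oplus> A\<^sub>1\<close>.\<close>

locale rank2_module = cartan_module +
  fixes n m :: nat
  assumes N_TF: "N True False = n" and N_FT: "N False True = m"
begin

lemma A_TF: "A True False = - real n" and A_FT: "A False True = - real m"
  using A_off[of True False] A_off[of False True] by (simp_all add: N_TF N_FT)

lemma br_adE_FT: "br (adE (Suc k)) (F True) = (real (Suc k) * (real n - real k)) *\<^sub>R adE k"
proof (induction k)
  case 0
  have "br (adE 0) (H True) = real n *\<^sub>R adE 0" using br_adE_H[of 0 True] by (simp add: A_TF)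
  then show ?case by (simp add: jacobi_left[of "E False" "E True" "F True"] br_E_F br_simps)
next
  case (Suc k)
  have "br (adE (Suc (Suc k))) (F True)
      = br (br (adE (Suc k)) (F True)) (E True) + br (adE (Suc k)) (H True)"
    unfolding adE.simps(2)[of "Suc k"] by (simp only: jacobi_left[of _ "E True" "F True"] br_E_F if_True simp_thms)
  also have "\<dots> = (real (Suc k) * (real n - real k)) *\<^sub>R adE (Suc k) + (real n - 2 * real (Suc k)) *\<^sub>R adE (Suc k)"
    by (simp only: Suc br_simps br_adE_H A_TF A_diag adE.simps(2)[symmetric]) simp
  also have "\<dots> = (real (Suc (Suc k)) * (real n - real (Suc k))) *\<^sub>R adE (Suc k)"
    by (simp only: scaleR_left_distrib[symmetric]) (simp add: algebra_simps)
  finally show ?case .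
qed

lemma br_adE_FF: "br (adE (Suc k)) (F False) = (if k = 0 then - real m *\<^sub>R E True else 0)"
proof (induction k)
  case 0
  have "br (H False) (E True) = - real m *\<^sub>R E True" by (simp only: br_H_E A_FT)
  then show ?case by (simp add: jacobi_left[of "E False" "E True" "F False"] br_E_F br_simps)
next
  case (Suc k)
  have "br (adE (Suc (Suc k))) (F False) = br (br (adE (Suc k)) (F False)) (E True)"
    unfolding adE.simps(2)[of "Suc k"] by (simp add: jacobi_left[of _ "E True" "F False"] br_E_F br_simps)
  then show ?case unfolding Suc by (simp add: br_simps)
qed

abbreviation "Fa \<equiv> F True"
abbreviation "Fb \<equiv> F False"
abbreviation "Ea \<equiv> E True"
abbreviation "Eb \<equiv> E False"
abbreviation "Ha \<equiv> H True"
abbreviation "Hb \<equiv> H False"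
abbreviation "X1 \<equiv> br Fa Fb"
abbreviation "X2 \<equiv> br Fa X1"
abbreviation "X3 \<equiv> br Fa X2"
abbreviation "e1 \<equiv> br Eb Ea"
abbreviation "e2 \<equiv> br e1 Ea"
abbreviation "e3 \<equiv> br e2 Ea"

lemma br_basic:
  "br Ea Fa = Ha" "br Eb Fb = Hb" "br Ea Fb = 0" "br Eb Fa = 0" "br Fa Ea = - Ha" "br Fb Eb = - Hb"
  "br Fb Fa = - X1"
  by (simp_all add: br_E_F br_swap[of Fa Ea] br_swap[of Fb Eb] br_swap[of Fb Fa])

lemma br_e_F:
  "br e1 Fa = real n *\<^sub>R Eb" "br e1 Fb = - real m *\<^sub>R Ea"
  "br e2 Fa = (2 * (real n - 1)) *\<^sub>R e1" "br e2 Fb = 0"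
  "br e3 Fa = (3 * (real n - 2)) *\<^sub>R e2" "br e3 Fb = 0"
  using br_adE_FT[of 0] br_adE_FT[of 1] br_adE_FT[of 2] br_adE_FF[of 0] br_adE_FF[of 1] br_adE_FF[of 2]
  by (simp_all add: numeral_2_eq_2)

lemma br_e1_X1: "br e1 X1 = real n *\<^sub>R Hb + real m *\<^sub>R Ha"
  by (simp only: jacobi_right[of e1] br_e_F br_simps br_basic) simp

lemma br_e2_X1: "br e2 X1 = - (2 * (real n - 1) * real m) *\<^sub>R Ea"
  by (simp only: jacobi_right[of e2] br_e_F br_simps) simp

lemma br_e2_X2: "br e2 X2 = (2 * (real n - 1)) *\<^sub>R (real n *\<^sub>R Hb + (2 * real m) *\<^sub>R Ha)"
proof -
  have eq: "br e2 X2 = (2 * (real n - 1)) *\<^sub>R br e1 X1 + br Fa (br e2 X1)"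
    by (simp only: jacobi_right[of e2 Fa X1] br_e_F br_simps)
  show ?thesis
    unfolding eq br_e1_X1 br_e2_X1 br_simps br_basic by (intro word_op_eqI) (simp add: algebra_simps)
qed


lemma serre_X:
  "n = 0 \<Longrightarrow> X1 = 0" "n = 1 \<Longrightarrow> X2 = 0" "n = 2 \<Longrightarrow> X3 = 0" "n = 3 \<Longrightarrow> br Fa X3 = 0"
  using serre_F[of True False] by (simp_all add: N_TF numeral_2_eq_2 numeral_3_eq_3)

lemma serre_Y: "m = 1 \<Longrightarrow> br Fb X1 = 0"
  using serre_F[of False True] br_swap[of Fa Fb] br_simps(6)[of Fb "br Fb Fa"] by (simp add: N_FT)

lemma br_Fb_X2: "m = 1 \<Longrightarrow> br Fb X2 = 0"
  by (simp only: jacobi_right[of Fb Fa X1] br_basic br_simps serre_Y) simp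

text \<open>The identities used from here on hold up to left multiples of the Serre element of the raising
  operators, which vanishes on \<open>V\<close> but not on all functions on words.\<close>

lemma serre_E:
  assumes "m = 1" "f \<in> V p" shows "app (br e2 Eb) f = 0"
proof -
  let ?t = "br e1 Eb"
  have "br ?t Fa = 0"
    by (simp only: jacobi_left[of e1 Eb Fa] br_e_F br_basic br_simps) simp
  moreover have "br e1 Hb = - e1"
    using br_adE_H[of 1 False] by (simp add: A_FT A_diag assms(1))
  then have "br ?t Fb = 0"
    using assms(1) by (simp add: jacobi_left[of e1 Eb Fb] br_e_F br_basic br_simps br_swap[of Ea Eb])
  ultimately have "br ?t (F i) = 0" for i by (cases i) simp_all
  moreover have "app ?t vac = 0" by (simp add: br_def E_vac)
  ultimately have t: "app ?t g = 0" if "g \<in> V p" for g p using vanish_on_V that by blast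
  have "br e2 Eb = br ?t Ea"
    by (simp add: jacobi_left[of e1 Ea Eb] br_swap[of Ea Eb] br_simps)
  then show ?thesis
    using t[OF assms(2)] t[OF E_V[OF assms(2), of True]] by (simp add: br_def)
qed

abbreviation "Z \<equiv> br X1 X2"
abbreviation "eZ \<equiv> br e2 e1"

text \<open>The root vectors for \<open>(3, 1)\<close> and \<open>(3, 2)\<close>. The bracket of
  \<open>eZ\<close> with \<open>Fa\<close> is not zero on all functions: it is a multiple of the
  Serre element \<open>br e2 Eb\<close>, which \<open>serre_E\<close> kills on
  \<open>V\<close>.\<close>

lemma G2_brackets:
  assumes "n = 3" "m = 1"
  shows "br Fa X3 = 0" "br Fb X3 = - Z" "br Fa Z = 0" "br Fb Z = 0"
    and "br eZ Fa = 3 *\<^sub>R br e2 Eb" "br eZ Fb = - e3"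
    and "br e3 X3 = 12 *\<^sub>R (3 *\<^sub>R Ha + 3 *\<^sub>R Hb)" "br eZ Z = 12 *\<^sub>R (3 *\<^sub>R Ha + 6 *\<^sub>R Hb)"
proof -
  note nm [simp] = assms
  show a: "br Fa X3 = 0" using serre_X(4) by simp
  show b: "br Fb X3 = - Z"
    by (simp only: jacobi_right[of Fb Fa X2] br_basic br_simps br_Fb_X2[OF assms(2)]) simp
  \<comment> \<open>Expanding \<open>br Fa (br Fb X3)\<close> in two ways shows that
    \<open>br Fa Z\<close> equals its own negative.\<close>
  have "br Fa Z = br X1 X3"
    by (simp only: jacobi_right[of Fa X1 X2] br_simps) simp
  moreover have "br Fa (br Fb X3) = br X1 X3"
    by (simp only: jacobi_right[of Fa Fb X3] a br_simps) simp
  ultimately have "br Fa Z = - br Fa Z" by (simp add: b br_simps)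
  then show "br Fa Z = 0"
    by (metis add.inverse_inverse add_eq_0_iff scaleR_2 scaleR_eq_0_iff zero_neq_numeral)
  show "br Fb Z = 0"
    by (simp only: jacobi_right[of Fb X1 X2] br_simps serre_Y[OF assms(2)] br_Fb_X2[OF assms(2)]) simp
  show ZFa: "br eZ Fa = 3 *\<^sub>R br e2 Eb"
    by (simp only: jacobi_left[of e2 e1 Fa] br_e_F br_simps) simp
  show ZFb: "br eZ Fb = - e3"
    by (simp only: jacobi_left[of e2 e1 Fb] br_e_F br_simps) simp
  have e3X1: "br e3 X1 = 0"
    by (simp only: jacobi_right[of e3 Fa Fb] br_e_F br_simps) simp
  have e3X2: "br e3 X2 = - 12 *\<^sub>R Ea"
    by (simp only: jacobi_right[of e3 Fa X1] br_e_F br_simps e3X1 br_e2_X1) simp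
  have "br e3 X3 = 3 *\<^sub>R br e2 X2 + br Fa (br e3 X2)"
    by (simp only: jacobi_right[of e3 Fa X2] br_e_F br_simps) simp
  then show "br e3 X3 = 12 *\<^sub>R (3 *\<^sub>R Ha + 3 *\<^sub>R Hb)"
    unfolding e3X2 br_e2_X2 br_simps br_basic by (intro word_op_eqI) simp
  have e2Hb: "br e2 Hb = 0"
    using br_adE_H[of 2 False] by (simp add: A_FT A_diag numeral_2_eq_2)
  have Fae3: "br Fa e3 = - 3 *\<^sub>R e2" using br_e_F(5) by (simp add: br_swap[of Fa e3])
  have Fae2: "br Fa e2 = - 4 *\<^sub>R e1" using br_e_F(3) by (simp add: br_swap[of Fa e2])
  have "br (br e2 Eb) Fb = 0"
    by (simp only: jacobi_left[of e2 Eb Fb] br_e_F br_basic e2Hb br_simps) simp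
  then have ZX1: "br eZ X1 = 3 *\<^sub>R e2"
    by (simp add: jacobi_right[of eZ Fa Fb] ZFa ZFb br_simps Fae3)
  have EbX1: "br Eb X1 = - Fa"
    by (simp add: jacobi_right[of Eb Fa Fb] br_basic br_simps br_swap[of Fa Hb] br_H_F A_FT)
  have "br (br e2 Eb) X1 = 0"
    by (simp add: jacobi_left[of e2 Eb X1] EbX1 br_e2_X1 br_e_F br_swap[of Ea Eb] br_simps)
  then have ZX2: "br eZ X2 = - 12 *\<^sub>R e1"
    by (simp add: jacobi_right[of eZ Fa X1] ZFa ZX1 br_simps Fae2)
  have X1e1: "br X1 e1 = - (real n *\<^sub>R Hb + real m *\<^sub>R Ha)"
    using br_e1_X1 br_swap[of X1 e1] by (simp only:)
  have eq: "br eZ Z = 3 *\<^sub>R br e2 X2 - 12 *\<^sub>R br X1 e1"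
    by (simp add: jacobi_right[of eZ X1 X2] ZX1 ZX2 br_simps)
  show "br eZ Z = 12 *\<^sub>R (3 *\<^sub>R Ha + 6 *\<^sub>R Hb)"
    unfolding eq X1e1 br_e2_X2 by (intro word_op_eqI) (simp add: algebra_simps)
qed


end

definition pos_coords :: "nat \<Rightarrow> (int \<times> int) set" where
  "pos_coords n = {(1, 0), (0, 1)} \<union> (if 1 \<le> n then {(1, 1)} else {}) \<union> (if 2 \<le> n then {(2, 1)} else {})
     \<union> (if 3 \<le> n then {(3, 1), (3, 2)} else {})"

locale rank2_finite_module = rank2_module +
  assumes nm: "(n, m) \<in> {(0, 0), (1, 1), (2, 1), (3, 1)}"
begin

text \<open>Half the square of the long root \<beta> when the invariant form is scaled to give
  \<alpha> the square 2. For \<open>n = 0\<close> the two roots are orthogonal and their relative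
  scale is set to 1.\<close>

definition rt :: real where "rt = real (max 1 n)"

definition rootX :: "int \<times> int \<Rightarrow> word_op" where
  "rootX g = (if g = (1, 0) then Fa else if g = (0, 1) then Fb else if g = (1, 1) then X1
     else if g = (2, 1) then X2 else if g = (3, 1) then X3 else Z)"

text \<open>The scalars make \<open>rootX g\<close> and \<open>rootE g\<close> dual for that form:
  their bracket becomes \<open>x * H True + rt * y * H False\<close> for the root
  \<open>(x, y)\<close>. At \<open>n = 3\<close> the iterated brackets produce the factor 4 for
  \<open>e2\<close> and 12 for \<open>e3\<close> and \<open>eZ\<close>.\<close>

definition rootE :: "int \<times> int \<Rightarrow> word_op" where
  "rootE g = (if g = (1, 0) then Ea else if g = (0, 1) then rt *\<^sub>R Eb else if g = (1, 1) then e1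
     else if g = (2, 1) then (1 / (2 * (real n - 1))) *\<^sub>R e2
     else (1 / 12) *\<^sub>R (if g = (3, 1) then e3 else eZ))"

text \<open>Half the difference of the squares of \<lambda> + \<rho> and \<lambda> + \<rho> - p: the
  value that the part of the Casimir operator made of positive roots takes at the weight \<lambda> -
  p.\<close>

definition cas :: "int \<times> int \<Rightarrow> real" where
  "cas p = (real (a True) + 1) * of_int (fst p) + rt * (real (a False) + 1) * of_int (snd p)
     - of_int (fst p) ^ 2 + real n * of_int (fst p) * of_int (snd p) - rt * of_int (snd p) ^ 2"

lemma shifts_root:
  assumes "g \<in> pos_coords n" shows "shifts (rootX g) g" "shifts (rootE g) (- g)"
proof -
  have "shifts Fa (1, 0)" "shifts Fb (0, 1)" "shifts Ea (- 1, 0)" "shifts Eb (0, - 1)"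
    using shifts_F[of True] shifts_F[of False] shifts_E[of True] shifts_E[of False] by (simp_all add: dg_def)
  moreover have "shifts X1 (1, 1)" "shifts X2 (2, 1)" "shifts X3 (3, 1)"
    using shifts_adF[of 1] shifts_adF[of 2] shifts_adF[of 3] by (simp_all add: numeral_2_eq_2 numeral_3_eq_3)
  moreover have "shifts e1 (- 1, - 1)" "shifts e2 (- 2, - 1)" "shifts e3 (- 3, - 1)"
    using shifts_adE[of 1] shifts_adE[of 2] shifts_adE[of 3] by (simp_all add: numeral_2_eq_2 numeral_3_eq_3)
  moreover from this have "shifts Z (3, 2)" "shifts eZ (- 3, - 2)"
    using shifts_br[of X1 "(1, 1)" X2 "(2, 1)"] shifts_br[of e2 "(- 2, - 1)" e1 "(- 1, - 1)"] calculation by simp_all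
  ultimately show "shifts (rootX g) g" "shifts (rootE g) (- g)"
    using assms by (auto simp: pos_coords_def rootX_def rootE_def shifts_scale split: if_splits)
qed

lemma root_coroot:
  assumes "g \<in> pos_coords n" and "f \<in> V p"
  shows "app (br (rootE g) (rootX g)) f = (of_int (fst g) * hw True p + rt * of_int (snd g) * hw False p) *\<^sub>R f"
proof -
  have "br (rootE g) (rootX g) = of_int (fst g) *\<^sub>R Ha + (rt * of_int (snd g)) *\<^sub>R Hb"
    using assms(1) nm
    by (intro word_op_eqI)
      (auto simp: pos_coords_def rootX_def rootE_def rt_def br_basic br_simps br_e1_X1 br_e2_X2 G2_brackets
        split: if_splits)
  then show ?thesis by (simp add: H_V[OF assms(2)] scaleR_left_distrib)
qed

text \<open>In the commutator with \<open>F i\<close> the contributions of neighbouring roots in a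
  string cancel, and only the Cartan term from \<open>[E i, F i]\<close> survives. In type G2 a left
  multiple of the raising Serre element remains, which vanishes because \<open>f\<close> lies in
  \<open>V p\<close>.\<close>

lemma casimir:
  assumes "f \<in> V p"
  shows "(\<Sum>g\<in>pos_coords n. app (rootX g) (app (rootE g) f)) = cas p *\<^sub>R f"
proof -
  define C where "C = (\<Sum>g\<in>pos_coords n. rootX g * rootE g)"
  have C_app: "app C f = (\<Sum>g\<in>pos_coords n. app (rootX g) (app (rootE g) f))" for f
    by (simp add: C_def app_sum)
  have XF: "br X1 Fa = - X2" "br X2 Fa = - X3" "br X3 Fa = - br Fa X3" "br Z Fa = - br Fa Z"
    "br X1 Fb = - br Fb X1" "br X2 Fb = - br Fb X2" "br X3 Fb = - br Fb X3" "br Z Fb = - br Fb Z"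
    by (rule br_swap)+
  have "app C f = cas p *\<^sub>R f"
  proof (rule casimir_scalar[where s = "\<lambda>i. if i then 1 else rt"])
    show "app C vac = 0" unfolding C_app
      by (intro sum.neutral) (simp add: rootE_def br_def E_vac)
    show "cas 0 = 0" by (simp add: cas_def)
    show "cas (p + dg i) = cas p + (if i then 1 else rt) * hw i p" for i p
      using nm by (cases i)
        (auto simp: cas_def hw_def dg_def l_eq A_TF A_FT A_diag rt_def algebra_simps power2_eq_square)
    fix i p f assume f: "f \<in> V p"
    note H = H_V[OF f]
    consider "n = 0" "m = 0" | "n = 1" "m = 1" | "n = 2" "m = 1" | "n = 3" "m = 1" using nm by auto
    then show "app (br C (F i)) f = ((if i then 1 else rt) * hw i p) *\<^sub>R app (F i) f"
    proof cases
      case 1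
      have rt: "rt = 1" unfolding rt_def using 1 by simp
      have C: "C = Fa * Ea + Fb * Eb"
        unfolding C_def pos_coords_def rootX_def rootE_def rt_def using 1 by simp
      show ?thesis unfolding C rt
        by (cases i) (simp_all add: br_simps br_times br_basic serre_X(1)[OF 1(1)] H 1)
    next
      case 2
      have rt: "rt = 1" unfolding rt_def using 2 by simp
      have C: "C = Fa * Ea + (Fb * Eb + X1 * e1)"
        unfolding C_def pos_coords_def rootX_def rootE_def rt_def using 2 by simp
      show ?thesis unfolding C rt
        by (cases i) (simp_all only: br_simps br_times br_basic br_e_F XF
            serre_X(2)[OF 2(1)] serre_Y[OF 2(2)] 2 app_simps if_True if_False, simp_all add: H)
    next
      case 3
      have rt: "rt = 2" unfolding rt_def using 3 by simp
      have C: "C = Fa * Ea + (Fb * (2 *\<^sub>R Eb) + (X1 * e1 + X2 * ((1 / 2) *\<^sub>R e2)))"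
        unfolding C_def pos_coords_def rootX_def rootE_def rt_def using 3 by simp
      show ?thesis unfolding C rt
        by (cases i; intro word_fun_eqI) (simp_all only: br_simps br_times br_basic br_e_F XF
            serre_X(3)[OF 3(1)] serre_Y[OF 3(2)] br_Fb_X2[OF 3(2)] 3 app_simps if_True if_False, simp_all add: H)
    next
      case 4
      have rt: "rt = 3" unfolding rt_def using 4 by simp
      have C: "C = Fa * Ea + (Fb * (3 *\<^sub>R Eb) + (X1 * e1 + (X2 * ((1 / 4) *\<^sub>R e2)
          + (X3 * ((1 / 12) *\<^sub>R e3) + Z * ((1 / 12) *\<^sub>R eZ)))))"
        unfolding C_def pos_coords_def rootX_def rootE_def rt_def using 4 by simp
      show ?thesis unfolding C rt
        by (cases i; intro word_fun_eqI) (simp_all only: br_simps br_times br_basic br_e_F XF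
            G2_brackets[OF 4] serre_Y[OF 4(2)] br_Fb_X2[OF 4(2)] 4 app_simps if_True if_False,
            simp_all add: H serre_E[OF 4(2) f])
    qed
  qed (rule assms)
  then show ?thesis by (simp only: C_app)
qed

lemma multiplicity_recursion:
  obtains T where "\<And>g p. g \<in> pos_coords n \<Longrightarrow> T g p = T g (p - g)
      + (of_int (fst g) * hw True (p - g) + rt * of_int (snd g) * hw False (p - g)) * real (mult (p - g))"
    and "\<And>p. (\<Sum>g\<in>pos_coords n. T g p) = cas p * real (mult p)"
    and "\<And>g p. mult p = 0 \<Longrightarrow> T g p = (0::real)"
proof -
  have fin: "finite (pos_coords n)" by (simp add: pos_coords_def)
  have X: "app (rootX g) f \<in> V (p + g)" and E: "app (rootE g) f \<in> V (p - g)"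
    if "g \<in> pos_coords n" "f \<in> V p" for g p f
    using shiftsD[OF shifts_root(1)[OF that(1)] that(2)] shiftsD[OF shifts_root(2)[OF that(1)] that(2)] by simp_all
  show thesis
    by (rule freudenthal[where X = rootX and e = rootE and \<delta> = "\<lambda>g. g" and q = cas,
        OF fin X E root_coroot casimir]) (assumption | rule that)+
qed

end

section \<open>The Weyl denominator as a difference operator, and uniqueness of
  multiplicities\<close>

definition diff_op :: "int \<times> int \<Rightarrow> (int \<times> int \<Rightarrow> real) \<Rightarrow> int \<times> int \<Rightarrow> real" where
  "diff_op g f p = f p - f (p - g)"

definition pos_list :: "nat \<Rightarrow> (int \<times> int) list" where
  "pos_list n = [(1, 0), (0, 1)] @ (if 1 \<le> n then [(1, 1)] else []) @ (if 2 \<le> n then [(2, 1)] else [])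
     @ (if 3 \<le> n then [(3, 1), (3, 2)] else [])"

text \<open>The signs and the shifts \<open>\<rho> - w \<rho>\<close>, in coordinates for the simple roots, in the Weyl denominator
  \<open>\<Prod>(1 - e\<^sup>-\<^sup>\<gamma>)\<close>.\<close>

definition denominator_terms :: "nat \<Rightarrow> (int \<times> int \<times> int) list" where
  "denominator_terms n = (if n = 0 then [(1, 0, 0), (- 1, 1, 0), (- 1, 0, 1), (1, 1, 1)]
     else if n = 1 then [(1, 0, 0), (- 1, 1, 0), (- 1, 0, 1), (1, 1, 2), (1, 2, 1), (- 1, 2, 2)]
     else if n = 2 then [(1, 0, 0), (- 1, 1, 0), (- 1, 0, 1), (1, 1, 2), (1, 3, 1), (- 1, 4, 2), (- 1, 3, 3), (1, 4, 3)]
     else [(1, 0, 0), (- 1, 1, 0), (- 1, 0, 1), (1, 1, 2), (1, 4, 1), (- 1, 6, 2), (- 1, 4, 4), (1, 6, 5), (1, 9, 4),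
       (- 1, 10, 5), (- 1, 9, 6), (1, 10, 6)])"

definition denominator_sum :: "nat \<Rightarrow> (int \<times> int \<Rightarrow> int \<times> int \<Rightarrow> real) \<Rightarrow> real" where
  "denominator_sum n h = (\<Sum>(s, d)\<leftarrow>denominator_terms n. of_int s * h d d)"

abbreviation denominator_op :: "nat \<Rightarrow> (int \<times> int \<Rightarrow> real) \<Rightarrow> int \<times> int \<Rightarrow> real" where
  "denominator_op n \<equiv> foldr diff_op (pos_list n)"

lemma denominator_op_expand:
  assumes "n \<le> 3"
  shows "denominator_op n f p = (\<Sum>(s, d)\<leftarrow>denominator_terms n. of_int s * f (p - d))"
proof -
  consider "n = 0" | "n = 1" | "n = 2" | "n = 3" using assms by linarith
  then show ?thesis
    by cases (cases p; simp add: pos_list_def denominator_terms_def diff_op_def)+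
qed

text \<open>The Leibniz rule: \<open>diff_op g\<close> is multiplication by
  \<open>1 - e^(-g)\<close>. The denominator is differentiated in each coordinate direction, on the
  left factor by factor and on the right in expanded form.\<close>

lemma denominator_op_derivative:
  assumes "n \<le> 3"
  shows "(\<Sum>g\<leftarrow>pos_list n. of_int (fst g) * foldr diff_op (remove1 g (pos_list n)) (\<lambda>p. f (p - g)) p)
      = - (\<Sum>(s, d)\<leftarrow>denominator_terms n. of_int s * of_int (fst d) * f (p - d))"
    and "(\<Sum>g\<leftarrow>pos_list n. of_int (snd g) * foldr diff_op (remove1 g (pos_list n)) (\<lambda>p. f (p - g)) p)
      = - (\<Sum>(s, d)\<leftarrow>denominator_terms n. of_int s * of_int (snd d) * f (p - d))"
proof -
  consider "n = 0" | "n = 1" | "n = 2" | "n = 3" using assms by linarith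
  then show "(\<Sum>g\<leftarrow>pos_list n. of_int (fst g) * foldr diff_op (remove1 g (pos_list n)) (\<lambda>p. f (p - g)) p)
      = - (\<Sum>(s, d)\<leftarrow>denominator_terms n. of_int s * of_int (fst d) * f (p - d))"
    by cases (cases p; simp add: pos_list_def denominator_terms_def diff_op_def)+
  consider "n = 0" | "n = 1" | "n = 2" | "n = 3" using assms by linarith
  then show "(\<Sum>g\<leftarrow>pos_list n. of_int (snd g) * foldr diff_op (remove1 g (pos_list n)) (\<lambda>p. f (p - g)) p)
      = - (\<Sum>(s, d)\<leftarrow>denominator_terms n. of_int s * of_int (snd d) * f (p - d))"
    by cases (cases p; simp add: pos_list_def denominator_terms_def diff_op_def)+
qed

lemma diff_op_linear:
  "foldr diff_op gs (\<lambda>p. f p - h p) = (\<lambda>p. foldr diff_op gs f p - foldr diff_op gs h p)"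
  "foldr diff_op gs (\<lambda>p. \<Sum>i\<in>I. F i p) = (\<lambda>p. \<Sum>i\<in>I. foldr diff_op gs (F i) p)"
  "foldr diff_op gs (\<lambda>p. x * f p + y * h p) = (\<lambda>p. x * foldr diff_op gs f p + y * foldr diff_op gs h p)"
  by (induction gs) (auto simp: diff_op_def fun_eq_iff sum_subtractf algebra_simps)

lemma diff_op_commute: "diff_op g (diff_op h f) = diff_op h (diff_op g f)"
  by (auto simp: diff_op_def fun_eq_iff algebra_simps)

lemma foldr_diff_op_remove1:
  "g \<in> set gs \<Longrightarrow> foldr diff_op gs f = foldr diff_op (remove1 g gs) (diff_op g f)"
proof (induction gs)
  case (Cons h gs)
  have "diff_op g (foldr diff_op gs f) = foldr diff_op gs (diff_op g f)" for gs f
    by (induction gs) (simp_all add: diff_op_commute[of g])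
  then show ?case using Cons by (auto simp: diff_op_commute[of g])
qed simp

definition vanishes_off_cone :: "(int \<times> int \<Rightarrow> real) \<Rightarrow> bool" where
  "vanishes_off_cone f \<longleftrightarrow> (\<forall>p. fst p < 0 \<or> snd p < 0 \<longrightarrow> f p = 0)"

lemma vanishes_off_coneD: "vanishes_off_cone f \<Longrightarrow> x < 0 \<or> y < 0 \<Longrightarrow> f (x, y) = 0"
  by (auto simp: vanishes_off_cone_def)

lemma foldr_diff_op_vanishes:
  "vanishes_off_cone f \<Longrightarrow> \<forall>g\<in>set gs. 0 \<le> fst g \<and> 0 \<le> snd g \<Longrightarrow> vanishes_off_cone (foldr diff_op gs f)"
  by (induction gs) (auto simp: vanishes_off_cone_def diff_op_def)

text \<open>Functions supported in the cone behave like power series, in which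
  \<open>1 - e^(-g)\<close> is invertible: invariance under translation by \<open>g\<close>
  propagates the zeros from outside the cone.\<close>

lemma diff_op_cancel:
  assumes "vanishes_off_cone f" and "foldr diff_op gs f = (\<lambda>_. 0)"
    and "\<And>g. g \<in> set gs \<Longrightarrow> 0 \<le> fst g \<and> 0 \<le> snd g \<and> 0 < fst g + snd g"
  shows "f = (\<lambda>_. 0)"
  using assms(2,3)
proof (induction gs)
  case (Cons g gs)
  let ?h = "foldr diff_op gs f"
  have "vanishes_off_cone ?h"
    using assms(1) Cons.prems(2) by (intro foldr_diff_op_vanishes) auto
  have g: "0 \<le> fst g" "0 \<le> snd g" "0 < fst g + snd g" using Cons.prems(2)[of g] by auto
  have step: "?h p = ?h (p - g)" for p
    using fun_cong[OF Cons.prems(1), of p] diff_op_def[of g ?h p] by simp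
  have "?h p = 0" for p
  proof (induction "nat (fst p + snd p)" arbitrary: p rule: less_induct)
    case less
    show ?case
    proof (cases "fst p < 0 \<or> snd p < 0")
      case True
      then show ?thesis using vanishes_off_coneD[OF \<open>vanishes_off_cone ?h\<close>, of "fst p" "snd p"] by simp
    next
      case False
      show ?thesis
      proof (cases "fst p + snd p = 0")
        case True
        then have "fst (p - g) < 0 \<or> snd (p - g) < 0" using False g by auto
        then show ?thesis using step[of p] \<open>vanishes_off_cone ?h\<close> by (simp only: vanishes_off_cone_def)
      next
        case nz: False
        then have "nat (fst (p - g) + snd (p - g)) < nat (fst p + snd p)" using False g by auto
        then show ?thesis using less step[of p] by simp
      qed
    qed
  qed
  then have "?h = (\<lambda>_. 0)" by blast
  then show ?case using Cons by simp
qed simp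

context rank2_finite_module begin

lemma n_le_3: "n \<le> 3"
  using nm by auto

lemma hw_coords: "hw True p = real (a True) - 2 * of_int (fst p) + real n * of_int (snd p)"
  "hw False p = real (a False) - 2 * of_int (snd p) + real m * of_int (fst p)"
  by (simp_all add: hw_def l_eq A_diag A_TF A_FT)

lemma rt_m: "rt * real m = real n"
  using nm by (auto simp: rt_def)

lemma rt_pos: "rt > 0"
  by (simp add: rt_def)

definition pairing :: "int \<times> int \<Rightarrow> int \<times> int \<Rightarrow> real" where
  "pairing g p = of_int (fst g) * hw True p + rt * of_int (snd g) * hw False p"

text \<open>Each \<open>d\<close> is \<rho> - w\<rho>, so \<rho> and \<rho> - d have the same
  length; hence half the square of \<open>d\<close> equals its product with \<rho>, and the
  quadratic terms cancel.\<close>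

lemma cas_shift:
  assumes "(s, d) \<in> set (denominator_terms n)"
  shows "cas (p - d) = cas p - pairing d (p - d)"
proof -
  have "real_of_int (fst d) ^ 2 - real n * of_int (fst d) * of_int (snd d) + rt * of_int (snd d) ^ 2
      = of_int (fst d) + rt * of_int (snd d)"
    using assms nm by (auto simp: denominator_terms_def rt_def)
  moreover have "cas (p - d) - cas p + pairing d (p - d)
      = (real_of_int (fst d) ^ 2 - real n * of_int (fst d) * of_int (snd d) + rt * of_int (snd d) ^ 2)
      - (of_int (fst d) + rt * of_int (snd d)) + (rt * real m - real n) * of_int (fst p - fst d) * of_int (snd d)"
    by (simp add: cas_def pairing_def hw_coords algebra_simps power2_eq_square)
  ultimately show ?thesis by (simp add: rt_m)
qed

text \<open>The inner sum of Freudenthal's formula. Roots have positive height, so for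
  \<open>c\<close> supported in the cone the terms beyond the height of \<open>p\<close> are
  zero.\<close>

definition root_sum :: "(int \<times> int \<Rightarrow> real) \<Rightarrow> int \<times> int \<Rightarrow> int \<times> int \<Rightarrow> real" where
  "root_sum c g p = (\<Sum>j\<in>{1..nat (fst p + snd p)}.
     pairing g (fst p - int j * fst g, snd p - int j * snd g) * c (fst p - int j * fst g, snd p - int j * snd g))"

lemma pos_list: "set (pos_list n) = pos_coords n" "distinct (pos_list n)"
  by (auto simp: pos_list_def pos_coords_def)

lemma pos_coords_nonneg: "g \<in> pos_coords n \<Longrightarrow> 0 \<le> fst g \<and> 0 \<le> snd g \<and> 0 < fst g + snd g"
  by (auto simp: pos_coords_def split: if_splits)

lemma root_sum_extend:
  assumes "vanishes_off_cone c" and "g \<in> pos_coords n" and "nat (fst p + snd p) \<le> M"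
  shows "root_sum c g p = (\<Sum>j\<in>{1..M}.
     pairing g (fst p - int j * fst g, snd p - int j * snd g) * c (fst p - int j * fst g, snd p - int j * snd g))"
  unfolding root_sum_def
proof (rule sum.mono_neutral_left)
  show "\<forall>j\<in>{1..M} - {1..nat (fst p + snd p)}.
     pairing g (fst p - int j * fst g, snd p - int j * snd g) * c (fst p - int j * fst g, snd p - int j * snd g) = 0"
  proof
    fix j assume j: "j \<in> {1..M} - {1..nat (fst p + snd p)}"
    have "int j * 1 \<le> int j * (fst g + snd g)" using pos_coords_nonneg[OF assms(2)] by (intro mult_left_mono) auto
    then have "(fst p - int j * fst g) + (snd p - int j * snd g) < 0"
      using j by (simp add: algebra_simps) linarith
    then have "fst p - int j * fst g < 0 \<or> snd p - int j * snd g < 0" by linarith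
    then show "pairing g (fst p - int j * fst g, snd p - int j * snd g) * c (fst p - int j * fst g, snd p - int j * snd g) = 0"
      using vanishes_off_coneD[OF assms(1)] by (metis mult_zero_right)
  qed
qed (use assms(3) in auto)

text \<open>The recursion that the traces obey in \<open>multiplicity_recursion\<close>; it is the
  link between the two.\<close>

lemma root_sum_rec:
  assumes "vanishes_off_cone c" and "g \<in> pos_coords n"
  shows "root_sum c g p = root_sum c g (p - g) + pairing g (p - g) * c (p - g)"
proof -
  define M where "M = nat (fst p + snd p)"
  let ?t = "\<lambda>p j. pairing g (fst p - int j * fst g, snd p - int j * snd g) * c (fst p - int j * fst g, snd p - int j * snd g)"
  have "root_sum c g p = (\<Sum>j\<in>{1..Suc M}. ?t p j)"
    by (rule root_sum_extend[OF assms]) (simp add: M_def)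
  also have "\<dots> = ?t p 1 + (\<Sum>j\<in>{1..M}. ?t p (Suc j))"
    by (subst sum.atLeast_Suc_atMost) (simp_all add: sum.shift_bounds_cl_Suc_ivl del: sum.cl_ivl_Suc)
  also have "?t p 1 = pairing g (p - g) * c (p - g)"
    by (cases p; cases g) simp
  also have "(\<Sum>j\<in>{1..M}. ?t p (Suc j)) = (\<Sum>j\<in>{1..M}. ?t (p - g) j)"
    by (rule sum.cong) (simp_all add: algebra_simps)
  also have "\<dots> = root_sum c g (p - g)"
    by (rule root_sum_extend[OF assms, symmetric]) (use pos_coords_nonneg[OF assms(2)] in \<open>auto simp: M_def\<close>)
  finally show ?thesis by simp
qed

lemma root_sum_vanishes: "vanishes_off_cone c \<Longrightarrow> g \<in> pos_coords n \<Longrightarrow> vanishes_off_cone (root_sum c g)"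
  unfolding vanishes_off_cone_def[of "root_sum c g"]
proof (intro allI impI)
  fix p :: "int \<times> int"
  assume c: "vanishes_off_cone c" and g: "g \<in> pos_coords n" and p: "fst p < 0 \<or> snd p < 0"
  have "fst p - int j * fst g < 0 \<or> snd p - int j * snd g < 0" for j
    using p pos_coords_nonneg[OF g] by (metis diff_ge_0_iff_ge dual_order.trans mult_nonneg_nonneg not_less of_nat_0_le_iff)
  then show "root_sum c g p = 0" unfolding root_sum_def using vanishes_off_coneD[OF c] by (intro sum.neutral ballI) (metis mult_zero_right)
qed

text \<open>Freudenthal's recursion for any function whose product with the Weyl denominator is supported
  on the zeros of the Casimir eigenvalue \<open>cas\<close>.\<close>

lemma freudenthal_of_denominator:
  assumes c: "vanishes_off_cone c"
    and D: "\<And>p. cas p * (\<Sum>(s, d)\<leftarrow>denominator_terms n. of_int s * c (p - d)) = 0"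
  shows "(\<Sum>g\<in>pos_coords n. root_sum c g p) = cas p * c p"
proof -
  let ?D = "denominator_op n" and ?P = "\<lambda>g f. foldr diff_op (remove1 g (pos_list n)) (\<lambda>p. f (p - g))"
  let ?u = "\<lambda>p. hw True p * c p" and ?v = "\<lambda>p. hw False p * c p"
  \<comment> \<open>The defect of the recursion. Commuting the denominator past \<open>cas\<close>
    yields, by \<open>cas_shift\<close>, the same sum of pairings as the Leibniz rule yields for the
    root sums. So the denominator sends \<open>Q\<close> to the expression in \<open>D\<close>,
    which is zero, and can then be cancelled.\<close>
  define Q where "Q p = cas p * c p - (\<Sum>g\<in>pos_coords n. root_sum c g p)" for p
  have "?D Q p = 0" for p
  proof -
    have P: "?D (root_sum c g) p = of_int (fst g) * ?P g ?u p + rt * (of_int (snd g) * ?P g ?v p)"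
      if "g \<in> pos_coords n" for g
    proof -
      have "?D (root_sum c g) = foldr diff_op (remove1 g (pos_list n)) (diff_op g (root_sum c g))"
        by (rule foldr_diff_op_remove1) (simp add: that pos_list)
      moreover have "diff_op g (root_sum c g) = (\<lambda>p. of_int (fst g) * ?u (p - g) + (rt * of_int (snd g)) * ?v (p - g))"
      proof
        fix q
        show "diff_op g (root_sum c g) q = of_int (fst g) * ?u (q - g) + (rt * of_int (snd g)) * ?v (q - g)"
          unfolding diff_op_def using root_sum_rec[OF c that, of q] by (simp add: pairing_def algebra_simps)
      qed
      ultimately have "?D (root_sum c g) = foldr diff_op (remove1 g (pos_list n))
          (\<lambda>p. of_int (fst g) * ?u (p - g) + (rt * of_int (snd g)) * ?v (p - g))"
        by (simp only:)
      then show ?thesis unfolding diff_op_linear(3) by simp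
    qed
    have split: "(\<Sum>(s, d)\<leftarrow>xs. of_int s * (pairing d (p - d) * c (p - d)))
        = (\<Sum>(s, d)\<leftarrow>xs. of_int s * of_int (fst d) * ?u (p - d))
          + rt * (\<Sum>(s, d)\<leftarrow>xs. of_int s * of_int (snd d) * ?v (p - d))" for xs :: "(int \<times> int \<times> int) list"
      by (induction xs) (auto simp: pairing_def algebra_simps)
    have "?D (\<lambda>p. \<Sum>g\<in>pos_coords n. root_sum c g p) p = (\<Sum>g\<in>pos_coords n. ?D (root_sum c g) p)"
      by (simp only: diff_op_linear(2))
    also have "\<dots> = (\<Sum>g\<leftarrow>pos_list n. of_int (fst g) * ?P g ?u p) + rt * (\<Sum>g\<leftarrow>pos_list n. of_int (snd g) * ?P g ?v p)"
      unfolding sum_list_distinct_conv_sum_set[OF pos_list(2)] pos_list(1) sum_distrib_left sum.distrib[symmetric]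
      by (rule sum.cong[OF refl P])
    also have "\<dots> = - (\<Sum>(s, d)\<leftarrow>denominator_terms n. of_int s * (pairing d (p - d) * c (p - d)))"
      using denominator_op_derivative(1)[OF n_le_3, of ?u p] denominator_op_derivative(2)[OF n_le_3, of ?v p]
      by (simp only: split)
    finally have sum: "?D (\<lambda>p. \<Sum>g\<in>pos_coords n. root_sum c g p) p
      = - (\<Sum>(s, d)\<leftarrow>denominator_terms n. of_int s * (pairing d (p - d) * c (p - d)))" .
    have "?D (\<lambda>p. cas p * c p) p = (\<Sum>(s, d)\<leftarrow>denominator_terms n. of_int s * (cas (p - d) * c (p - d)))"
      by (rule denominator_op_expand[OF n_le_3])
    also have "\<dots> = (\<Sum>(s, d)\<leftarrow>denominator_terms n. cas p * (of_int s * c (p - d)) - of_int s * (pairing d (p - d) * c (p - d)))"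
      by (rule arg_cong[where f = sum_list], rule map_cong[OF refl]) (auto simp: cas_shift algebra_simps)
    also have "\<dots> = cas p * (\<Sum>(s, d)\<leftarrow>denominator_terms n. of_int s * c (p - d))
        - (\<Sum>(s, d)\<leftarrow>denominator_terms n. of_int s * (pairing d (p - d) * c (p - d)))"
    proof -
      have "(\<Sum>(s, d)\<leftarrow>xs. cas p * (of_int s * c (p - d)) - of_int s * (pairing d (p - d) * c (p - d)))
          = cas p * (\<Sum>(s, d)\<leftarrow>xs. of_int s * c (p - d)) - (\<Sum>(s, d)\<leftarrow>xs. of_int s * (pairing d (p - d) * c (p - d)))"
        for xs :: "(int \<times> int \<times> int) list"
        by (induction xs) (auto simp: distrib_left)
      then show ?thesis .
    qed
    finally show ?thesis
      using D[of p] unfolding Q_def diff_op_linear(1) sum by simp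
  qed
  then have "?D Q = (\<lambda>_. 0)" by blast
  moreover have "vanishes_off_cone Q"
    using c root_sum_vanishes[OF c] unfolding Q_def vanishes_off_cone_def by (auto intro!: sum.neutral)
  ultimately have "Q = (\<lambda>_. 0)"
    using pos_coords_nonneg pos_list(1) by (intro diff_op_cancel[of Q "pos_list n"]) blast+
  from fun_cong[OF this, of p] show ?thesis by (simp add: Q_def)
qed

text \<open>The classical inequality that \<lambda> + \<rho> is longer than \<mu> + \<rho> for every
  other weight \<mu> = \<lambda> - p. The quantity \<open>nr\<close> is half the difference of the
  squares of \<lambda> and \<mu>: it is nonnegative for dominant \<mu> by \<open>two_nr\<close>, and
  reflections towards the dominant chamber preserve it.\<close>

lemma cas_pos:
  fixes S :: "int \<times> int \<Rightarrow> bool"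
  assumes nonneg: "\<And>p. S p \<Longrightarrow> 0 \<le> fst p \<and> 0 \<le> snd p"
    and refl: "\<And>p i k. S p \<Longrightarrow> hw i p = - real k \<Longrightarrow> S (p - ray i (int k))"
  shows "S p \<Longrightarrow> p \<noteq> 0 \<Longrightarrow> cas p > 0"
proof -
  define nr where "nr p = cas p - of_int (fst p) - rt * of_int (snd p)" for p
  have two_nr: "2 * nr p = of_int (fst p) * (real (a True) + hw True p) + rt * of_int (snd p) * (real (a False) + hw False p)" for p
    using rt_m by (simp add: nr_def cas_def hw_coords algebra_simps power2_eq_square)
  have nr_nonneg: "nr p \<ge> 0" if "S p" for p
    using that
  proof (induction "nat (fst p + snd p)" arbitrary: p rule: less_induct)
    case less
    have p: "0 \<le> fst p" "0 \<le> snd p" using nonneg[OF less.prems] by auto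
    show ?case
    proof (cases "hw True p \<ge> 0 \<and> hw False p \<ge> 0")
      case True
      then have "0 \<le> 2 * nr p" unfolding two_nr using p rt_pos by (intro add_nonneg_nonneg mult_nonneg_nonneg) auto
      then show ?thesis by simp
    next
      case False
      define z where "z i = (if i then int (a True) - 2 * fst p + int n * snd p
        else int (a False) - 2 * snd p + int m * fst p)" for i
      have hz: "hw i p = of_int (z i)" for i by (cases i) (simp_all add: z_def hw_coords)
      from False obtain i where "z i < 0" unfolding hz by (auto simp: not_le)
      define k where "k = nat (- z i)"
      have k: "hw i p = - real k" "0 < k" using \<open>z i < 0\<close> by (simp_all add: hz k_def)
      let ?p = "p - ray i (int k)"
      have "S ?p" by (rule refl[OF less.prems k(1)])
      then have "nat (fst ?p + snd ?p) < nat (fst p + snd p)"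
        using nonneg[of ?p] k(2) p by (cases i) (auto simp: ray_def)
      then have "0 \<le> nr ?p" using less.hyps \<open>S ?p\<close> by blast
      \<comment> \<open>Reflections preserve lengths: the difference is \<open>k\<close> times a
        factor that vanishes by the value of \<open>k\<close>.\<close>
      also have "nr ?p = nr p"
      proof -
        have kz: "real k = - real_of_int (z i)" using k(1) hz[of i] by simp
        show ?thesis
        proof (cases i)
          case True
          then have "nr ?p - nr p = real k * (2 * of_int (fst p) - real k - real (a True) - real n * of_int (snd p))"
            by (simp add: nr_def cas_def ray_def algebra_simps power2_eq_square)
          also have "\<dots> = 0" using kz True by (simp add: z_def)
          finally show ?thesis by simp
        next
          case False
          have "nr ?p - nr p = real k * (rt * (2 * of_int (snd p) - real k - real (a False)) - (rt * real m) * of_int (fst p))"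
            unfolding rt_m using False by (simp add: nr_def cas_def ray_def algebra_simps power2_eq_square)
          also have "\<dots> = rt * real k * (2 * of_int (snd p) - real k - real (a False) - real m * of_int (fst p))"
            by (simp add: algebra_simps)
          also have "\<dots> = 0" using kz False by (simp add: z_def)
          finally show ?thesis by simp
        qed
      qed
      finally show ?thesis .
    qed
  qed
  assume p: "S p" "p \<noteq> 0"
  then have "0 < real_of_int (fst p) + rt * of_int (snd p)"
    using nonneg[OF p(1)] rt_pos
    by (cases p) (auto simp: zero_prod_def add_pos_nonneg add_nonneg_pos dest: le_neq_trans)
  then show "cas p > 0" using nr_nonneg[OF p(1)] by (simp add: nr_def)
qed

text \<open>Both functions satisfy Freudenthal's recursion and start with 1. Wherever one of them is
  nonzero away from 0 the factor \<open>cas\<close> is positive, so the recursion fixes the value;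
  this positivity rests on reflection stability, assumed for \<open>c\<close> and given by
  \<open>V_reflect\<close> for \<open>mult\<close>.\<close>

lemma mult_eqI:
  fixes c :: "int \<times> int \<Rightarrow> nat"
  assumes c0: "c 0 = 1" and cone: "vanishes_off_cone (\<lambda>p. real (c p))"
    and refl: "\<And>p i k. c p \<noteq> 0 \<Longrightarrow> hw i p = - real k \<Longrightarrow> c (p - ray i (int k)) \<noteq> 0"
    and D: "\<And>p. cas p * (\<Sum>(s, d)\<leftarrow>denominator_terms n. of_int s * real (c (p - d))) = 0"
  shows "c p = mult p"
proof -
  obtain T where T: "\<And>g p. g \<in> pos_coords n \<Longrightarrow> T g p = T g (p - g) + pairing g (p - g) * real (mult (p - g))"
    "\<And>p. (\<Sum>g\<in>pos_coords n. T g p) = cas p * real (mult p)"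
    "\<And>g p. mult p = 0 \<Longrightarrow> T g p = (0::real)"
    using multiplicity_recursion unfolding pairing_def by blast
  let ?c = "\<lambda>p. real (c p)"
  have C: "(\<Sum>g\<in>pos_coords n. root_sum ?c g p) = cas p * ?c p" for p
    by (rule freudenthal_of_denominator[OF cone D])
  have neg: "fst p < 0 \<or> snd p < 0 \<Longrightarrow> c p = 0" for p
    using vanishes_off_coneD[OF cone, of "fst p" "snd p"] by simp
  have rneg: "root_sum ?c g p = 0" if "g \<in> pos_coords n" "fst p < 0 \<or> snd p < 0" for g p
    using vanishes_off_coneD[OF root_sum_vanishes[OF cone that(1)], of "fst p" "snd p"] that(2) by simp
  have cas_c: "cas p > 0" if "c p \<noteq> 0" "p \<noteq> 0" for p
    by (rule cas_pos[of "\<lambda>p. c p \<noteq> 0"]) (use neg refl that in \<open>auto simp: not_less intro: leI\<close>)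
  have cas_m: "cas p > 0" if "mult p \<noteq> 0" "p \<noteq> 0" for p
    by (rule cas_pos[of "\<lambda>p. mult p \<noteq> 0"])
      (use mult_neg V_reflect that in \<open>auto simp: mult_eq_0 not_less intro: leI\<close>)
  \<comment> \<open>The root sums are carried through the induction because the traces
    \<open>T\<close> are known only by their recursion.\<close>
  have "c p = mult p \<and> (\<forall>g\<in>pos_coords n. root_sum ?c g p = T g p)" for p
  proof (induction "nat (fst p + snd p)" arbitrary: p rule: less_induct)
    case less
    show ?case
    proof (cases "fst p < 0 \<or> snd p < 0")
      case True
      then show ?thesis
        using neg[OF True] mult_neg[OF True] T(3)[of p] rneg[OF _ True] by simp
    next
      case False
      have rs: "root_sum ?c g p = T g p" if g: "g \<in> pos_coords n" for g
      proof -
        have "c (p - g) = mult (p - g) \<and> root_sum ?c g (p - g) = T g (p - g)"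
        proof (cases "fst p + snd p = 0")
          case True
          then have "fst (p - g) < 0 \<or> snd (p - g) < 0" using False pos_coords_nonneg[OF g] by auto
          then show ?thesis
            using neg mult_neg T(3)[of "p - g"] rneg[OF g] by metis
        next
          case nz: False
          then have "nat (fst (p - g) + snd (p - g)) < nat (fst p + snd p)"
            using False pos_coords_nonneg[OF g] by auto
          then show ?thesis using less g by blast
        qed
        then show ?thesis using root_sum_rec[OF cone g, of p] T(1)[OF g, of p] by simp
      qed
      then have "cas p * ?c p = cas p * real (mult p)"
        unfolding C[symmetric] T(2)[symmetric] by (intro sum.cong) auto
      then have "c p = mult p"
        using cas_c[of p] cas_m[of p] c0 mult_0 by (cases "p = 0"; cases "c p = 0 \<and> mult p = 0"; force)
      then show ?thesis using rs by blast
    qed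
  qed
  then show ?thesis by blast
qed

lemma levels_unimodal:
  fixes c :: "int \<times> int \<Rightarrow> nat"
  assumes "\<And>p. c p = mult p" and k: "0 \<le> k"
    and "2 * real_of_int k * (4 - real (n * m)) < (4 + 2 * real m) * real (a True) + (4 + 2 * real n) * real (a False)"
  shows "(\<Sum>x\<in>{0..k}. c (x, k - x)) \<le> (\<Sum>x\<in>{0..k + 1}. c (x, k + 1 - x))"
proof -
  \<comment> \<open>The solution of the two linear equations in \<open>h2\<close>, whose determinant
    is \<open>4 - n * m\<close>; the assumed inequality is positivity of the principal weight with
    this denominator cleared.\<close>
  define h where "h i = (if i then (4 + 2 * real m) / (4 - real (n * m)) else (4 + 2 * real n) / (4 - real (n * m)))" for i
  have h2: "h True * A True j + h False * A False j = 2" for j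
    using nm by (cases j) (auto simp: h_def A_diag A_TF A_FT)
  have "2 * real_of_int k < h True * l True + h False * l False"
    using assms(3) nm by (auto simp: h_def l_eq field_simps)
  from level_increasing[of h, OF h2 k this] show ?thesis
    unfolding dim_level assms(1) by (simp add: add.commute)
qed

end

section \<open>Systems of chains and two-color grid posets\<close>

text \<open>Here \<open>len j\<close> is the size of chain \<open>j\<close>, and
  \<open>f j s\<close> counts the elements of chain \<open>Suc j\<close> below the first
  \<open>s\<close> elements of chain \<open>j\<close>. The assumption \<open>f_max\<close> is the
  trace left by the max property: from chain 2 on, a full chain forces the next one to be
  full.\<close>

locale chain_system =
  fixes M :: nat and len :: "nat \<Rightarrow> nat" and f :: "nat \<Rightarrow> nat \<Rightarrow> nat"
  assumes len_out: "j \<notin> {1..M} \<Longrightarrow> len j = 0"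
    and f_0: "f j 0 = 0" and f_mono: "s \<le> t \<Longrightarrow> f j s \<le> f j t" and f_le: "f j s \<le> len (Suc j)"
    and f_max: "2 \<le> j \<Longrightarrow> f j (len j) = len (Suc j)"
begin

definition vecs :: "(nat \<Rightarrow> nat) set" where
  "vecs = {X. \<forall>j. X j \<le> len j \<and> f j (X j) \<le> X (Suc j)}"

definition lo :: "(nat \<Rightarrow> nat) \<Rightarrow> nat \<Rightarrow> nat" where
  "lo X j = (case j of 0 \<Rightarrow> 0 | Suc i \<Rightarrow> f i (X i))"

definition hi :: "(nat \<Rightarrow> nat) \<Rightarrow> nat \<Rightarrow> nat" where
  "hi X j = Max {s. s \<le> len j \<and> f j s \<le> X (Suc j)}"

lemma le_hi: "s \<le> hi X j \<longleftrightarrow> s \<le> len j \<and> f j s \<le> X (Suc j)"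
proof -
  let ?A = "{s. s \<le> len j \<and> f j s \<le> X (Suc j)}"
  have fin: "finite ?A" by (rule finite_subset[of _ "{..len j}"]) auto
  have "0 \<in> ?A" by (simp add: f_0)
  then have "hi X j \<in> ?A" unfolding hi_def using fin by (intro Max_in) auto
  then have "s \<le> hi X j \<Longrightarrow> s \<in> ?A" using f_mono[of s "hi X j" j] by auto
  moreover have "s \<in> ?A \<Longrightarrow> s \<le> hi X j" unfolding hi_def using fin by (rule Max_ge)
  ultimately show ?thesis by blast
qed

lemma vecs_bounds: "X \<in> vecs \<Longrightarrow> lo X j \<le> X j \<and> X j \<le> hi X j"
  by (auto simp: vecs_def lo_def le_hi split: nat.split)

lemma vecs_len: "X \<in> vecs \<Longrightarrow> X j \<le> len j"
  by (simp add: vecs_def)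

lemma vecs_out: "X \<in> vecs \<Longrightarrow> j \<notin> {1..M} \<Longrightarrow> X j = 0"
  using vecs_len[of X j] len_out by simp

lemma finite_vecs: "finite vecs"
proof (rule finite_subset)
  show "vecs \<subseteq> (\<lambda>g j. if j \<in> {1..M} then g j else 0) ` (\<Pi>\<^sub>E j\<in>{1..M}. {..len j})"
  proof
    fix X assume X: "X \<in> vecs"
    show "X \<in> (\<lambda>g j. if j \<in> {1..M} then g j else 0) ` (\<Pi>\<^sub>E j\<in>{1..M}. {..len j})"
    proof (rule image_eqI)
      show "X = (\<lambda>j. if j \<in> {1..M} then restrict X {1..M} j else 0)"
        using vecs_out[OF X] by (intro ext) (simp add: restrict_def)
      show "restrict X {1..M} \<in> (\<Pi>\<^sub>E j\<in>{1..M}. {..len j})"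
        using vecs_len[OF X] by (intro restrict_PiE_iff[THEN iffD2]) simp
    qed
  qed
  show "finite ((\<lambda>g j. if j \<in> {1..M} then g j else 0) ` (\<Pi>\<^sub>E j\<in>{1..M}. {..len j}))"
    by (intro finite_imageI finite_PiE) simp_all
qed

text \<open>Colors alternate along the chains, so \<open>p\<close> stands for a color and the
  relation for lying in a common component of that color.\<close>

definition same_off :: "bool \<Rightarrow> (nat \<Rightarrow> nat) \<Rightarrow> (nat \<Rightarrow> nat) \<Rightarrow> bool" where
  "same_off p X Y \<longleftrightarrow> (\<forall>j. even j \<noteq> p \<longrightarrow> Y j = X j)"

lemma same_offD: "same_off p X Y \<Longrightarrow> even j \<noteq> p \<Longrightarrow> Y j = X j"
  unfolding same_off_def by blast

lemma same_off_lo_hi: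
  assumes "same_off p X Y" "even j = p" shows "lo Y j = lo X j" "hi Y j = hi X j"
proof -
  have "lo Y j = lo X j"
  proof (cases j)
    case (Suc i)
    then have "even i \<noteq> p" using assms(2) even_Suc by metis
    then show ?thesis using same_offD[OF assms(1), of i] Suc by (simp add: lo_def)
  qed (simp add: lo_def)
  moreover have "even (Suc j) \<noteq> p" using assms(2) even_Suc by metis
  from same_offD[OF assms(1) this] have "hi Y j = hi X j" by (simp only: hi_def)
  ultimately show "lo Y j = lo X j" "hi Y j = hi X j" .
qed

text \<open>A chain is constrained only by its two neighbours, which have the other parity; the
  heights of one parity therefore vary independently in their intervals.\<close>

lemma vecs_update:
  assumes X: "X \<in> vecs" and Y: "same_off p X Y"
    and b: "\<And>j. even j = p \<Longrightarrow> lo X j \<le> Y j \<and> Y j \<le> hi X j"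
  shows "Y \<in> vecs"
proof -
  have "Y j \<le> len j \<and> f j (Y j) \<le> Y (Suc j)" for j
  proof (cases "even j = p")
    case True
    then have "even (Suc j) \<noteq> p" using even_Suc by metis
    from same_offD[OF Y this] show ?thesis using b[OF True] le_hi[of "Y j" X j] by simp
  next
    case False
    then have "even (Suc j) = p" using even_Suc by metis
    from b[OF this] show ?thesis using same_offD[OF Y False] vecs_len[OF X] by (simp add: lo_def)
  qed
  then show ?thesis unfolding vecs_def by blast
qed

text \<open>Twice the rank minus the length, for the height \<open>X j\<close> in the interval that
  the neighbouring chains leave to it.\<close>

definition dev :: "(nat \<Rightarrow> nat) \<Rightarrow> nat \<Rightarrow> int" where
  "dev X j = 2 * int (X j) - int (lo X j) - int (hi X j)"

definition wgt :: "bool \<Rightarrow> (nat \<Rightarrow> nat) \<Rightarrow> int" where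
  "wgt p X = (\<Sum>j | j \<le> M \<and> even j = p. dev X j)"

definition tot :: "bool \<Rightarrow> (nat \<Rightarrow> nat) \<Rightarrow> int" where
  "tot p X = (\<Sum>j | j \<le> M \<and> even j = p. int (X j))"

lemma wgt_diff:
  assumes "same_off p X Y" shows "wgt p Y - wgt p X = 2 * (tot p Y - tot p X)"
  unfolding wgt_def tot_def sum_subtractf[symmetric] sum_distrib_left
  by (rule sum.cong) (auto simp: dev_def same_off_lo_hi[OF assms])

lemma tot_same_off: "same_off p X Y \<Longrightarrow> tot (\<not> p) Y = tot (\<not> p) X"
  unfolding tot_def by (rule sum.cong) (auto simp: same_offD)

definition flip :: "bool \<Rightarrow> (nat \<Rightarrow> nat) \<Rightarrow> nat \<Rightarrow> nat" where
  "flip p X j = (if even j = p then lo X j + hi X j - X j else X j)"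

lemma flip:
  assumes "X \<in> vecs"
  shows "flip p X \<in> vecs" "same_off p X (flip p X)" "wgt p (flip p X) = - wgt p X" "flip p (flip p X) = X"
proof -
  show s: "same_off p X (flip p X)" by (simp add: same_off_def flip_def)
  show "flip p X \<in> vecs"
  proof (rule vecs_update[OF assms s])
    fix j :: nat assume "even j = p"
    then show "lo X j \<le> flip p X j \<and> flip p X j \<le> hi X j"
      using vecs_bounds[OF assms, of j] unfolding flip_def by auto
  qed
  have fl: "lo X j + hi X j - X j \<le> lo X j + hi X j \<and> X j \<le> lo X j + hi X j" for j
    using vecs_bounds[OF assms, of j] by simp
  have "dev (flip p X) j = - dev X j" if "even j = p" for j
    using same_off_lo_hi[OF s that] fl[of j] that by (simp add: dev_def flip_def of_nat_diff)
  then show "wgt p (flip p X) = - wgt p X"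
    unfolding wgt_def sum_negf[symmetric] by (intro sum.cong) auto
  show "flip p (flip p X) = X"
  proof
    fix j show "flip p (flip p X) j = X j"
      using same_off_lo_hi[OF s, of j] fl[of j] by (simp add: flip_def[of p "flip p X"]) (simp add: flip_def)
  qed
qed

text \<open>The cancellation is Stembridge's: reading the chains from the last to the first, the first
  chain \<open>k\<close> at which the partial weight drops below zero determines a reflection of all earlier chains
  of the same colour, which leaves the part already read, and hence \<open>k\<close>, unchanged.\<close>

definition partial :: "(nat \<Rightarrow> nat) \<Rightarrow> nat \<Rightarrow> int" where
  "partial X k = (\<Sum>j | k < j \<and> j \<le> M \<and> even j = even k. dev X j)"

text \<open>As \<open>dev X k\<close> is \<open>(X k - lo X k) - (hi X k - X k)\<close>, a chain is
  read in two halves: the running weight first falls by \<open>hi X k - X k\<close> and then rises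
  by \<open>X k - lo X k\<close>. The condition tests the low point in between.\<close>

definition violated :: "(nat \<Rightarrow> nat) \<Rightarrow> nat \<Rightarrow> bool" where
  "violated X k \<longleftrightarrow> k \<le> M \<and> partial X k < int (hi X k) - int (X k)"

lemma partial_rec:
  assumes "k + 2 \<le> M" shows "partial X k = dev X (k + 2) + partial X (k + 2)"
proof -
  have eq: "{j. k < j \<and> j \<le> M \<and> even j = even k} = insert (k + 2) {j. k + 2 < j \<and> j \<le> M \<and> even j = even (k + 2)}"
  proof -
    have "j = k + 2 \<or> k + 2 < j" if "k < j" "even j = even k" for j
      using that by presburger
    then show ?thesis using assms by auto
  qed
  show ?thesis unfolding partial_def eq by (subst sum.insert) auto
qed

lemma partial_end: "M < k + 2 \<Longrightarrow> partial X k = 0"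
proof -
  assume "M < k + 2"
  have "\<not> (k < j \<and> j \<le> M \<and> even j = even k)" for j
  proof
    assume "k < j \<and> j \<le> M \<and> even j = even k"
    then have "j = Suc k" "even j = even k" using \<open>M < k + 2\<close> by auto
    then show False by simp
  qed
  then have "{j. k < j \<and> j \<le> M \<and> even j = even k} = {}" by blast
  then show ?thesis unfolding partial_def by (simp only: sum.empty)
qed

lemma len_vecs: "len \<in> vecs"
  by (simp add: vecs_def f_le)

lemma hi_len: "hi len j = len j"
  using le_hi[of "hi len j" len j] le_hi[of "len j" len j] f_le by (simp add: le_antisym)

text \<open>By \<open>f_max\<close>, the chains from 3 on have \<open>lo\<close> and
  \<open>hi\<close> both equal to their length and contribute nothing. For \<open>k = 0\<close> the
  sum would contain chain 2, whose \<open>lo\<close> is governed by chain 1, outside the reach of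
  \<open>f_max\<close>.\<close>

lemma partial_len:
  assumes "\<And>j. k < j \<Longrightarrow> X j = len j" "k \<noteq> 0" shows "partial X k = 0"
  unfolding partial_def
proof (rule sum.neutral, rule ballI)
  fix j assume j: "j \<in> {j. k < j \<and> j \<le> M \<and> even j = even k}"
  then have "k < j" "even j = even k" by auto
  then have "k + 2 \<le> j" by presburger
  then have "3 \<le> j" "k < j - 1" using assms(2) by auto
  then obtain i where i: "j = Suc i" "k < i" "2 \<le> i" by (cases j) auto
  have "lo X j = len j" using f_max[OF i(3)] assms(1)[OF i(2)] by (simp add: i(1) lo_def)
  moreover have "hi X j = len j" using hi_len[of j] assms(1)[of "Suc j"] i by (simp add: hi_def)
  ultimately show "dev X j = 0" using assms(1)[of j] i by (simp add: dev_def)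
qed

lemma not_violated_len: "\<not> violated len k"
proof (cases "k = 0")
  case True
  have "0 \<le> dev len j" for j
    using hi_len[of j] vecs_bounds[OF len_vecs, of j] by (simp add: dev_def)
  then have "0 \<le> partial len k" unfolding partial_def by (intro sum_nonneg) simp
  then show ?thesis using hi_len[of k] by (simp add: violated_def)
next
  case False
  then show ?thesis using partial_len[of k len] hi_len[of k] by (simp add: violated_def)
qed

text \<open>The last chain that is not full is violated: the partial weight beyond it is zero, and
  it still has room to rise.\<close>

lemma violated_exists:
  assumes X: "X \<in> vecs" "X \<noteq> len" shows "\<exists>k. violated X k"
proof (rule ccontr)
  assume nv: "\<nexists>k. violated X k"
  define k where "k = Max {j. X j \<noteq> len j}"
  have out: "j \<in> {1..M}" if "X j \<noteq> len j" for j using that vecs_out[OF X(1)] len_out by metis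
  have "{j. X j \<noteq> len j} \<subseteq> {1..M}" using out by blast
  then have fin: "finite {j. X j \<noteq> len j}" by (rule finite_subset) simp
  have "{j. X j \<noteq> len j} \<noteq> {}" using X(2) by auto
  then have k: "X k \<noteq> len k" unfolding k_def using Max_in[OF fin] by blast
  have above: "X j = len j" if "k < j" for j
    using that Max_ge[OF fin, of j] unfolding k_def by fastforce
  have "k \<noteq> 0" "k \<le> M" using out[OF k] by auto
  then have "partial X k = 0" using partial_len above by blast
  moreover have "hi X k = len k" using hi_len[of k] above[of "Suc k"] by (simp add: hi_def)
  moreover have "X k < len k" using k vecs_len[OF X(1), of k] by simp
  ultimately have "violated X k" using \<open>k \<le> M\<close> by (simp add: violated_def)
  then show False using nv by blast
qed

definition crit :: "(nat \<Rightarrow> nat) \<Rightarrow> nat" where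
  "crit X = Max {k. violated X k}"

lemma crit:
  assumes "X \<in> vecs" "X \<noteq> len"
  shows "violated X (crit X)" "\<And>k. crit X < k \<Longrightarrow> \<not> violated X k"
proof -
  have fin: "finite {k. violated X k}" by (rule finite_subset[of _ "{..M}"]) (auto simp: violated_def)
  show "violated X (crit X)" unfolding crit_def using Max_in[OF fin] violated_exists[OF assms] by blast
  show "\<not> violated X k" if "crit X < k" for k using that Max_ge[OF fin, of k] unfolding crit_def by fastforce
qed

lemma critI: "violated X k \<Longrightarrow> (\<And>j. k < j \<Longrightarrow> \<not> violated X j) \<Longrightarrow> crit X = k"
  unfolding crit_def by (rule Max_eqI) (auto intro: finite_subset[of _ "{..M}"] simp: violated_def not_less[symmetric])

text \<open>The correction \<open>- partial X k - 1\<close> at the critical chain makes the weight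
  of its color pass from \<open>w\<close> to \<open>- w - 2\<close>, which is the reflection of
  \<open>w + 1\<close>, that is, of the weight shifted by \<rho>. The chains beyond are left alone,
  so the critical chain can be recognized again.\<close>

definition refl :: "(nat \<Rightarrow> nat) \<Rightarrow> nat \<Rightarrow> nat" where
  "refl X j = (let k = crit X in
     if even j \<noteq> even k \<or> k < j then X j
     else if j = k then nat (int (lo X j) + int (hi X j) - partial X k - 1 - int (X j))
     else lo X j + hi X j - X j)"

lemma partial_nonneg:
  assumes "X \<in> vecs" "\<And>j. k < j \<Longrightarrow> \<not> violated X j" shows "0 \<le> partial X k"
proof (cases "k + 2 \<le> M")
  case True
  then have "int (hi X (k + 2)) - int (X (k + 2)) \<le> partial X (k + 2)"
    using assms(2)[of "k + 2"] by (simp add: violated_def)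
  then show ?thesis using partial_rec[OF True] vecs_bounds[OF assms(1), of "k + 2"] by (simp add: dev_def)
qed (simp add: partial_end)

lemma refl:
  assumes X: "X \<in> vecs" "X \<noteq> len"
  shows "refl X \<in> vecs" "refl X \<noteq> len" "same_off (even (crit X)) X (refl X)" "refl (refl X) = X"
    "wgt (even (crit X)) (refl X) = - wgt (even (crit X)) X - 2"
proof -
  define k where "k = crit X"
  define Y where "Y = refl X"
  have k: "violated X k" "\<And>j. k < j \<Longrightarrow> \<not> violated X j" using crit[OF X] by (simp_all add: k_def)
  have S: "0 \<le> partial X k" using partial_nonneg[OF X(1)] k(2) by blast
  have v: "partial X k < int (hi X k) - int (X k)" "k \<le> M" using k(1) by (simp_all add: violated_def)
  note b = vecs_bounds[OF X(1)]
  have Yk: "int (Y k) = int (lo X k) + int (hi X k) - partial X k - 1 - int (X k)"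
    using v(1) b[of k] by (simp add: Y_def refl_def k_def[symmetric])
  have Yless: "int (Y j) = int (lo X j) + int (hi X j) - int (X j)" if "even j = even k" "j < k" for j
    using that b[of j] by (simp add: Y_def refl_def k_def[symmetric] of_nat_diff)
  have Ysame: "Y j = X j" if "even j \<noteq> even k \<or> k < j" for j
    using that by (simp add: Y_def refl_def k_def[symmetric])
  have so: "same_off (even k) X Y" unfolding same_off_def using Ysame by blast
  have Yv: "Y \<in> vecs"
  proof (rule vecs_update[OF X(1) so])
    fix j :: nat assume j: "even j = even k"
    consider "j < k" | "j = k" | "k < j" by linarith
    then show "lo X j \<le> Y j \<and> Y j \<le> hi X j"
    proof cases
      case 1
      then show ?thesis using Yless[OF j 1] b[of j] by linarith
    next
      case 2
      \<comment> \<open>The violation gives the lower bound; the upper one comes from the partial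
        weight being nonnegative, as no chain beyond \<open>k\<close> is violated.\<close>
      show ?thesis unfolding 2 using Yk v(1) S b[of k] by linarith
    next
      case 3
      then show ?thesis using Ysame[of j] b[of j] by simp
    qed
  qed
  note lh = same_off_lo_hi[OF so]
  \<comment> \<open>Chain \<open>k + 1\<close> is left out because its \<open>lo\<close> depends on
    chain \<open>k\<close>; partial weights at \<open>j\<close> with \<open>k \<le> j\<close> only
    begin at \<open>j + 2\<close>.\<close>
  have dev_above: "dev Y j = dev X j" if kj: "k + 1 < j" for j
  proof -
    obtain i where i: "j = Suc i" "k < i" using kj by (cases j) auto
    then have "lo Y j = lo X j" using Ysame[of i] by (simp add: lo_def)
    moreover have "hi Y j = hi X j" using Ysame[of "Suc j"] i by (simp add: hi_def)
    ultimately show ?thesis using Ysame[of j] i by (simp add: dev_def)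
  qed
  have partial_above: "partial Y j = partial X j" if "k \<le> j" for j
    unfolding partial_def
  proof (rule sum.cong[OF refl])
    fix i assume i: "i \<in> {i. j < i \<and> i \<le> M \<and> even i = even j}"
    then have "k + 1 < i" using that by (cases "i = Suc j") auto
    then show "dev Y i = dev X i" by (rule dev_above)
  qed
  have "violated Y k"
    unfolding violated_def partial_above[OF order_refl] using lh(2)[of k] Yk v b[of k] by simp
  moreover have "\<not> violated Y j" if "k < j" for j
  proof -
    have "hi Y j = hi X j" using Ysame[of "Suc j"] that by (simp add: hi_def)
    then show ?thesis using k(2)[OF that] Ysame[of j] that partial_above[of j] by (simp add: violated_def)
  qed
  ultimately have ck: "crit Y = k" by (rule critI)
  have "violated Y k" by fact
  then show "refl X \<noteq> len" using not_violated_len[of k] unfolding Y_def by metis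
  show "refl X \<in> vecs" using Yv by (simp add: Y_def)
  show "same_off (even (crit X)) X (refl X)" using so by (simp add: Y_def k_def)
  show "refl (refl X) = X"
  proof
    fix j
    have "refl Y j = X j"
    proof (cases "even j \<noteq> even k \<or> k < j")
      case True
      then show ?thesis using Ysame[OF True] unfolding refl_def ck Let_def by simp
    next
      case False
      then have j: "even j = even k" by blast
      show ?thesis
      proof (cases "j = k")
        case True
        have "int (lo Y k) + int (hi Y k) - partial Y k - 1 - int (Y k) = int (X k)"
          unfolding lh[OF HOL.refl] partial_above[OF order_refl] using Yk by linarith
        then show ?thesis unfolding True refl_def ck Let_def by simp
      next
        case neq: False
        then have "j < k" using False by linarith
        then have "lo X j + hi X j - Y j = X j" using Yless[OF j] b[of j] by linarith
        then show ?thesis unfolding refl_def ck Let_def lh[OF j] using j neq False by simp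
      qed
    qed
    then show "refl (refl X) j = X j" by (simp add: Y_def)
  qed
  let ?A = "{j. j < k \<and> even j = even k}" and ?B = "{j. k < j \<and> j \<le> M \<and> even j = even k}"
  have split: "{j. j \<le> M \<and> even j = even k} = ?A \<union> insert k ?B"
  proof (rule Set.set_eqI)
    fix j show "j \<in> {j. j \<le> M \<and> even j = even k} \<longleftrightarrow> j \<in> ?A \<union> insert k ?B"
      using v(2) by (cases j k rule: linorder_cases) auto
  qed
  have w: "wgt (even k) Z = (\<Sum>j\<in>?A. dev Z j) + (dev Z k + partial Z k)" for Z
  proof -
    have "wgt (even k) Z = (\<Sum>j\<in>?A. dev Z j) + (\<Sum>j\<in>insert k ?B. dev Z j)"
      unfolding wgt_def split by (rule sum.union_disjoint) auto
    moreover have "(\<Sum>j\<in>insert k ?B. dev Z j) = dev Z k + (\<Sum>j\<in>?B. dev Z j)"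
      by (rule sum.insert) auto
    ultimately show ?thesis by (simp only: partial_def)
  qed
  have "(\<Sum>j | j < k \<and> even j = even k. dev Y j) = - (\<Sum>j | j < k \<and> even j = even k. dev X j)"
    unfolding sum_negf[symmetric]
  proof (rule sum.cong[OF HOL.refl])
    fix j assume "j \<in> ?A"
    then have j: "even j = even k" "j < k" by auto
    show "dev Y j = - dev X j" unfolding dev_def lh[OF j(1)] Yless[OF j] by simp
  qed
  moreover have "dev Y k = - dev X k - 2 * partial X k - 2"
    unfolding dev_def lh[OF HOL.refl] Yk by simp
  ultimately have "wgt (even k) Y = - wgt (even k) X - 2"
    using w[of X] w[of Y] partial_above[OF order_refl] by linarith
  then show "wgt (even (crit X)) (refl X) = - wgt (even (crit X)) X - 2" by (simp add: Y_def k_def)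
qed

text \<open>The involution \<open>refl\<close> reverses the sign of every term except that of
  \<open>len\<close>, so the remaining sum equals its own negative.\<close>

lemma alternating_sum:
  fixes G :: "(nat \<Rightarrow> nat) \<Rightarrow> 'r::comm_ring"
  assumes two: "\<And>x::'r. x + x = 0 \<Longrightarrow> x = 0"
    and alt: "\<And>p X Y. X \<in> vecs \<Longrightarrow> Y \<in> vecs \<Longrightarrow> same_off p X Y \<Longrightarrow> wgt p Y = - wgt p X - 2 \<Longrightarrow> G Y = - G X"
  shows "(\<Sum>X\<in>vecs. G X) = G len"
proof -
  let ?A = "vecs - {len}"
  have bij: "refl X \<in> ?A" "refl (refl X) = X" if "X \<in> ?A" for X
    using that refl(1,2,4)[of X] by blast+
  have "(\<Sum>X\<in>?A. G X) = (\<Sum>X\<in>?A. G (refl X))"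
    by (rule sum.reindex_bij_witness[where i = refl and j = refl]) (simp_all only: bij)
  also have "\<dots> = - (\<Sum>X\<in>?A. G X)"
    unfolding sum_negf[symmetric]
  proof (rule sum.cong[OF HOL.refl])
    fix X assume "X \<in> ?A"
    then have X: "X \<in> vecs" "X \<noteq> len" by auto
    show "G (refl X) = - G X" by (rule alt[OF X(1) refl(1,3,5)[OF X]])
  qed
  finally have "(\<Sum>X\<in>?A. G X) = 0" by (rule two[OF eq_neg_iff_add_eq_0[THEN iffD1]])
  then show ?thesis using sum.remove[OF finite_vecs len_vecs, of G] by simp
qed

end

section \<open>Covers and ranks in finite posets\<close>

lemma covers_in_above:
  assumes "finite R" "x \<in> R" "y \<in> R" "(x::'a::order) < y"
  obtains z where "covers_in R x z" "z \<le> y"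
proof -
  have "finite {z \<in> R. x < z \<and> z \<le> y}" "y \<in> {z \<in> R. x < z \<and> z \<le> y}" using assms by auto
  then obtain z where z: "z \<in> {z \<in> R. x < z \<and> z \<le> y}" "\<And>w. w \<in> {z \<in> R. x < z \<and> z \<le> y} \<Longrightarrow> w \<le> z \<Longrightarrow> w = z"
    using finite_has_minimal2 by (metis (no_types, lifting))
  have "covers_in R x z"
    unfolding covers_in_def using z assms by (auto, metis less_le_not_le order.strict_trans2 order_less_imp_le)
  then show thesis using that z by blast
qed

lemma covers_in_below:
  assumes "finite R" "x \<in> R" "y \<in> R" "(x::'a::order) < y"
  obtains z where "covers_in R z y" "x \<le> z"
proof -
  have "finite {z \<in> R. x \<le> z \<and> z < y}" "x \<in> {z \<in> R. x \<le> z \<and> z < y}" using assms by auto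
  then obtain z where z: "z \<in> {z \<in> R. x \<le> z \<and> z < y}" "\<And>w. w \<in> {z \<in> R. x \<le> z \<and> z < y} \<Longrightarrow> z \<le> w \<Longrightarrow> w = z"
    using finite_has_maximal2 by (metis (no_types, lifting))
  have "covers_in R z y"
    unfolding covers_in_def using z assms by (auto, metis less_le_not_le order.strict_trans1 order_less_imp_le)
  then show thesis using that z by blast
qed

text \<open>Every element can be followed down along edges to \<open>z\<close>, so any rank function
  differs from \<open>g\<close> by a constant, which is zero because the value 0 is attained. This
  evaluates the definite descriptions in \<open>rank_wrt\<close> and
  \<open>length_wrt\<close>.\<close>

lemma rank_unique:
  assumes edge: "\<And>x y. x \<in> C \<Longrightarrow> y \<in> C \<Longrightarrow> E x y \<Longrightarrow> g y = g x + (1::nat)"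
    and pred: "\<And>y. y \<in> C \<Longrightarrow> y \<noteq> z \<Longrightarrow> \<exists>x\<in>C. E x y"
    and z: "z \<in> C" "g z = 0" and w: "w \<in> C" "\<And>y. y \<in> C \<Longrightarrow> g y \<le> g w"
  shows "is_rank_function E C g (g w)" "\<And>y. y \<in> C \<Longrightarrow> rank_wrt E C y = g y" "length_wrt E C = g w"
proof -
  have attained: "k \<in> g ` C" if "y \<in> C" "k \<le> g y" for k y
    using that
  proof (induction "g y" arbitrary: y)
    case (Suc n)
    then have "y \<noteq> z" using z by auto
    then obtain x where "x \<in> C" "E x y" using pred Suc.prems by blast
    then have "g y = g x + 1" using edge Suc.prems by blast
    show ?case
    proof (cases "k = g y")
      case True
      then show ?thesis using Suc.prems(1) by (metis imageI)
    next
      case False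
      then show ?thesis using Suc.hyps(1)[of x] Suc.hyps(2) Suc.prems \<open>x \<in> C\<close> \<open>g y = g x + 1\<close> by simp
    qed
  next
    case 0
    then show ?case by (metis imageI le_zero_eq)
  qed
  have "g ` C = {0..g w}" using attained[OF w(1)] w(2) by fastforce
  then show rank: "is_rank_function E C g (g w)" unfolding is_rank_function_def using edge by blast
  have unique: "l = g w \<and> (\<forall>y\<in>C. r y = g y)" if r: "is_rank_function E C r l" for r l
  proof -
    have img: "r ` C = {0..l}" and step: "\<And>x y. x \<in> C \<Longrightarrow> y \<in> C \<Longrightarrow> E x y \<Longrightarrow> r y = r x + 1"
      using r by (auto simp: is_rank_function_def)
    have eq: "r y = r z + g y" if "y \<in> C" for y
      using that
    proof (induction "g y" arbitrary: y rule: less_induct)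
      case less
      show ?case
      proof (cases "y = z")
        case False
        then obtain x where x: "x \<in> C" "E x y" using pred less.prems by blast
        then have "g y = g x + 1" using edge less.prems by blast
        moreover have "r y = r x + 1" using step x less.prems by blast
        ultimately show ?thesis using less.hyps[of x] x(1) by simp
      qed (simp add: z)
    qed
    have "0 \<in> r ` C" using img by simp
    then obtain y0 where "y0 \<in> C" "r y0 = 0" by auto
    then have "r z = 0" using eq by fastforce
    then have eq': "\<And>y. y \<in> C \<Longrightarrow> r y = g y" using eq by simp
    have "l \<in> r ` C" using img by simp
    then obtain y1 where "y1 \<in> C" "r y1 = l" by auto
    then have "l \<le> g w" using eq' w by force
    moreover have "g w \<le> l" using img w(1) eq'[OF w(1)] by (metis atLeastAtMost_iff imageI)
    ultimately show ?thesis using eq' by auto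
  qed
  show "rank_wrt E C y = g y" if "y \<in> C" for y
    unfolding rank_wrt_def
  proof (rule the_equality)
    show "\<exists>r l. is_rank_function E C r l \<and> r y = g y" using rank by blast
    show "k = g y" if "\<exists>r l. is_rank_function E C r l \<and> r y = k" for k
      using that unique \<open>y \<in> C\<close> by blast
  qed
  show "length_wrt E C = g w"
    unfolding length_wrt_def by (rule the_equality) (use rank unique in blast)+
qed

section \<open>Grid posets as systems of chains\<close>

locale colored_grid =
  fixes P :: "'p::order set" and chn :: "'p \<Rightarrow> nat" and col :: "'p \<Rightarrow> 'c" and \<alpha> \<beta> :: 'c and M :: nat
  assumes grid: "two_color_grid_poset P chn {\<alpha>, \<beta>} col"
    and chain: "chain_function P M chn" and max_prop: "max_property P chn col"
begin

lemma finP: "finite P"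
  using grid by (simp add: two_color_grid_poset_def grid_poset_def)

lemma two_color: "two_color_function P chn {\<alpha>, \<beta>} col"
  using grid by (simp add: two_color_grid_poset_def)

lemma colors_distinct: "\<alpha> \<noteq> \<beta>"
proof
  assume "\<alpha> = \<beta>"
  then have "card {\<alpha>, \<beta>} = 1" by simp
  then show False using two_color by (simp add: two_color_function_def)
qed

lemma color_cases: "u \<in> P \<Longrightarrow> col u = \<alpha> \<or> col u = \<beta>"
  using two_color unfolding two_color_function_def Pi_def by blast

lemma color_chain: "u \<in> P \<Longrightarrow> v \<in> P \<Longrightarrow> chn u = chn v \<Longrightarrow> col u = col v"
  using two_color unfolding two_color_function_def by blast

lemma color_connected:
  "u \<in> P \<Longrightarrow> v \<in> P \<Longrightarrow> equivclp (covers_in P) u v \<Longrightarrow> chn u = chn v + 1 \<Longrightarrow> col u \<noteq> col v"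
  using two_color unfolding two_color_function_def by blast

lemmas colors = colors_distinct color_cases color_chain color_connected

definition C :: "nat \<Rightarrow> 'p set" where "C j = {u \<in> P. chn u = j}"

lemma chn_image: "chn ` P = {1..M}"
  using chain by (simp add: chain_function_def)

lemma chn_range: "u \<in> P \<Longrightarrow> chn u \<in> {1..M}"
  using chn_image by blast

lemma chn_cover: "covers_in P u v \<Longrightarrow> chn u = chn v \<or> chn u = chn v + 1"
  using chain unfolding chain_function_def by blast

lemma C_nonempty:
  assumes "j \<in> {1..M}" shows "C j \<noteq> {}"
proof -
  have "j \<in> chn ` P" using assms chn_image by simp
  then show ?thesis unfolding C_def by blast
qed

lemma C_out: "j \<notin> {1..M} \<Longrightarrow> C j = {}"
  using chn_range unfolding C_def by blast

lemma C_total: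
  assumes "u \<in> C j" "v \<in> C j" shows "u \<le> v \<or> v \<le> u"
proof -
  have "j \<in> {1..M}" using assms(1) chn_range unfolding C_def by blast
  then have "Complete_Partial_Order.chain (\<le>) (C j)"
    using chain unfolding chain_function_def C_def by blast
  then show ?thesis using assms by (rule Complete_Partial_Order.chainD)
qed

lemma finC: "finite (C j)"
  using finP by (simp add: C_def)

definition pos :: "'p \<Rightarrow> nat" where "pos u = card {v \<in> C (chn u). v < u}"

definition seg :: "nat \<Rightarrow> nat \<Rightarrow> 'p set" where "seg j s = {u \<in> C j. pos u < s}"

lemma down_closed_seg:
  assumes "x \<subseteq> C j" and down: "\<And>u v. u \<in> x \<Longrightarrow> v \<in> C j \<Longrightarrow> v \<le> u \<Longrightarrow> v \<in> x"
  shows "x = seg j (card x)"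
proof -
  have fx: "finite x" using assms(1) finC finite_subset by blast
  have "u \<in> x \<longleftrightarrow> pos u < card x" if u: "u \<in> C j" for u
  proof
    assume "u \<in> x"
    then have "{v \<in> C (chn u). v < u} \<subset> x" using down u by (auto simp: C_def)
    then show "pos u < card x" unfolding pos_def using fx psubset_card_mono by blast
  next
    assume "pos u < card x"
    show "u \<in> x"
    proof (rule ccontr)
      assume "u \<notin> x"
      have "x \<subseteq> {v \<in> C (chn u). v < u}"
      proof
        fix v assume v: "v \<in> x"
        then have "v \<in> C j" "\<not> u \<le> v" using assms(1) down u \<open>u \<notin> x\<close> by blast+
        then show "v \<in> {v \<in> C (chn u). v < u}" using C_total[OF u, of v] u by (auto simp: C_def)
      qed
      then have "card x \<le> pos u" unfolding pos_def using finC by (intro card_mono) auto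
      then show False using \<open>pos u < card x\<close> by simp
    qed
  qed
  then show ?thesis using assms(1) by (auto simp: seg_def)
qed

lemma pos_mono: "u \<in> C j \<Longrightarrow> v \<in> C j \<Longrightarrow> u < v \<Longrightarrow> pos u < pos v"
  unfolding pos_def using finP by (intro psubset_card_mono) (auto simp: C_def)

lemma pos_bij: "bij_betw pos (C j) {..<card (C j)}"
proof -
  have inj: "inj_on pos (C j)"
    by (rule inj_onI) (metis C_total less_irrefl order_le_less pos_mono)
  have "pos ` C j \<subseteq> {..<card (C j)}"
  proof
    fix n assume "n \<in> pos ` C j"
    then obtain u where u: "u \<in> C j" "n = pos u" by blast
    then have "{v \<in> C (chn u). v < u} \<subset> C j" by (auto simp: C_def)
    then show "n \<in> {..<card (C j)}" using u finC by (simp add: pos_def psubset_card_mono)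
  qed
  moreover have "card (pos ` C j) = card {..<card (C j)}" using card_image[OF inj] by simp
  ultimately have "pos ` C j = {..<card (C j)}" by (intro card_subset_eq) simp_all
  then show ?thesis using inj by (simp add: bij_betw_def)
qed

lemma card_seg: "s \<le> card (C j) \<Longrightarrow> card (seg j s) = s"
proof -
  assume s: "s \<le> card (C j)"
  have "pos ` seg j s = {..<s}"
  proof
    show "{..<s} \<subseteq> pos ` seg j s"
    proof
      fix n assume "n \<in> {..<s}"
      then have "n \<in> pos ` C j" using s pos_bij[of j] by (simp add: bij_betw_def)
      then show "n \<in> pos ` seg j s" using \<open>n \<in> {..<s}\<close> by (auto simp: seg_def)
    qed
  qed (auto simp: seg_def)
  moreover have "inj_on pos (seg j s)"
    using pos_bij[of j] by (auto simp: bij_betw_def seg_def inj_on_def)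
  ultimately show ?thesis using card_image by fastforce
qed

definition below :: "nat \<Rightarrow> nat \<Rightarrow> 'p set" where
  "below j s = {w \<in> C (Suc j). \<exists>v\<in>seg j s. w \<le> v}"

lemma below_seg: "below j s = seg (Suc j) (card (below j s))"
  by (rule down_closed_seg) (auto simp: below_def intro: order_trans)

lemma seg_full: "seg j (card (C j)) = C j"
  using pos_bij[of j] by (auto simp: seg_def bij_betw_def)

lemma top_exists:
  assumes "C j \<noteq> {}"
  obtains u where "u \<in> C j" "\<And>v. v \<in> C j \<Longrightarrow> v \<le> u"
proof -
  obtain u where u: "u \<in> C j" "\<And>v. v \<in> C j \<Longrightarrow> u \<le> v \<Longrightarrow> v = u"
    using finite_has_maximal[OF finC assms] by (metis (no_types))
  then show thesis using that C_total by blast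
qed

text \<open>A cover of the top of a chain must leave that chain, and covers lower the chain index by
  at most one.\<close>

lemma top_cover:
  assumes u: "u \<in> C j" "\<And>v. v \<in> C j \<Longrightarrow> v \<le> u" and "\<not> maximal_in P u"
  obtains v where "covers_in P u v" "j = Suc (chn v)"
proof -
  obtain y where "y \<in> P" "u < y" using assms by (auto simp: maximal_in_def C_def)
  then obtain v where v: "covers_in P u v" using covers_in_above[OF finP, of u y] u by (auto simp: C_def)
  then have "v \<in> P" "u < v" by (auto simp: covers_in_def)
  then have "chn v \<noteq> j" using u(2)[of v] by (auto simp: C_def)
  then show thesis using chn_cover[OF v] u(1) v by (intro that[of v]) (auto simp: C_def)
qed

sublocale chain_system M "\<lambda>j. card (C j)" "\<lambda>j s. card (below j s)"
proof
  show "card (C j) = 0" if "j \<notin> {1..M}" for j using C_out[OF that] by simp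
  show "card (below j 0) = 0" for j by (simp add: below_def seg_def)
  show "card (below j s) \<le> card (below j t)" if "s \<le> t" for j s t
    using that finC by (intro card_mono) (auto simp: below_def seg_def intro: finite_subset)
  show "card (below j s) \<le> card (C (Suc j))" for j s
    using finC by (intro card_mono) (auto simp: below_def)
  \<comment> \<open>The top of chain \<open>Suc j\<close> has index above 2, so by the max property
    it is not maximal and lies below an element of chain \<open>j\<close>.\<close>
  show "card (below j (card (C j))) = card (C (Suc j))" if "2 \<le> j" for j
  proof (cases "C (Suc j) = {}")
    case False
    then obtain u where u: "u \<in> C (Suc j)" "\<And>v. v \<in> C (Suc j) \<Longrightarrow> v \<le> u" using top_exists by blast
    have "\<not> maximal_in P u" using max_prop u(1) that by (auto simp: max_property_def C_def)
    then obtain v where v: "covers_in P u v" "Suc j = Suc (chn v)" using top_cover[OF u] by blast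
    then have "v \<in> C j" "u \<le> v" by (auto simp: covers_in_def C_def)
    then have "below j (card (C j)) = C (Suc j)"
      unfolding below_def seg_full using u(2) by (auto intro: order_trans)
    then show ?thesis by simp
  qed (simp add: below_def)
qed

text \<open>A two-color function separates neighbouring chains only inside a connected component. If
  the top of chain \<open>Suc j\<close> is not maximal, a cover connects it to chain
  \<open>j\<close>. If it is maximal, then \<open>j = 1\<close> and the tops of the first two chains
  are distinct maximal elements, separated by the max property.\<close>

lemma adjacent_colors:
  assumes "u \<in> C (Suc j)" "v \<in> C j" shows "col u \<noteq> col v"
proof -
  obtain u' where u': "u' \<in> C (Suc j)" "\<And>v. v \<in> C (Suc j) \<Longrightarrow> v \<le> u'" using top_exists assms by blast
  have cu: "col u = col u'" using colors(3)[of u u'] assms u' by (simp add: C_def)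
  show ?thesis
  proof (cases "maximal_in P u'")
    case False
    then obtain w where w: "covers_in P u' w" "Suc j = Suc (chn w)" using top_cover[OF u'] by blast
    then have "equivclp (covers_in P) u' w" by (intro r_into_equivclp)
    then have "col u' \<noteq> col w" using colors(4)[of u' w] w u' by (auto simp: covers_in_def C_def)
    moreover have "col w = col v" using colors(3)[of w v] w assms by (auto simp: covers_in_def C_def)
    ultimately show ?thesis using cu by simp
  next
    case True
    then have "Suc j \<le> 2" using max_prop u'(1) by (auto simp: max_property_def C_def)
    moreover have "1 \<le> j" using assms(2) chn_range by (auto simp: C_def)
    ultimately have j: "j = 1" by simp
    obtain v' where v': "v' \<in> C j" "\<And>v. v \<in> C j \<Longrightarrow> v \<le> v'" using top_exists assms by blast
    have "maximal_in P v'"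
    proof (rule ccontr)
      assume "\<not> maximal_in P v'"
      then obtain w where "covers_in P v' w" "j = Suc (chn w)" using top_cover[OF v'] by blast
      then show False using j chn_range[of w] by (auto simp: covers_in_def)
    qed
    moreover have "v' \<noteq> u'" using u' v' by (auto simp: C_def)
    ultimately have "col v' \<noteq> col u'" using True max_prop by (auto simp: max_property_def)
    moreover have "col v' = col v" using colors(3)[of v' v] v' assms by (simp add: C_def)
    ultimately show ?thesis using cu by simp
  qed
qed

end

section \<open>Order ideals, height vectors and color components\<close>

context colored_grid begin

abbreviation "L \<equiv> order_ideals P"

definition vec :: "'p set \<Rightarrow> nat \<Rightarrow> nat" where "vec x j = card (x \<inter> C j)"

definition idl :: "(nat \<Rightarrow> nat) \<Rightarrow> 'p set" where "idl X = {u \<in> P. pos u < X (chn u)}"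

lemma idl_seg: "idl X \<inter> C j = seg j (X j)"
  by (auto simp: idl_def seg_def C_def)

lemma vec_idl: "X \<in> vecs \<Longrightarrow> vec (idl X) = X"
  by (rule ext) (simp add: vec_def idl_seg card_seg vecs_len)

lemma ideal_seg: "x \<in> L \<Longrightarrow> x \<inter> C j = seg j (vec x j)"
  unfolding vec_def by (rule down_closed_seg) (auto simp: order_ideals_def C_def)

lemma idl_vec:
  assumes "x \<in> L" shows "idl (vec x) = x"
proof -
  have "u \<in> x \<longleftrightarrow> pos u < vec x (chn u)" if "u \<in> P" for u
  proof -
    have "u \<in> x \<longleftrightarrow> u \<in> x \<inter> C (chn u)" using that by (simp add: C_def)
    also have "\<dots> \<longleftrightarrow> pos u < vec x (chn u)" unfolding ideal_seg[OF assms] using that by (simp add: seg_def C_def)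
    finally show ?thesis .
  qed
  moreover have "x \<subseteq> P" using assms by (simp add: order_ideals_def)
  ultimately show ?thesis unfolding idl_def by blast
qed

lemma vec_vecs:
  assumes "x \<in> L" shows "vec x \<in> vecs"
proof -
  have "card (below j (vec x j)) \<le> vec x (Suc j)" for j
  proof -
    have "below j (vec x j) \<subseteq> x \<inter> C (Suc j)"
      using assms unfolding below_def ideal_seg[OF assms, symmetric] by (auto simp: order_ideals_def C_def)
    then show ?thesis unfolding vec_def[of x "Suc j"] using finC by (intro card_mono) auto
  qed
  moreover have "vec x j \<le> card (C j)" for j unfolding vec_def using finC by (intro card_mono) auto
  ultimately show ?thesis by (simp add: vecs_def)
qed

text \<open>It suffices to descend along covers: inside a chain the position drops, and a cover
  coming from the next chain is controlled by the bound on \<open>below\<close>.\<close>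

lemma idl_L:
  assumes X: "X \<in> vecs" shows "idl X \<in> L"
proof -
  have cover: "z \<in> idl X" if x: "x \<in> idl X" and zx: "covers_in P z x" for x z
  proof -
    have zP: "z \<in> P" and "z < x" using zx by (auto simp: covers_in_def)
    have xP: "x \<in> P" and px: "pos x < X (chn x)" using x by (auto simp: idl_def)
    from chn_cover[OF zx] show ?thesis
    proof
      assume eq: "chn z = chn x"
      then have "pos z < pos x" using pos_mono[of z "chn x" x] zP xP \<open>z < x\<close> by (simp add: C_def)
      then show ?thesis using px zP eq by (simp add: idl_def)
    next
      assume eq: "chn z = chn x + 1"
      then have "z \<in> below (chn x) (X (chn x))"
        unfolding below_def using zP xP px \<open>z < x\<close> by (auto simp: C_def seg_def intro!: bexI[of _ x])
      then have "pos z < card (below (chn x) (X (chn x)))"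
        using below_seg[of "chn x" "X (chn x)"] by (auto simp: seg_def)
      also have "\<dots> \<le> X (chn z)" using X eq by (simp add: vecs_def)
      finally show ?thesis using zP by (simp add: idl_def)
    qed
  qed
  have "y \<in> idl X" if "x \<in> idl X" "y \<in> P" "y \<le> x" for x y
    using that
  proof (induction "card {v \<in> P. v < x}" arbitrary: x rule: less_induct)
    case less
    show ?case
    proof (cases "y = x")
      case False
      have xP: "x \<in> P" using less.prems by (simp add: idl_def)
      obtain z where z: "covers_in P z x" "y \<le> z"
        using covers_in_below[OF finP, of y x] less.prems False xP by (metis order_le_less)
      then have "z < x" "z \<in> P" by (auto simp: covers_in_def)
      then have "card {v \<in> P. v < z} < card {v \<in> P. v < x}"
        using finP by (intro psubset_card_mono) (auto intro: less_trans)
      then show ?thesis using less.hyps cover[OF less.prems(1) z(1)] less.prems(2) z(2) by blast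
    qed (use less.prems in simp)
  qed
  then show ?thesis by (auto simp: order_ideals_def idl_def)
qed

lemma bij_vec: "bij_betw vec L vecs"
  by (rule bij_betw_byWitness[where f' = idl]) (auto simp: idl_vec vec_idl vec_vecs idl_L)

lemma finL: "finite L"
  using bij_betw_finite[OF bij_vec] finite_vecs by simp

lemma card_tot:
  assumes "x \<in> L" shows "int (card x) = tot True (vec x) + tot False (vec x)"
proof -
  have xP: "x \<subseteq> P" using assms by (simp add: order_ideals_def)
  have "x = (\<Union>j\<in>{..M}. x \<inter> C j)" using xP chn_range by (auto simp: C_def)
  then have "card x = card (\<Union>j\<in>{..M}. x \<inter> C j)" by simp
  also have "\<dots> = (\<Sum>j\<in>{..M}. vec x j)"
    unfolding vec_def by (rule card_UN_disjoint) (auto simp: C_def finP intro: finite_subset[OF xP])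
  finally have "int (card x) = (\<Sum>j\<in>{..M}. int (vec x j))" by simp
  also have "{..M} = {j. j \<le> M \<and> even j = True} \<union> {j. j \<le> M \<and> even j = False}" by auto
  also have "(\<Sum>j\<in>\<dots>. int (vec x j)) = tot True (vec x) + tot False (vec x)"
    unfolding tot_def by (rule sum.union_disjoint) auto
  finally show ?thesis .
qed

lemma ideal_subset: "x \<in> L \<Longrightarrow> x \<subseteq> P"
  and ideal_down: "x \<in> L \<Longrightarrow> u \<in> x \<Longrightarrow> v \<in> P \<Longrightarrow> v \<le> u \<Longrightarrow> v \<in> x"
  unfolding order_ideals_def by blast+

lemma idealI: "x \<subseteq> P \<Longrightarrow> (\<And>u v. u \<in> x \<Longrightarrow> v \<in> P \<Longrightarrow> v \<le> u \<Longrightarrow> v \<in> x) \<Longrightarrow> x \<in> L"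
  unfolding order_ideals_def by blast

lemma finite_ideal: "x \<in> L \<Longrightarrow> finite x"
  using finite_subset[OF ideal_subset finP] .

lemma covers_L:
  "covers_in L s t \<longleftrightarrow> s \<in> L \<and> t \<in> L \<and> (\<exists>u\<in>P - s. t = insert u s)"
proof
  assume st: "covers_in L s t"
  then have s: "s \<in> L" "t \<in> L" "s \<subset> t" unfolding covers_in_def by blast+
  have "finite (t - s)" "t - s \<noteq> {}" using s finite_ideal[of t] by blast+
  then obtain u where u: "u \<in> t - s" "\<And>v. v \<in> t - s \<Longrightarrow> v \<le> u \<Longrightarrow> v = u"
    using finite_has_minimal by (metis (no_types))
  have uP: "u \<in> P" using u(1) ideal_subset[OF s(2)] by blast
  have "insert u s \<in> L"
  proof (rule idealI)
    show "insert u s \<subseteq> P" using uP ideal_subset[OF s(1)] by blast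
    fix v y assume vy: "v \<in> insert u s" "y \<in> P" "y \<le> v"
    show "y \<in> insert u s"
    proof (cases "v = u")
      case True
      then have "y \<in> t" using ideal_down[OF s(2)] u(1) vy by blast
      then show ?thesis using u(2)[of y] True vy(3) by blast
    next
      case False
      then show ?thesis using ideal_down[OF s(1)] vy by blast
    qed
  qed
  moreover have "s \<subset> insert u s" "insert u s \<subseteq> t" using u(1) s(3) by blast+
  ultimately have "insert u s = t" using st unfolding covers_in_def by (metis order_le_less)
  then show "s \<in> L \<and> t \<in> L \<and> (\<exists>u\<in>P - s. t = insert u s)"
    using s u(1) uP by blast
next
  assume "s \<in> L \<and> t \<in> L \<and> (\<exists>u\<in>P - s. t = insert u s)"
  then obtain u where u: "s \<in> L" "t \<in> L" "u \<in> P - s" "t = insert u s" by blast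
  have "\<not> (s \<subset> z \<and> z \<subset> t)" for z
    unfolding u(4) by (cases "u \<in> z") blast+
  moreover have "s \<subset> t" using u(3,4) by blast
  ultimately show "covers_in L s t" using u(1,2) unfolding covers_in_def by blast
qed

lemma ideal_edge_color_insert: "u \<notin> s \<Longrightarrow> ideal_edge_color col s (insert u s) = col u"
proof -
  assume "u \<notin> s"
  then have "insert u s - s = {u}" by blast
  then show ?thesis by (simp add: ideal_edge_color_def)
qed

lemma color_edge_L:
  "color_edge L (ideal_edge_color col) i s t \<longleftrightarrow> s \<in> L \<and> t \<in> L \<and> (\<exists>u\<in>P - s. t = insert u s \<and> col u = i)"
proof
  assume e: "color_edge L (ideal_edge_color col) i s t"
  then obtain u where u: "s \<in> L" "t \<in> L" "u \<in> P - s" "t = insert u s"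
    unfolding color_edge_def covers_L by blast
  moreover have "col u = i"
    using e ideal_edge_color_insert[of u s] u(3,4) by (simp add: color_edge_def)
  ultimately show "s \<in> L \<and> t \<in> L \<and> (\<exists>u\<in>P - s. t = insert u s \<and> col u = i)" by blast
next
  assume "s \<in> L \<and> t \<in> L \<and> (\<exists>u\<in>P - s. t = insert u s \<and> col u = i)"
  then obtain u where u: "s \<in> L" "t \<in> L" "u \<in> P - s" "t = insert u s" "col u = i" by blast
  then have "covers_in L s t" unfolding covers_L by blast
  then show "color_edge L (ideal_edge_color col) i s t"
    using ideal_edge_color_insert[of u s] u(3-5) by (simp add: color_edge_def)
qed

text \<open>The parity of the chains colored \<alpha>, with \<open>True\<close> for even.
  Alternation lets chain 1 decide, and that chain is odd.\<close>

definition par :: bool where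
  "par = (if \<exists>u\<in>P. chn u = 1 \<and> col u = \<alpha> then False else True)"

lemma col_parity: "u \<in> P \<Longrightarrow> col u = \<alpha> \<longleftrightarrow> even (chn u) = par"
proof -
  have "\<forall>u\<in>C (Suc j). col u = \<alpha> \<longleftrightarrow> even (Suc j) = par" for j
  proof (induction j)
    case 0
    have "col u = \<alpha> \<longleftrightarrow> \<not> par" if u: "u \<in> C (Suc 0)" for u
    proof -
      have "u \<in> P" "chn u = 1" using u by (simp_all add: C_def)
      moreover have "col v = col u" if "v \<in> P" "chn v = 1" for v
        using colors(3)[of v u] that \<open>u \<in> P\<close> \<open>chn u = 1\<close> by simp
      ultimately show ?thesis unfolding par_def by metis
    qed
    then show ?case by simp
  next
    case (Suc j)
    show ?case
    proof
      fix u assume u: "u \<in> C (Suc (Suc j))"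
      then have "Suc (Suc j) \<in> {1..M}" using C_out by blast
      then have "C (Suc j) \<noteq> {}" by (intro C_nonempty) simp
      then obtain v where v: "v \<in> C (Suc j)" by blast
      have "col u \<noteq> col v" by (rule adjacent_colors[OF u v])
      then have "col u = \<alpha> \<longleftrightarrow> col v \<noteq> \<alpha>" using colors(2)[of u] colors(2)[of v] u v by (auto simp: C_def)
      also have "\<dots> \<longleftrightarrow> even (Suc (Suc j)) = par" using Suc v even_Suc[of "Suc j"] by metis
      finally show "col u = \<alpha> \<longleftrightarrow> even (Suc (Suc j)) = par" .
    qed
  qed
  moreover assume u: "u \<in> P"
  then obtain j where "chn u = Suc j" using chn_range[of u] by (cases "chn u") auto
  ultimately show "col u = \<alpha> \<longleftrightarrow> even (chn u) = par" using u by (auto simp: C_def)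
qed

definition cpar :: "'c \<Rightarrow> bool" where "cpar i = (if i = \<alpha> then par else \<not> par)"

lemma col_cpar:
  assumes "u \<in> P" "i \<in> {\<alpha>, \<beta>}" shows "col u = i \<longleftrightarrow> even (chn u) = cpar i"
proof (cases "i = \<alpha>")
  case True
  then show ?thesis using col_parity[OF assms(1)] by (simp only: cpar_def if_True simp_thms)
next
  case False
  then have "i = \<beta>" using assms(2) by blast
  then have "col u = i \<longleftrightarrow> col u \<noteq> \<alpha>" using colors(1) colors(2)[OF assms(1)] by metis
  then show ?thesis using col_parity[OF assms(1)] False by (simp only: cpar_def if_False) blast
qed

lemma vec_insert:
  assumes "x \<in> L" "u \<in> P - x"
  shows "vec (insert u x) = (vec x)(chn u := Suc (vec x (chn u)))"
proof
  fix j
  have fin: "finite (x \<inter> C j)" using finC by blast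
  show "vec (insert u x) j = ((vec x)(chn u := Suc (vec x (chn u)))) j"
  proof (cases "j = chn u")
    case True
    then have "insert u x \<inter> C j = insert u (x \<inter> C j)" "u \<notin> x \<inter> C j" using assms(2) by (auto simp: C_def)
    then show ?thesis using True fin by (simp add: vec_def)
  next
    case False
    then have "insert u x \<inter> C j = x \<inter> C j" by (auto simp: C_def)
    then show ?thesis using False by (simp add: vec_def)
  qed
qed

lemma idl_Suc:
  assumes X: "X \<in> vecs" and Y: "X(j := Suc (X j)) \<in> vecs"
  obtains u where "u \<in> P - idl X" "chn u = j" "idl (X(j := Suc (X j))) = insert u (idl X)"
proof -
  have "X j < card (C j)" using vecs_len[OF Y, of j] by simp
  then have "X j \<in> pos ` C j" using pos_bij[of j] by (simp add: bij_betw_def)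
  then obtain u where u: "u \<in> C j" "pos u = X j" by auto
  have inj: "v = u" if "v \<in> C j" "pos v = X j" for v
    using pos_bij[of j] u that by (auto simp: bij_betw_def inj_on_def)
  have "idl (X(j := Suc (X j))) = insert u (idl X)"
  proof (rule Set.set_eqI)
    fix v
    show "v \<in> idl (X(j := Suc (X j))) \<longleftrightarrow> v \<in> insert u (idl X)"
    proof (cases "chn v = j")
      case True
      then have "v \<in> P \<Longrightarrow> pos v = X j \<Longrightarrow> v = u" using inj[of v] by (simp add: C_def)
      then show ?thesis using True u by (cases "pos v = X j") (auto simp: idl_def C_def less_Suc_eq)
    next
      case False
      then have "v \<noteq> u" using u(1) by (auto simp: C_def)
      then show ?thesis using False by (simp add: idl_def)
    qed
  qed
  moreover have "u \<in> P - idl X" "chn u = j" using u by (auto simp: C_def idl_def)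
  ultimately show thesis using that by blast
qed

definition low :: "bool \<Rightarrow> (nat \<Rightarrow> nat) \<Rightarrow> nat \<Rightarrow> nat" where
  "low p X j = (if even j = p then lo X j else X j)"

definition high :: "bool \<Rightarrow> (nat \<Rightarrow> nat) \<Rightarrow> nat \<Rightarrow> nat" where
  "high p X j = (if even j = p then hi X j else X j)"

lemma low_high:
  assumes "X \<in> vecs"
  shows "low p X \<in> vecs" "same_off p X (low p X)" "high p X \<in> vecs" "same_off p X (high p X)"
proof -
  show so: "same_off p X (low p X)" "same_off p X (high p X)" by (simp_all add: same_off_def low_def high_def)
  have b: "lo X j \<le> hi X j" for j using vecs_bounds[OF assms, of j] by simp
  show "low p X \<in> vecs" by (rule vecs_update[OF assms so(1)]) (simp add: low_def b)
  show "high p X \<in> vecs" by (rule vecs_update[OF assms so(2)]) (simp add: high_def b)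
qed

lemma same_off_refl: "same_off p X X"
  and same_off_sym: "same_off p X Y \<Longrightarrow> same_off p Y X"
  and same_off_trans: "same_off p X Y \<Longrightarrow> same_off p Y Z \<Longrightarrow> same_off p X Z"
  by (simp_all add: same_off_def)

definition component :: "bool \<Rightarrow> 'p set \<Rightarrow> 'p set set" where
  "component p x = {y \<in> L. same_off p (vec x) (vec y)}"

text \<open>An ideal other than the least of its component has a chain of this color above its
  \<open>lo\<close>; lowering that chain by one respects all constraints.\<close>

lemma component_pred:
  assumes x: "x \<in> L" and y: "y \<in> component (cpar i) x" "y \<noteq> idl (low (cpar i) (vec x))" and i: "i \<in> {\<alpha>, \<beta>}"
  shows "\<exists>s\<in>component (cpar i) x. color_edge L (ideal_edge_color col) i s y"
proof -
  let ?p = "cpar i" and ?X = "vec x" and ?Y = "vec y"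
  have yL: "y \<in> L" and so: "same_off ?p ?X ?Y" using y(1) by (auto simp: component_def)
  have Y: "?Y \<in> vecs" and X: "?X \<in> vecs" using vec_vecs yL x by auto
  have "?Y \<noteq> low ?p ?X" using y(2) idl_vec[OF yL] by metis
  then obtain j where j: "?Y j \<noteq> low ?p ?X j" by auto
  have ej: "even j = ?p"
  proof (rule ccontr)
    assume e: "even j \<noteq> ?p"
    then show False using j same_offD[OF so e] by (simp add: low_def)
  qed
  then have "lo ?Y j < ?Y j"
    using j same_off_lo_hi(1)[OF so ej] vecs_bounds[OF Y, of j] by (simp add: low_def)
  define Z where "Z = ?Y(j := ?Y j - 1)"
  have soZ: "same_off ?p ?Y Z" unfolding Z_def same_off_def using ej by simp
  have Zv: "Z \<in> vecs"
  proof (rule vecs_update[OF Y soZ])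
    fix k :: nat assume "even k = ?p"
    then show "lo ?Y k \<le> Z k \<and> Z k \<le> hi ?Y k"
      using vecs_bounds[OF Y, of k] \<open>lo ?Y j < ?Y j\<close> unfolding Z_def by auto
  qed
  have ZY: "Z(j := Suc (Z j)) = ?Y" using \<open>lo ?Y j < ?Y j\<close> by (auto simp: Z_def)
  obtain u where u: "u \<in> P - idl Z" "chn u = j" "idl ?Y = insert u (idl Z)"
    using idl_Suc[OF Zv, of j] Y unfolding ZY by blast
  have "col u = i" using col_cpar[of u i] u ej i by blast
  then have "color_edge L (ideal_edge_color col) i (idl Z) y"
    unfolding color_edge_L using u idl_L[OF Zv] yL idl_vec[OF yL] by auto
  moreover have "idl Z \<in> component ?p x"
    using idl_L[OF Zv] vec_idl[OF Zv] same_off_trans[OF so soZ] by (simp add: component_def)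
  ultimately show ?thesis by blast
qed

lemma edge_same_off:
  assumes "color_edge L (ideal_edge_color col) i s t" "i \<in> {\<alpha>, \<beta>}"
  shows "same_off (cpar i) (vec s) (vec t)" "card t = card s + 1"
    "tot (cpar i) (vec t) = tot (cpar i) (vec s) + 1" "s \<in> L" "t \<in> L"
proof -
  obtain u where u: "s \<in> L" "t \<in> L" "u \<in> P - s" "t = insert u s" "col u = i"
    using assms(1) unfolding color_edge_L by blast
  have e: "even (chn u) = cpar i" using col_cpar[of u i] u assms(2) by blast
  show so: "same_off (cpar i) (vec s) (vec t)"
    unfolding u(4) vec_insert[OF u(1,3)] same_off_def using e by simp
  have "finite s" using u(1) finP by (auto simp: order_ideals_def intro: finite_subset)
  then show c: "card t = card s + 1" using u by simp
  show "tot (cpar i) (vec t) = tot (cpar i) (vec s) + 1"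
    using card_tot[OF u(1)] card_tot[OF u(2)] c tot_same_off[OF so] by (cases "cpar i") simp_all
  show "s \<in> L" "t \<in> L" by fact+
qed

text \<open>With the other color fixed, the component is a product of intervals of heights. It has a
  least and a greatest ideal, so rank and length in it are differences of cardinalities.\<close>

lemma color_weight_L:
  assumes x: "x \<in> L" and i: "i \<in> {\<alpha>, \<beta>}"
  shows "color_weight L (ideal_edge_color col) i x = wgt (cpar i) (vec x)"
proof -
  let ?p = "cpar i" and ?E = "color_edge L (ideal_edge_color col) i" and ?X = "vec x"
  define z where "z = idl (low ?p ?X)"
  define w where "w = idl (high ?p ?X)"
  define g where "g y = card y - card z" for y :: "'p set"
  have X: "?X \<in> vecs" by (rule vec_vecs[OF x])
  note lh = low_high[OF X, of ?p]
  have z: "z \<in> L" "vec z = low ?p ?X" and w: "w \<in> L" "vec w = high ?p ?X"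
    using idl_L vec_idl lh by (simp_all add: z_def w_def)
  have zC: "z \<in> component ?p x" and wC: "w \<in> component ?p x" and xC: "x \<in> component ?p x"
    using z w x lh same_off_refl by (simp_all add: component_def)
  have sub: "z \<subseteq> y \<and> y \<subseteq> w" if y: "y \<in> component ?p x" for y
  proof -
    have yL: "y \<in> L" and so: "same_off ?p ?X (vec y)" using y by (auto simp: component_def)
    have "low ?p ?X j \<le> vec y j \<and> vec y j \<le> high ?p ?X j" for j
    proof (cases "even j = ?p")
      case True
      then show ?thesis
        using vecs_bounds[OF vec_vecs[OF yL], of j] same_off_lo_hi[OF so True] by (simp add: low_def high_def)
    next
      case False
      then show ?thesis using same_offD[OF so False] by (simp add: low_def high_def)
    qed
    then have "idl (low ?p ?X) \<subseteq> idl (vec y) \<and> idl (vec y) \<subseteq> idl (high ?p ?X)"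
      unfolding idl_def by (auto intro: less_le_trans)
    then show ?thesis unfolding idl_vec[OF yL] z_def w_def .
  qed
  have finL': "finite y" if "y \<in> L" for y
    using that finP by (auto simp: order_ideals_def intro: finite_subset)
  have le: "card z \<le> card y \<and> card y \<le> card w" if "y \<in> component ?p x" for y
    using sub[OF that] finL' that w(1) by (auto simp: component_def intro!: card_mono)
  have step: "\<exists>s\<in>component ?p x. ?E s y" if "y \<in> component ?p x" "y \<noteq> z" for y
    using component_pred[OF x that(1) _ i] that(2) by (simp add: z_def)
  have ge: "g y = g s + 1" if "s \<in> component ?p x" "?E s y" for s y
    using edge_same_off(2)[OF that(2) i] le[OF that(1)] by (simp add: g_def Suc_diff_le)
  have rank: "rank_wrt ?E (component ?p x) x = g x" "length_wrt ?E (component ?p x) = g w"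
  proof -
    have a: "g y = g s + 1" if "s \<in> component ?p x" "y \<in> component ?p x" "?E s y" for s y using ge that by blast
    have b: "g z = 0" by (simp add: g_def)
    have c: "g y \<le> g w" if "y \<in> component ?p x" for y
      using le[OF that] unfolding g_def by (intro diff_le_mono) blast
    show "rank_wrt ?E (component ?p x) x = g x" "length_wrt ?E (component ?p x) = g w"
      using rank_unique(2,3)[of "component ?p x" ?E g z w, OF a step zC b wC c] xC by blast+
  qed
  have "color_comp L (ideal_edge_color col) i x = component ?p x"
  proof
    have "same_off ?p ?X (vec y)" if "equivclp ?E x y" for y
      using that
    proof (induction rule: equivclp_induct)
      case base
      show ?case by (rule same_off_refl)
    next
      case (step y z)
      then have "same_off ?p (vec y) (vec z)"
        using edge_same_off(1)[OF _ i] same_off_sym by blast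
      then show ?case using step same_off_trans by blast
    qed
    then show "color_comp L (ideal_edge_color col) i x \<subseteq> component ?p x"
      by (auto simp: color_comp_def component_def)
    have down: "rtranclp ?E z y" if "y \<in> component ?p x" for y
      using that
    proof (induction "g y" arbitrary: y rule: less_induct)
      case less
      show ?case
      proof (cases "y = z")
        case False
        then obtain s where s: "s \<in> component ?p x" "?E s y" using step less.prems by blast
        then have "rtranclp ?E z s" using less.hyps ge by simp
        then show ?thesis using s(2) by (rule rtranclp.rtrancl_into_rtrancl)
      qed simp
    qed
    show "component ?p x \<subseteq> color_comp L (ideal_edge_color col) i x"
    proof
      fix y assume y: "y \<in> component ?p x"
      have "equivclp ?E x z" using predicate2D[OF rtranlcp_le_equivclp down[OF xC]] by (rule equivclp_sym)
      moreover have "equivclp ?E z y" using predicate2D[OF rtranlcp_le_equivclp down[OF y]] .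
      ultimately have "equivclp ?E x y" by (rule equivclp_trans)
      then show "y \<in> color_comp L (ideal_edge_color col) i x"
        using y by (simp add: color_comp_def component_def)
    qed
  qed
  then have "color_weight L (ideal_edge_color col) i x = 2 * int (g x) - int (g w)"
    unfolding color_weight_def using rank by simp
  also have "\<dots> = 2 * int (card x) - int (card z) - int (card w)"
    using le[OF xC] le[OF wC] by (simp add: g_def of_nat_diff)
  also have "\<dots> = 2 * tot ?p ?X - tot ?p (low ?p ?X) - tot ?p (high ?p ?X)"
    using card_tot[OF x] card_tot[OF z(1)] card_tot[OF w(1)] z(2) w(2)
      tot_same_off[OF lh(2)] tot_same_off[OF lh(4)]
    by (cases ?p) simp_all
  also have "\<dots> = wgt ?p ?X"
  proof -
    have "wgt ?p ?X = (\<Sum>j | j \<le> M \<and> even j = ?p. 2 * int (?X j) - int (low ?p ?X j) - int (high ?p ?X j))"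
      unfolding wgt_def by (rule sum.cong) (auto simp: dev_def low_def high_def)
    then show ?thesis unfolding tot_def by (simp only: sum_subtractf sum_distrib_left)
  qed
  finally show ?thesis .
qed

lemma rank_L:
  shows "is_rank_function (covers_in L) L card (card P)"
    "x \<in> L \<Longrightarrow> rank_wrt (covers_in L) L x = card x" "poset_length L = card P"
proof -
  have edge: "card t = card s + 1" if "s \<in> L" "t \<in> L" "covers_in L s t" for s t
  proof -
    have "finite s" using that(1) finP by (auto simp: order_ideals_def intro: finite_subset)
    then show ?thesis using that(3) unfolding covers_L by auto
  qed
  have pred: "\<exists>s\<in>L. covers_in L s t" if t: "t \<in> L" "t \<noteq> {}" for t
  proof -
    have "finite t" using t(1) finP by (auto simp: order_ideals_def intro: finite_subset)
    then obtain u where u: "u \<in> t" "\<And>v. v \<in> t \<Longrightarrow> u \<le> v \<Longrightarrow> v = u"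
      using finite_has_maximal[OF _ t(2)] by (metis (no_types))
    have "t - {u} \<in> L" using t(1) u by (auto simp: order_ideals_def)
    moreover have "u \<in> P" using t(1) u(1) by (auto simp: order_ideals_def)
    ultimately have "covers_in L (t - {u}) t" unfolding covers_L using t(1) u(1) by auto
    then show ?thesis using \<open>t - {u} \<in> L\<close> by blast
  qed
  have e: "{} \<in> L" "card {} = 0" and p: "P \<in> L" by (auto simp: order_ideals_def)
  have le: "card x \<le> card P" if "x \<in> L" for x
    using that finP by (auto simp: order_ideals_def intro: card_mono)
  note r = rank_unique[of L "covers_in L" card "{}" P, OF edge pred e p le]
  show "is_rank_function (covers_in L) L card (card P)"
    "x \<in> L \<Longrightarrow> rank_wrt (covers_in L) L x = card x" "poset_length L = card P"
    unfolding poset_length_def using r by blast+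
qed

lemma P_L: "P \<in> L" and vec_P: "vec P = (\<lambda>j. card (C j))"
proof -
  show "P \<in> L" by (auto simp: order_ideals_def)
  have "P \<inter> C j = C j" for j by (auto simp: C_def)
  then show "vec P = (\<lambda>j. card (C j))" by (simp add: vec_def fun_eq_iff)
qed

end

section \<open>Rank two root systems\<close>

locale rank_two_roots =
  fixes \<Phi> :: "'v::euclidean_space set" and \<alpha> \<beta> :: 'v
  assumes dim2: "DIM('v) = 2" and root_sys: "root_system \<Phi>" and simple: "simple_roots \<Phi> \<alpha> \<beta>"
    and short: "\<alpha> \<bullet> \<beta> \<noteq> 0 \<longrightarrow> norm \<alpha> \<le> norm \<beta>"
begin

lemma roots: "finite \<Phi>" "0 \<notin> \<Phi>" "\<gamma> \<in> \<Phi> \<Longrightarrow> root_reflection \<gamma> ` \<Phi> = \<Phi>"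
  "\<gamma> \<in> \<Phi> \<Longrightarrow> \<delta> \<in> \<Phi> \<Longrightarrow> \<gamma> \<bullet> coroot \<delta> \<in> \<int>"
  "\<gamma> \<in> \<Phi> \<Longrightarrow> c *\<^sub>R \<gamma> \<in> \<Phi> \<Longrightarrow> c = 1 \<or> c = - 1"
  using root_sys unfolding root_system_def by blast+

lemma simple_facts: "\<alpha> \<in> \<Phi>" "\<beta> \<in> \<Phi>" "\<alpha> \<noteq> \<beta>" "independent {\<alpha>, \<beta>}" "span {\<alpha>, \<beta>} = UNIV"
  "\<gamma> \<in> \<Phi> \<Longrightarrow> \<gamma> \<in> nat_combs \<alpha> \<beta> \<or> - \<gamma> \<in> nat_combs \<alpha> \<beta>"
  using simple unfolding simple_roots_def by blast+

lemma root_neq_0: "\<gamma> \<in> \<Phi> \<Longrightarrow> \<gamma> \<bullet> \<gamma> > 0"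
  using roots(2) by auto

lemma coroot_self: "\<gamma> \<in> \<Phi> \<Longrightarrow> \<gamma> \<bullet> coroot \<gamma> = 2"
  using root_neq_0[of \<gamma>] by (simp add: coroot_def)

lemma coroot_eq_0: "\<gamma> \<in> \<Phi> \<Longrightarrow> v \<bullet> coroot \<gamma> = 0 \<longleftrightarrow> v \<bullet> \<gamma> = 0"
  using root_neq_0[of \<gamma>] by (simp add: coroot_def)

lemma lin_indep: "x *\<^sub>R \<alpha> + y *\<^sub>R \<beta> = 0 \<Longrightarrow> x = 0 \<and> y = 0"
proof -
  assume e: "x *\<^sub>R \<alpha> + y *\<^sub>R \<beta> = 0"
  define u where "u v = (if v = \<alpha> then x else y)" for v
  have "(\<Sum>v\<in>{\<alpha>, \<beta>}. u v *\<^sub>R v) = 0" using e simple_facts(3) by (simp add: u_def)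
  then have "\<forall>v\<in>{\<alpha>, \<beta>}. u v = 0"
    using simple_facts(4) dependent_finite[of "{\<alpha>, \<beta>}"] by blast
  then show ?thesis using simple_facts(3) by (simp add: u_def)
qed

lemma comb_eq_iff: "x *\<^sub>R \<alpha> + y *\<^sub>R \<beta> = x' *\<^sub>R \<alpha> + y' *\<^sub>R \<beta> \<longleftrightarrow> x = x' \<and> y = y'"
proof
  assume "x *\<^sub>R \<alpha> + y *\<^sub>R \<beta> = x' *\<^sub>R \<alpha> + y' *\<^sub>R \<beta>"
  then have "(x - x') *\<^sub>R \<alpha> + (y - y') *\<^sub>R \<beta> = 0" by (simp add: algebra_simps)
  then show "x = x' \<and> y = y'" using lin_indep by fastforce
qed simp

lemma orth_eq_0: "v \<bullet> \<alpha> = 0 \<Longrightarrow> v \<bullet> \<beta> = 0 \<Longrightarrow> v = 0"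
proof -
  assume v: "v \<bullet> \<alpha> = 0" "v \<bullet> \<beta> = 0"
  have "w \<in> {w. v \<bullet> w = 0}" if "w \<in> span {\<alpha>, \<beta>}" for w
    using that by (rule span_subspace_induct) (use v in \<open>auto simp: subspace_def inner_add_right\<close>)
  then have "v \<bullet> v = 0" using simple_facts(5) by blast
  then show "v = 0" by simp
qed

definition wa :: "'v \<Rightarrow> real" where "wa v = v \<bullet> coroot \<alpha>"
definition wb :: "'v \<Rightarrow> real" where "wb v = v \<bullet> coroot \<beta>"

lemma wt_coord_linear [simp]:
  "wa (v + w) = wa v + wa w" "wb (v + w) = wb v + wb w" "wa (c *\<^sub>R v) = c * wa v" "wb (c *\<^sub>R v) = c * wb v"
  "wa (v - w) = wa v - wa w" "wb (v - w) = wb v - wb w" "wa 0 = 0" "wb 0 = 0" "wa (- v) = - wa v" "wb (- v) = - wb v"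
  by (simp_all add: wa_def wb_def inner_add_left inner_diff_left)

lemma wt_coord_eqI: "wa v = wa w \<Longrightarrow> wb v = wb w \<Longrightarrow> v = w"
proof -
  assume "wa v = wa w" "wb v = wb w"
  then have "(v - w) \<bullet> \<alpha> = 0" "(v - w) \<bullet> \<beta> = 0"
    using coroot_eq_0[OF simple_facts(1), of "v - w"] coroot_eq_0[OF simple_facts(2), of "v - w"]
    by (simp_all add: wa_def wb_def inner_diff_left)
  then show ?thesis using orth_eq_0[of "v - w"] by simp
qed

lemma gram: "(\<alpha> \<bullet> \<beta>)\<^sup>2 < (\<alpha> \<bullet> \<alpha>) * (\<beta> \<bullet> \<beta>)"
proof -
  \<comment> \<open>A vector orthogonal to \<beta>, nonzero by independence; its square is
    \<open>\<beta> \<bullet> \<beta>\<close> times the Gram determinant.\<close>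
  let ?w = "(\<beta> \<bullet> \<beta>) *\<^sub>R \<alpha> + (- (\<alpha> \<bullet> \<beta>)) *\<^sub>R \<beta>"
  have b: "\<beta> \<bullet> \<beta> > 0" by (rule root_neq_0[OF simple_facts(2)])
  have "?w \<noteq> 0" using lin_indep[of "\<beta> \<bullet> \<beta>" "- (\<alpha> \<bullet> \<beta>)"] b by auto
  then have "0 < ?w \<bullet> ?w" by simp
  also have "?w \<bullet> ?w = (\<beta> \<bullet> \<beta>) * ((\<alpha> \<bullet> \<alpha>) * (\<beta> \<bullet> \<beta>) - (\<alpha> \<bullet> \<beta>)\<^sup>2)"
    by (simp add: inner_add_left inner_add_right inner_commute algebra_simps power2_eq_square)
  finally show ?thesis using b by (simp add: zero_less_mult_iff)
qed

lemma wb_alpha_wa_beta: "wb \<alpha> * wa \<beta> < 4"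
proof -
  have "wb \<alpha> * wa \<beta> = 4 * ((\<alpha> \<bullet> \<beta>)\<^sup>2 / ((\<alpha> \<bullet> \<alpha>) * (\<beta> \<bullet> \<beta>)))"
    by (simp add: wa_def wb_def coroot_def inner_commute power2_eq_square)
  moreover have "(\<alpha> \<bullet> \<beta>)\<^sup>2 / ((\<alpha> \<bullet> \<alpha>) * (\<beta> \<bullet> \<beta>)) < 1"
    using gram root_neq_0 simple_facts(1,2) by (subst divide_less_eq_1_pos) auto
  ultimately show ?thesis by simp
qed

lemma comb_nonneg:
  assumes "x *\<^sub>R \<alpha> + y *\<^sub>R \<beta> \<in> \<Phi>" shows "0 \<le> x \<and> 0 \<le> y \<or> x \<le> 0 \<and> y \<le> 0"
  using simple_facts(6)[OF assms]
proof
  assume "x *\<^sub>R \<alpha> + y *\<^sub>R \<beta> \<in> nat_combs \<alpha> \<beta>"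
  then obtain m n where "x *\<^sub>R \<alpha> + y *\<^sub>R \<beta> = real m *\<^sub>R \<alpha> + real n *\<^sub>R \<beta>" by (auto simp: nat_combs_def)
  then show ?thesis unfolding comb_eq_iff by simp
next
  assume "- (x *\<^sub>R \<alpha> + y *\<^sub>R \<beta>) \<in> nat_combs \<alpha> \<beta>"
  then obtain m n where "- (x *\<^sub>R \<alpha> + y *\<^sub>R \<beta>) = real m *\<^sub>R \<alpha> + real n *\<^sub>R \<beta>" by (auto simp: nat_combs_def)
  then have "x *\<^sub>R \<alpha> + y *\<^sub>R \<beta> = - (real m *\<^sub>R \<alpha> + real n *\<^sub>R \<beta>)" by (metis add.inverse_inverse)
  also have "\<dots> = (- real m) *\<^sub>R \<alpha> + (- real n) *\<^sub>R \<beta>" by simp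
  finally have "x *\<^sub>R \<alpha> + y *\<^sub>R \<beta> = (- real m) *\<^sub>R \<alpha> + (- real n) *\<^sub>R \<beta>" .
  then show ?thesis unfolding comb_eq_iff by simp
qed

lemma refl_root: "\<gamma> \<in> \<Phi> \<Longrightarrow> \<delta> \<in> \<Phi> \<Longrightarrow> root_reflection \<gamma> \<delta> \<in> \<Phi>"
  using roots(3)[of \<gamma>] by blast

text \<open>Reflecting one simple root in the other keeps its own coefficient 1, so the new
  coefficient cannot be negative.\<close>

lemma cartan_le_0: "wb \<alpha> \<le> 0" "wa \<beta> \<le> 0"
proof -
  have "root_reflection \<beta> \<alpha> \<in> \<Phi>" by (rule refl_root[OF simple_facts(2,1)])
  then have "1 *\<^sub>R \<alpha> + (- wb \<alpha>) *\<^sub>R \<beta> \<in> \<Phi>" by (simp add: root_reflection_def wb_def)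
  from comb_nonneg[OF this] show "wb \<alpha> \<le> 0" by auto
  have "root_reflection \<alpha> \<beta> \<in> \<Phi>" by (rule refl_root[OF simple_facts(1,2)])
  then have "(- wa \<beta>) *\<^sub>R \<alpha> + 1 *\<^sub>R \<beta> \<in> \<Phi>" by (simp add: root_reflection_def wa_def)
  from comb_nonneg[OF this] show "wa \<beta> \<le> 0" by auto
qed

text \<open>Integrality, the bound \<open>n * m < 4\<close> and the fact that both numbers vanish
  together leave products 0, 1, 2 and 3; the length assumption orders the pair by
  \<open>m \<le> n\<close>.\<close>

lemma cartan_values:
  obtains n m where "wa \<beta> = - real n" "wb \<alpha> = - real m" "(n, m) \<in> {(0, 0), (1, 1), (2, 1), (3, 1)}"
proof -
  obtain i j where ij: "wa \<beta> = of_int i" "wb \<alpha> = of_int j"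
    using roots(4) simple_facts(1,2) unfolding wa_def wb_def Ints_def by blast
  define n m where "n = nat (- i)" and "m = nat (- j)"
  have nm: "wa \<beta> = - real n" "wb \<alpha> = - real m"
    using cartan_le_0 unfolding ij n_def m_def by simp_all
  have lt: "n * m < 4"
  proof -
    have "real n * real m < 4" using wb_alpha_wa_beta unfolding nm by (simp add: mult.commute)
    then have "real (n * m) < real 4" by simp
    then show ?thesis by (simp only: of_nat_less_iff)
  qed
  have zero: "n = 0 \<longleftrightarrow> m = 0"
    using coroot_eq_0[OF simple_facts(1), of \<beta>] coroot_eq_0[OF simple_facts(2), of \<alpha>] nm
    by (simp add: wa_def wb_def inner_commute)
  have "m \<le> n"
  proof (cases "\<alpha> \<bullet> \<beta> = 0")
    case True
    then have "wa \<beta> = 0" "wb \<alpha> = 0" by (simp_all add: wa_def wb_def coroot_def inner_commute)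
    then show ?thesis using nm by simp
  next
    case False
    then have "norm \<alpha> \<le> norm \<beta>" using short by blast
    then have "\<alpha> \<bullet> \<alpha> \<le> \<beta> \<bullet> \<beta>" by (simp add: norm_le)
    have "wb \<alpha> * (\<beta> \<bullet> \<beta>) = wa \<beta> * (\<alpha> \<bullet> \<alpha>)"
      using root_neq_0 simple_facts(1,2) by (simp add: wa_def wb_def coroot_def inner_commute)
    then have e: "real m * (\<beta> \<bullet> \<beta>) = real n * (\<alpha> \<bullet> \<alpha>)" unfolding nm by simp
    have "real m * (\<alpha> \<bullet> \<alpha>) \<le> real n * (\<alpha> \<bullet> \<alpha>)"
      unfolding e[symmetric] using \<open>\<alpha> \<bullet> \<alpha> \<le> \<beta> \<bullet> \<beta>\<close> by (intro mult_left_mono) auto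
    then show ?thesis using root_neq_0[OF simple_facts(1)] by simp
  qed
  have m1: "m \<le> 1"
  proof (rule ccontr)
    assume "\<not> m \<le> 1"
    then have "2 * 2 \<le> n * m" using \<open>m \<le> n\<close> by (intro mult_le_mono) auto
    then show False using lt by simp
  qed
  have "m = 0 \<or> m = 1" using m1 by auto
  then have "n \<le> 3" using lt zero by auto
  then have "(n, m) \<in> {(0, 0), (1, 1), (2, 1), (3, 1)}"
    using m1 zero by (cases "m = 0") auto
  then show thesis using that nm by blast
qed

end

section \<open>Weight coordinates and positive roots\<close>

locale rank_two_cartan = rank_two_roots \<Phi> \<alpha> \<beta>
  for \<Phi> :: "'v::euclidean_space set" and \<alpha> \<beta> :: 'v +
  fixes n m :: nat
  assumes wa_beta: "wa \<beta> = - real n" and wb_alpha: "wb \<alpha> = - real m"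
    and nm: "(n, m) \<in> {(0, 0), (1, 1), (2, 1), (3, 1)}"
begin

lemma wa_alpha: "wa \<alpha> = 2" and wb_beta: "wb \<beta> = 2"
  using coroot_self simple_facts(1,2) by (simp_all add: wa_def wb_def)

lemma nm_cases:
  obtains "n = 0" "m = 0" | "n = 1" "m = 1" | "n = 2" "m = 1" | "n = 3" "m = 1"
  using nm by auto

definition cdet :: real where "cdet = 4 - real n * real m"

lemma cdet_pos: "cdet > 0"
  using nm by (auto simp: cdet_def)

lemma coords_exist: "\<exists>w. wa w = x \<and> wb w = y"
proof (intro exI conjI)
  let ?w = "((2 * x + real n * y) / cdet) *\<^sub>R \<alpha> + ((real m * x + 2 * y) / cdet) *\<^sub>R \<beta>"
  show "wa ?w = x" "wb ?w = y"
    using cdet_pos by (simp_all add: wa_alpha wb_beta wa_beta wb_alpha field_simps) (simp_all add: cdet_def algebra_simps)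
qed

definition wv :: "real \<Rightarrow> real \<Rightarrow> 'v" where "wv x y = (SOME w. wa w = x \<and> wb w = y)"

lemma wv [simp]: "wa (wv x y) = x" "wb (wv x y) = y"
  using someI_ex[OF coords_exist[of x y]] by (simp_all add: wv_def)

lemma wv_coords [simp]: "wv (wa v) (wb v) = v"
  by (rule wt_coord_eqI) simp_all

lemma fund: "fund_weight \<alpha> \<beta> = wv 1 0" "fund_weight \<beta> \<alpha> = wv 0 1"
proof -
  show "fund_weight \<alpha> \<beta> = wv 1 0" unfolding fund_weight_def
  proof (rule the_equality)
    show "wv 1 0 \<bullet> coroot \<alpha> = 1 \<and> wv 1 0 \<bullet> coroot \<beta> = 0" using wv[of 1 0] by (simp add: wa_def wb_def)
    fix w assume "w \<bullet> coroot \<alpha> = 1 \<and> w \<bullet> coroot \<beta> = 0"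
    then show "w = wv 1 0" by (intro wt_coord_eqI) (simp_all only: wv, simp_all add: wa_def wb_def)
  qed
  show "fund_weight \<beta> \<alpha> = wv 0 1" unfolding fund_weight_def
  proof (rule the_equality)
    show "wv 0 1 \<bullet> coroot \<beta> = 1 \<and> wv 0 1 \<bullet> coroot \<alpha> = 0" using wv[of 0 1] by (simp add: wa_def wb_def)
    fix w assume "w \<bullet> coroot \<beta> = 1 \<and> w \<bullet> coroot \<alpha> = 0"
    then show "w = wv 0 1" by (intro wt_coord_eqI) (simp_all only: wv, simp_all add: wa_def wb_def)
  qed
qed

lemma comb_fund: "x *\<^sub>R fund_weight \<alpha> \<beta> + y *\<^sub>R fund_weight \<beta> \<alpha> = wv x y"
  by (rule wt_coord_eqI) (simp_all add: fund)

lemma rho_eq: "rho \<alpha> \<beta> = wv 1 1"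
  using comb_fund[of 1 1] by (simp add: rho_def)

abbreviation "sa \<equiv> root_reflection \<alpha>"
abbreviation "sb \<equiv> root_reflection \<beta>"

lemma refl_coords:
  "wa (sa v) = - wa v" "wb (sa v) = wb v + real m * wa v"
  "wa (sb v) = wa v + real n * wb v" "wb (sb v) = - wb v"
  by (simp_all add: root_reflection_def flip: wa_def wb_def)
    (simp_all add: wa_alpha wb_beta wa_beta wb_alpha algebra_simps)

lemma refl_refl: "\<gamma> \<in> \<Phi> \<Longrightarrow> root_reflection \<gamma> (root_reflection \<gamma> v) = v"
  using coroot_self[of \<gamma>] by (simp add: root_reflection_def inner_diff_left algebra_simps)

lemma refl_inner: "\<gamma> \<in> \<Phi> \<Longrightarrow> root_reflection \<gamma> v \<bullet> root_reflection \<gamma> w = v \<bullet> w"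
  using root_neq_0[of \<gamma>]
  by (simp add: root_reflection_def coroot_def inner_diff_left inner_diff_right inner_commute field_simps)

lemma refl_linear: "root_reflection \<gamma> (v + w) = root_reflection \<gamma> v + root_reflection \<gamma> w"
  "root_reflection \<gamma> (v - w) = root_reflection \<gamma> v - root_reflection \<gamma> w"
  "root_reflection \<gamma> (c *\<^sub>R v) = c *\<^sub>R root_reflection \<gamma> v"
  by (simp_all add: root_reflection_def inner_add_left inner_diff_left algebra_simps)

lemma refl_conj:
  assumes "\<delta> \<in> \<Phi>"
  shows "root_reflection (root_reflection \<delta> \<gamma>) v = root_reflection \<delta> (root_reflection \<gamma> (root_reflection \<delta> v))"
proof -
  have "v \<bullet> root_reflection \<delta> \<gamma> = root_reflection \<delta> v \<bullet> \<gamma>"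
    using refl_inner[OF assms, of "root_reflection \<delta> v" \<gamma>] by (simp add: refl_refl[OF assms])
  then have "v \<bullet> coroot (root_reflection \<delta> \<gamma>) = root_reflection \<delta> v \<bullet> coroot \<gamma>"
    using refl_inner[OF assms, of \<gamma> \<gamma>] by (simp add: coroot_def)
  then have "root_reflection (root_reflection \<delta> \<gamma>) v
      = v - (root_reflection \<delta> v \<bullet> coroot \<gamma>) *\<^sub>R root_reflection \<delta> \<gamma>"
    by (simp add: root_reflection_def[of "root_reflection \<delta> \<gamma>"])
  also have "\<dots> = root_reflection \<delta> (root_reflection \<delta> v) - root_reflection \<delta> ((root_reflection \<delta> v \<bullet> coroot \<gamma>) *\<^sub>R \<gamma>)"
    by (simp only: refl_refl[OF assms] refl_linear)
  also have "\<dots> = root_reflection \<delta> (root_reflection \<gamma> (root_reflection \<delta> v))"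
    unfolding refl_linear(2)[symmetric] root_reflection_def[of \<gamma>] ..
  finally show ?thesis .
qed

lemma refl_minus: "root_reflection (- \<gamma>) = root_reflection \<gamma>"
  by (rule ext) (simp add: root_reflection_def coroot_def)

text \<open>A positive root that is not simple has positive square, hence positive pairing with some
  simple root; reflecting there lowers the height and keeps the root positive.\<close>

lemma pos_root_induct [consumes 1, case_names alpha beta sa sb]:
  assumes "\<gamma> \<in> positive_roots \<Phi> \<alpha> \<beta>" and a: "Q \<alpha>" and b: "Q \<beta>"
    and sa: "\<And>\<gamma>. \<gamma> \<in> \<Phi> \<Longrightarrow> \<gamma> \<noteq> \<alpha> \<Longrightarrow> Q \<gamma> \<Longrightarrow> Q (sa \<gamma>)"
    and sb: "\<And>\<gamma>. \<gamma> \<in> \<Phi> \<Longrightarrow> \<gamma> \<noteq> \<beta> \<Longrightarrow> Q \<gamma> \<Longrightarrow> Q (sb \<gamma>)"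
  shows "Q \<gamma>"
proof -
  have main: "Q (real p *\<^sub>R \<alpha> + real q *\<^sub>R \<beta>)" if "real p *\<^sub>R \<alpha> + real q *\<^sub>R \<beta> \<in> \<Phi>" for p q
    using that
  proof (induction "p + q" arbitrary: p q rule: less_induct)
    case less
    let ?g = "real p *\<^sub>R \<alpha> + real q *\<^sub>R \<beta>"
    have "wa ?g \<in> \<int>" "wb ?g \<in> \<int>" using roots(4)[OF less.prems] simple_facts(1,2) by (simp_all only: wa_def wb_def)
    then obtain i j where ij: "wa ?g = of_int i" "wb ?g = of_int j" unfolding Ints_def by blast
    consider "q = 0" | "p = 0" | "0 < p" "0 < q" by auto
    then show ?case
    proof cases
      case 1
      then have "real p *\<^sub>R \<alpha> \<in> \<Phi>" using less.prems by simp
      then have "real p = 1" using roots(5)[OF simple_facts(1), of "real p"] by auto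
      then show ?thesis using 1 a by simp
    next
      case 2
      then have "real q *\<^sub>R \<beta> \<in> \<Phi>" using less.prems by simp
      then have "real q = 1" using roots(5)[OF simple_facts(2), of "real q"] by auto
      then show ?thesis using 2 b by simp
    next
      case 3
      have ip: "?g \<bullet> \<alpha> = wa ?g * (\<alpha> \<bullet> \<alpha>) / 2" "?g \<bullet> \<beta> = wb ?g * (\<beta> \<bullet> \<beta>) / 2"
        using root_neq_0 simple_facts(1,2) by (simp_all add: wa_def wb_def coroot_def)
      have "0 < ?g \<bullet> ?g" by (rule root_neq_0[OF less.prems])
      also have "?g \<bullet> ?g = real p * (?g \<bullet> \<alpha>) + real q * (?g \<bullet> \<beta>)"
        by (simp add: inner_add_right)
      finally have "0 < real p * (wa ?g * (\<alpha> \<bullet> \<alpha>) / 2) + real q * (wb ?g * (\<beta> \<bullet> \<beta>) / 2)" unfolding ip .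
      then have "0 < i \<or> 0 < j"
      proof (rule contrapos_pp)
        assume "\<not> (0 < i \<or> 0 < j)"
        then have "wa ?g \<le> 0" "wb ?g \<le> 0" unfolding ij by auto
        then have "wa ?g * (\<alpha> \<bullet> \<alpha>) / 2 \<le> 0" "wb ?g * (\<beta> \<bullet> \<beta>) / 2 \<le> 0"
          by (simp_all add: mult_nonpos_nonneg)
        then have "real p * (wa ?g * (\<alpha> \<bullet> \<alpha>) / 2) \<le> 0" "real q * (wb ?g * (\<beta> \<bullet> \<beta>) / 2) \<le> 0"
          by (auto intro!: mult_nonneg_nonpos simp only: of_nat_0_le_iff)
        then show "\<not> 0 < real p * (wa ?g * (\<alpha> \<bullet> \<alpha>) / 2) + real q * (wb ?g * (\<beta> \<bullet> \<beta>) / 2)" by linarith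
      qed
      then show ?thesis
      proof
        assume i: "0 < i"
        have r: "sa ?g \<in> \<Phi>" by (rule refl_root[OF simple_facts(1) less.prems])
        have eq: "sa ?g = (real p - of_int i) *\<^sub>R \<alpha> + real q *\<^sub>R \<beta>"
          unfolding root_reflection_def wa_def[symmetric] ij by (simp add: algebra_simps)
        have "real_of_int i \<le> real p" using comb_nonneg[OF r[unfolded eq]] 3 by auto
        then have "i \<le> int p" by linarith
        then have eq': "sa ?g = real (nat (int p - i)) *\<^sub>R \<alpha> + real q *\<^sub>R \<beta>" unfolding eq by (simp add: of_nat_diff)
        have "Q (sa ?g)" unfolding eq' using r[unfolded eq'] i \<open>i \<le> int p\<close> by (intro less.hyps) auto
        moreover have "sa ?g \<noteq> \<alpha>"
          unfolding eq' using comb_eq_iff[of _ "real q" 1 0] 3 by simp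
        ultimately have "Q (sa (sa ?g))" using sa r by blast
        then show ?thesis by (simp only: refl_refl[OF simple_facts(1)])
      next
        assume j: "0 < j"
        have r: "sb ?g \<in> \<Phi>" by (rule refl_root[OF simple_facts(2) less.prems])
        have eq: "sb ?g = real p *\<^sub>R \<alpha> + (real q - of_int j) *\<^sub>R \<beta>"
          unfolding root_reflection_def wb_def[symmetric] ij by (simp add: algebra_simps)
        have "real_of_int j \<le> real q" using comb_nonneg[OF r[unfolded eq]] 3 by auto
        then have "j \<le> int q" by linarith
        then have eq': "sb ?g = real p *\<^sub>R \<alpha> + real (nat (int q - j)) *\<^sub>R \<beta>" unfolding eq by (simp add: of_nat_diff)
        have "Q (sb ?g)" unfolding eq' using r[unfolded eq'] j \<open>j \<le> int q\<close> by (intro less.hyps) auto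
        moreover have "sb ?g \<noteq> \<beta>"
          unfolding eq' using comb_eq_iff[of "real p" _ 0 1] 3 by simp
        ultimately have "Q (sb (sb ?g))" using sb r by blast
        then show ?thesis by (simp only: refl_refl[OF simple_facts(2)])
      qed
    qed
  qed
  have "\<gamma> \<in> \<Phi>" "\<gamma> \<in> nat_combs \<alpha> \<beta>" using assms(1) by (auto simp: positive_roots_def)
  then show ?thesis using main by (auto simp: nat_combs_def)
qed

definition comb :: "int \<times> int \<Rightarrow> 'v" where
  "comb p = of_int (fst p) *\<^sub>R \<alpha> + of_int (snd p) *\<^sub>R \<beta>"

lemma comb_inj: "comb p = comb q \<longleftrightarrow> p = q"
  by (auto simp: comb_def comb_eq_iff prod_eq_iff)

lemma comb_coords: "wa (comb p) = 2 * of_int (fst p) - real n * of_int (snd p)"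
  "wb (comb p) = 2 * of_int (snd p) - real m * of_int (fst p)"
  by (simp_all add: comb_def wa_alpha wb_beta wa_beta wb_alpha)

lemma refl_comb: "sa (comb (k, l)) = comb (int n * l - k, l)" "sb (comb (k, l)) = comb (k, int m * k - l)"
  by (rule wt_coord_eqI; simp add: refl_coords comb_coords algebra_simps)+

lemma comb_simple: "comb (1, 0) = \<alpha>" "comb (0, 1) = \<beta>"
  by (simp_all add: comb_def)

lemma positive_roots_eq: "positive_roots \<Phi> \<alpha> \<beta> = comb ` pos_coords n"
proof
  show "positive_roots \<Phi> \<alpha> \<beta> \<subseteq> comb ` pos_coords n"
  proof
    fix \<gamma> assume "\<gamma> \<in> positive_roots \<Phi> \<alpha> \<beta>"
    then have "\<exists>g\<in>pos_coords n. \<gamma> = comb g"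
    proof (induction rule: pos_root_induct)
      case alpha
      show ?case using comb_simple by (intro bexI[of _ "(1, 0)"]) (simp_all add: pos_coords_def)
    next
      case beta
      show ?case using comb_simple by (intro bexI[of _ "(0, 1)"]) (simp_all add: pos_coords_def)
    next
      case (sa \<gamma>)
      then obtain k l where g: "(k, l) \<in> pos_coords n" "\<gamma> = comb (k, l)" by fast
      then have "(k, l) \<noteq> (1, 0)" using sa(2) comb_simple(1) by metis
      then have "(int n * l - k, l) \<in> pos_coords n" using g(1) by (cases rule: nm_cases) (auto simp: pos_coords_def)
      then show ?case unfolding g(2) refl_comb by blast
    next
      case (sb \<gamma>)
      then obtain k l where g: "(k, l) \<in> pos_coords n" "\<gamma> = comb (k, l)" by fast
      then have "(k, l) \<noteq> (0, 1)" using sb(2) comb_simple(2) by metis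
      then have "(k, int m * k - l) \<in> pos_coords n" using g(1) by (cases rule: nm_cases) (auto simp: pos_coords_def)
      then show ?case unfolding g(2) refl_comb by blast
    qed
    then show "\<gamma> \<in> comb ` pos_coords n" by blast
  qed
  have s: "comb (1, 0) \<in> \<Phi>" "comb (0, 1) \<in> \<Phi>" using simple_facts(1,2) by (simp_all only: comb_simple)
  have ra: "comb (int n * l - k, l) \<in> \<Phi>" if "comb (k, l) \<in> \<Phi>" for k l
    using refl_root[OF simple_facts(1) that] by (simp only: refl_comb)
  have rb: "comb (k, int m * k - l) \<in> \<Phi>" if "comb (k, l) \<in> \<Phi>" for k l
    using refl_root[OF simple_facts(2) that] by (simp only: refl_comb)
  have "comb g \<in> \<Phi>" if "g \<in> pos_coords n" for g
  proof (cases rule: nm_cases)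
    case 1
    then have "g = (1, 0) \<or> g = (0, 1)" using that by (simp add: pos_coords_def)
    then show ?thesis using s by metis
  next
    case 2
    then have "g = (1, 0) \<or> g = (0, 1) \<or> g = (1, 1)" using that by (simp add: pos_coords_def) metis
    moreover have "comb (1, 1) \<in> \<Phi>" using ra[OF s(2)] 2 by simp
    ultimately show ?thesis using s by metis
  next
    case 3
    then have "g = (1, 0) \<or> g = (0, 1) \<or> g = (1, 1) \<or> g = (2, 1)" using that by (simp add: pos_coords_def) metis
    moreover have "comb (2, 1) \<in> \<Phi>" "comb (1, 1) \<in> \<Phi>" using ra[OF s(2)] rb[OF s(1)] 3 by simp_all
    ultimately show ?thesis using s by metis
  next
    case 4
    then have "g = (1, 0) \<or> g = (0, 1) \<or> g = (1, 1) \<or> g = (2, 1) \<or> g = (3, 1) \<or> g = (3, 2)"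
      using that by (simp add: pos_coords_def) metis
    moreover have c: "comb (3, 1) \<in> \<Phi>" "comb (1, 1) \<in> \<Phi>" using ra[OF s(2)] rb[OF s(1)] 4 by simp_all
    moreover have "comb (2, 1) \<in> \<Phi>" "comb (3, 2) \<in> \<Phi>" using ra[OF c(2)] rb[OF c(1)] 4 by simp_all
    ultimately show ?thesis using s by metis
  qed
  moreover have "comb g \<in> nat_combs \<alpha> \<beta>" if "g \<in> pos_coords n" for g
  proof -
    have "0 \<le> fst g" "0 \<le> snd g" using that by (auto simp: pos_coords_def split: if_splits)
    then have "comb g = real (nat (fst g)) *\<^sub>R \<alpha> + real (nat (snd g)) *\<^sub>R \<beta>" by (simp add: comb_def)
    then show ?thesis unfolding nat_combs_def by blast
  qed
  ultimately show "comb ` pos_coords n \<subseteq> positive_roots \<Phi> \<alpha> \<beta>" unfolding positive_roots_def by blast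
qed

end

section \<open>The Weyl group as an explicit list of words\<close>

fun weyl_matrix :: "nat \<Rightarrow> nat \<Rightarrow> bool list \<Rightarrow> int \<times> int \<times> int \<times> int" where
  "weyl_matrix n m [] = (1, 0, 0, 1)"
| "weyl_matrix n m (True # w) = (case weyl_matrix n m w of (p, q, r, s) \<Rightarrow> (- p, - q, r + int m * p, s + int m * q))"
| "weyl_matrix n m (False # w) = (case weyl_matrix n m w of (p, q, r, s) \<Rightarrow> (p + int n * r, q + int n * s, - r, - s))"

text \<open>Reduced words for the dihedral groups of order 4, 6, 8 and 12, with \<open>True\<close>
  for the reflection in \<alpha>. The order is matched to \<open>denominator_terms\<close> and
  \<open>drop_terms\<close>, which are compared with this list entry by entry in
  \<open>act_rho\<close> and \<open>hgt_drops\<close>.\<close>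

definition weyl_words :: "nat \<Rightarrow> bool list list" where
  "weyl_words n = [[], [True], [False], [False, True]]
     @ (if n = 0 then [] else [[True, False], [True, False, True]])
     @ (if n \<le> 1 then [] else [[False, True, False], [False, True, False, True]])
     @ (if n \<le> 2 then [] else [[True, False, True, False], [True, False, True, False, True],
         [False, True, False, True, False], [False, True, False, True, False, True]])"

context rank_two_cartan begin

primrec act :: "bool list \<Rightarrow> 'v \<Rightarrow> 'v" where
  "act [] = id"
| "act (i # w) = root_reflection (if i then \<alpha> else \<beta>) \<circ> act w"

lemma act_coords:
  "wa (act w v) = (case weyl_matrix n m w of (p, q, r, s) \<Rightarrow> of_int p * wa v + of_int q * wb v) \<and>
   wb (act w v) = (case weyl_matrix n m w of (p, q, r, s) \<Rightarrow> of_int r * wa v + of_int s * wb v)"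
proof (induction w)
  case (Cons i w)
  obtain p q r s where "weyl_matrix n m w = (p, q, r, s)" by (cases "weyl_matrix n m w")
  then show ?case using Cons by (cases i) (simp_all add: refl_coords algebra_simps)
qed simp

lemma act_eq_iff: "act w = act w' \<longleftrightarrow> weyl_matrix n m w = weyl_matrix n m w'"
proof
  obtain p q r s where w: "weyl_matrix n m w = (p, q, r, s)" by (cases "weyl_matrix n m w")
  obtain p' q' r' s' where w': "weyl_matrix n m w' = (p', q', r', s')" by (cases "weyl_matrix n m w'")
  assume "act w = act w'"
  then have "act w (wv 1 0) = act w' (wv 1 0)" "act w (wv 0 1) = act w' (wv 0 1)" by simp_all
  then show "weyl_matrix n m w = weyl_matrix n m w'"
    using act_coords[of w "wv 1 0"] act_coords[of w' "wv 1 0"] act_coords[of w "wv 0 1"] act_coords[of w' "wv 0 1"]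
    by (simp add: w w')
next
  assume e: "weyl_matrix n m w = weyl_matrix n m w'"
  show "act w = act w'"
  proof
    fix v show "act w v = act w' v"
      using act_coords[of w v] act_coords[of w' v] unfolding e by (intro wt_coord_eqI) simp_all
  qed
qed

lemma weyl_words_closed: "w \<in> set (weyl_words n) \<Longrightarrow> \<exists>w'\<in>set (weyl_words n). act (i # w) = act w'"
  unfolding act_eq_iff by (cases rule: nm_cases; cases i) (auto simp: weyl_words_def)

lemma weyl_words_distinct: "distinct (weyl_words n)" "inj_on act (set (weyl_words n))"
proof -
  show "distinct (weyl_words n)" by (simp add: weyl_words_def)
  have "distinct (map (weyl_matrix n m) (weyl_words n))"
    by (cases rule: nm_cases) (simp_all add: weyl_words_def)
  then show "inj_on act (set (weyl_words n))"
    by (simp add: inj_on_def act_eq_iff distinct_map)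
qed

lemma act_weyl: "act w \<in> weyl_group \<Phi>"
proof (induction w)
  case Nil
  show ?case unfolding act.simps by (rule weyl_group.intros(1))
next
  case (Cons i w)
  have "(if i then \<alpha> else \<beta>) \<in> \<Phi>" using simple_facts(1,2) by simp
  then show ?case unfolding act.simps using Cons by (rule weyl_group.intros(2))
qed

text \<open>The Weyl group is generated by all root reflections. Those of positive roots arise from
  the simple ones by conjugation, and opposite roots have the same reflection.\<close>

lemma weyl_group_eq: "weyl_group \<Phi> = act ` set (weyl_words n)"
proof
  let ?W = "act ` set (weyl_words n)"
  define Q where "Q \<gamma> \<longleftrightarrow> (\<forall>\<sigma>\<in>?W. root_reflection \<gamma> \<circ> \<sigma> \<in> ?W)" for \<gamma>
  have Qa: "Q \<alpha>" unfolding Q_def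
  proof
    fix \<sigma> assume "\<sigma> \<in> ?W"
    then obtain w where w: "w \<in> set (weyl_words n)" "\<sigma> = act w" by blast
    then show "sa \<circ> \<sigma> \<in> ?W" using weyl_words_closed[OF w(1), of True] by auto
  qed
  have Qb: "Q \<beta>" unfolding Q_def
  proof
    fix \<sigma> assume "\<sigma> \<in> ?W"
    then obtain w where w: "w \<in> set (weyl_words n)" "\<sigma> = act w" by blast
    then show "sb \<circ> \<sigma> \<in> ?W" using weyl_words_closed[OF w(1), of False] by auto
  qed
  have conj: "Q (root_reflection \<delta> \<gamma>)" if "\<delta> \<in> \<Phi>" "Q \<delta>" "Q \<gamma>" for \<gamma> \<delta>
    unfolding Q_def
  proof
    fix \<sigma> assume "\<sigma> \<in> ?W"
    then have "root_reflection \<delta> \<circ> (root_reflection \<gamma> \<circ> (root_reflection \<delta> \<circ> \<sigma>)) \<in> ?W"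
      using that unfolding Q_def by blast
    moreover have "root_reflection (root_reflection \<delta> \<gamma>) \<circ> \<sigma>
        = root_reflection \<delta> \<circ> (root_reflection \<gamma> \<circ> (root_reflection \<delta> \<circ> \<sigma>))"
      by (rule ext) (simp add: refl_conj[OF that(1)])
    ultimately show "root_reflection (root_reflection \<delta> \<gamma>) \<circ> \<sigma> \<in> ?W" by (simp only:)
  qed
  have pos: "Q \<gamma>" if "\<gamma> \<in> positive_roots \<Phi> \<alpha> \<beta>" for \<gamma>
    using that
  proof (induction rule: pos_root_induct)
    case (sa \<gamma>)
    then show ?case using conj[OF simple_facts(1) Qa] by blast
  next
    case (sb \<gamma>)
    then show ?case using conj[OF simple_facts(2) Qb] by blast
  qed (use Qa Qb in auto)
  have all: "Q \<gamma>" if "\<gamma> \<in> \<Phi>" for \<gamma>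
  proof (cases "\<gamma> \<in> nat_combs \<alpha> \<beta>")
    case True
    then show ?thesis using pos that by (simp add: positive_roots_def)
  next
    case False
    then have "- \<gamma> \<in> nat_combs \<alpha> \<beta>" using simple_facts(6)[OF that] by blast
    moreover have "- \<gamma> = root_reflection \<gamma> \<gamma>" using coroot_self[OF that] by (simp add: root_reflection_def scaleR_2)
    then have "- \<gamma> \<in> \<Phi>" using refl_root[OF that that] by simp
    ultimately have "Q (- \<gamma>)" using pos by (simp add: positive_roots_def)
    then show ?thesis by (simp add: Q_def refl_minus)
  qed
  show "weyl_group \<Phi> \<subseteq> ?W"
  proof
    fix \<sigma> assume "\<sigma> \<in> weyl_group \<Phi>"
    then show "\<sigma> \<in> ?W"
    proof induction
      case 1
      have "[] \<in> set (weyl_words n)" by (simp add: weyl_words_def)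
      then show ?case by (intro image_eqI[of _ _ "[]"]) simp_all
    next
      case (2 \<gamma> \<sigma>)
      then show ?case using all unfolding Q_def by blast
    qed
  qed
  show "?W \<subseteq> weyl_group \<Phi>" using act_weyl by blast
qed

lemma sum_weyl: "(\<Sum>\<sigma>\<in>weyl_group \<Phi>. g \<sigma>) = (\<Sum>w\<leftarrow>weyl_words n. g (act w))"
  unfolding weyl_group_eq sum.reindex[OF weyl_words_distinct(2)]
  by (simp add: sum_list_distinct_conv_sum_set weyl_words_distinct(1))

lemma endo_det_basis:
  obtains e1 e2 :: 'v where "e1 \<bullet> e1 = 1" "e2 \<bullet> e2 = 1" "e1 \<bullet> e2 = 0" "\<And>v. v = (v \<bullet> e1) *\<^sub>R e1 + (v \<bullet> e2) *\<^sub>R e2"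
    "\<And>f :: 'v \<Rightarrow> 'v. endo_det f = (f e1 \<bullet> e1) * (f e2 \<bullet> e2) - (f e1 \<bullet> e2) * (f e2 \<bullet> e1)"
proof -
  have "card (Basis :: 'v set) = 2" using dim2 by simp
  then obtain e1 e2 :: 'v where e: "Basis = {e1, e2}" "e1 \<noteq> e2" by (auto simp: card_2_iff)
  have b: "e1 \<in> Basis" "e2 \<in> Basis" using e by auto
  show thesis
  proof (rule that[of e1 e2])
    show "e1 \<bullet> e1 = 1" "e2 \<bullet> e2 = 1" "e1 \<bullet> e2 = 0"
      using inner_Basis[OF b(1) b(1)] inner_Basis[OF b(2) b(2)] inner_Basis[OF b(1) b(2)] e(2) by simp_all
    show "v = (v \<bullet> e1) *\<^sub>R e1 + (v \<bullet> e2) *\<^sub>R e2" for v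
    proof -
      have "(\<Sum>b\<in>{e1, e2}. (v \<bullet> b) *\<^sub>R b) = v" using euclidean_representation[of v] unfolding e(1) .
      then show ?thesis using e(2) by simp
    qed
    fix f :: "'v \<Rightarrow> 'v"
    have P: "{p. p permutes (Basis :: 'v set)} = {id, Transposition.transpose e1 e2}"
      unfolding e(1) by (auto simp: permutes_doubleton_iff)
    have ne: "id \<noteq> Transposition.transpose e1 e2"
      using e(2) by (metis id_apply transpose_apply_first)
    show "endo_det f = (f e1 \<bullet> e1) * (f e2 \<bullet> e2) - (f e1 \<bullet> e2) * (f e2 \<bullet> e1)"
      unfolding endo_det_def P unfolding e(1) using ne e(2) by (simp add: sign_swap_id)
  qed
qed

lemma endo_det_refl_comp:
  assumes "\<gamma> \<in> \<Phi>" shows "endo_det (root_reflection \<gamma> \<circ> f) = - endo_det f"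
proof -
  obtain e1 e2 :: 'v where e: "e1 \<bullet> e1 = 1" "e2 \<bullet> e2 = 1" "e1 \<bullet> e2 = 0"
    "\<And>v. v = (v \<bullet> e1) *\<^sub>R e1 + (v \<bullet> e2) *\<^sub>R e2"
    "\<And>f :: 'v \<Rightarrow> 'v. endo_det f = (f e1 \<bullet> e1) * (f e2 \<bullet> e2) - (f e1 \<bullet> e2) * (f e2 \<bullet> e1)"
    using endo_det_basis by blast
  define g1 g2 where "g1 = \<gamma> \<bullet> e1" and "g2 = \<gamma> \<bullet> e2"
  have ip: "v \<bullet> \<gamma> = (v \<bullet> e1) * g1 + (v \<bullet> e2) * g2" for v
    by (subst e(4)[of \<gamma>]) (simp add: inner_add_right g1_def g2_def)
  define N where "N = g1\<^sup>2 + g2\<^sup>2"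
  have N: "\<gamma> \<bullet> \<gamma> = N" using ip[of \<gamma>] by (simp add: g1_def g2_def N_def power2_eq_square)
  have N0: "N \<noteq> 0" using root_neq_0[OF assms] N by simp
  have r: "root_reflection \<gamma> v \<bullet> e1 = (v \<bullet> e1) - 2 * ((v \<bullet> e1) * g1 + (v \<bullet> e2) * g2) * g1 / N"
    "root_reflection \<gamma> v \<bullet> e2 = (v \<bullet> e2) - 2 * ((v \<bullet> e1) * g1 + (v \<bullet> e2) * g2) * g2 / N" for v
    by (simp_all add: root_reflection_def coroot_def inner_diff_left ip N_def power2_eq_square flip: g1_def g2_def)
  have key: "(a - 2 * (a * g1 + b * g2) * g1 / N) * (d - 2 * (c * g1 + d * g2) * g2 / N)
      - (b - 2 * (a * g1 + b * g2) * g2 / N) * (c - 2 * (c * g1 + d * g2) * g1 / N) = - (a * d - b * c)" for a b c d :: real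
  proof -
    have "N * ((a - 2 * (a * g1 + b * g2) * g1 / N) * (d - 2 * (c * g1 + d * g2) * g2 / N)
      - (b - 2 * (a * g1 + b * g2) * g2 / N) * (c - 2 * (c * g1 + d * g2) * g1 / N))
      = (a * d - b * c) * (N - 2 * (g1\<^sup>2 + g2\<^sup>2))"
      using N0 by (simp add: field_simps power2_eq_square)
    also have "\<dots> = N * (- (a * d - b * c))" by (simp add: N_def algebra_simps)
    finally show ?thesis using N0 mult_left_cancel by blast
  qed
  show ?thesis unfolding e(5) comp_apply r by (rule key)
qed

lemma endo_det_act: "endo_det (act w) = (- 1) ^ length w"
proof (induction w)
  case Nil
  obtain e1 e2 :: 'v where "e1 \<bullet> e1 = 1" "e2 \<bullet> e2 = 1" "e1 \<bullet> e2 = 0"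
    "\<And>f :: 'v \<Rightarrow> 'v. endo_det f = (f e1 \<bullet> e1) * (f e2 \<bullet> e2) - (f e1 \<bullet> e2) * (f e2 \<bullet> e1)"
    using endo_det_basis by metis
  then show ?case by (simp add: inner_commute)
next
  case (Cons i w)
  have "(if i then \<alpha> else \<beta>) \<in> \<Phi>" using simple_facts(1,2) by simp
  moreover have "(- 1 :: real) ^ length (i # w) = - ((- 1) ^ length w)" by simp
  ultimately show ?case using endo_det_refl_comp[of "if i then \<alpha> else \<beta>" "act w"] by (simp only: act.simps Cons)
qed

lemma sign_act: "\<lfloor>endo_det (act w)\<rfloor> = (- 1) ^ length w"
proof -
  have "(- 1 :: real) ^ length w = of_int ((- 1) ^ length w)" by simp
  then show ?thesis unfolding endo_det_act by (metis floor_of_int)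
qed

text \<open>Leaving \<open>E\<close> and its target ring open lets one alternating sum serve both
  for the bialternant, with \<open>formal_exp\<close>, and for the rank generating function, with
  powers of \<open>qvar\<close>.\<close>

definition alt :: "('v \<Rightarrow> 'r::comm_ring_1) \<Rightarrow> 'v \<Rightarrow> 'r" where
  "alt E v = (\<Sum>w\<leftarrow>weyl_words n. (- 1) ^ length w * E (act w v))"

lemma alt_weyl: "alt E v = (\<Sum>\<sigma>\<in>weyl_group \<Phi>. of_int \<lfloor>endo_det \<sigma>\<rfloor> * E (\<sigma> v))"
  unfolding sum_weyl sign_act alt_def by simp

lemma act_append: "act (w @ [i]) = act w \<circ> root_reflection (if i then \<alpha> else \<beta>)"
  by (induction w) (simp_all add: comp_assoc)

text \<open>Multiplication by a simple reflection on the right permutes the Weyl group and reverses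
  all signs.\<close>

lemma alt_refl: "alt E (root_reflection (if i then \<alpha> else \<beta>) v) = - alt E v"
proof -
  let ?s = "root_reflection (if i then \<alpha> else \<beta>)"
  have s: "?s \<circ> ?s = id" using refl_refl simple_facts(1,2) by (auto simp: fun_eq_iff)
  have W: "\<sigma> \<circ> ?s \<in> weyl_group \<Phi> \<and> \<lfloor>endo_det (\<sigma> \<circ> ?s)\<rfloor> = - \<lfloor>endo_det \<sigma>\<rfloor>" if sg: "\<sigma> \<in> weyl_group \<Phi>" for \<sigma>
  proof -
    obtain w where w: "\<sigma> = act w" using sg unfolding weyl_group_eq by blast
    have "\<sigma> \<circ> ?s = act (w @ [i])" by (simp only: w act_append)
    then show ?thesis using act_weyl[of "w @ [i]"] sign_act[of "w @ [i]"] sign_act[of w] by (simp add: w)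
  qed
  have inv: "\<sigma> \<circ> ?s \<circ> ?s = \<sigma>" for \<sigma> :: "'v \<Rightarrow> 'v" by (simp only: comp_assoc s comp_id)
  have "alt E (?s v) = (\<Sum>\<sigma>\<in>weyl_group \<Phi>. - (of_int \<lfloor>endo_det (\<sigma> \<circ> ?s)\<rfloor> * E ((\<sigma> \<circ> ?s) v)))"
    unfolding alt_weyl by (rule sum.cong) (simp_all add: W)
  also have "\<dots> = - (\<Sum>\<sigma>\<in>weyl_group \<Phi>. of_int \<lfloor>endo_det (\<sigma> \<circ> ?s)\<rfloor> * E ((\<sigma> \<circ> ?s) v))"
    by (rule sum_negf)
  also have "(\<Sum>\<sigma>\<in>weyl_group \<Phi>. of_int \<lfloor>endo_det (\<sigma> \<circ> ?s)\<rfloor> * E ((\<sigma> \<circ> ?s) v)) = alt E v"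
    unfolding alt_weyl
    by (rule sum.reindex_bij_witness[where i = "\<lambda>\<sigma>. \<sigma> \<circ> ?s" and j = "\<lambda>\<sigma>. \<sigma> \<circ> ?s"]) (use W inv in blast)+
  finally show ?thesis .
qed

lemma act_rho: "map (\<lambda>w. ((- 1) ^ length w, act w (rho \<alpha> \<beta>))) (weyl_words n)
    = map (\<lambda>(s, d). (s, rho \<alpha> \<beta> - comb d)) (denominator_terms n)"
proof -
  have eq: "act w (wv 1 1) = wv 1 1 - comb d \<longleftrightarrow>
      (case weyl_matrix n m w of (p, q, r, s) \<Rightarrow> p + q = 1 - (2 * fst d - int n * snd d) \<and> r + s = 1 - (2 * snd d - int m * fst d))"
    (is "_ \<longleftrightarrow> ?R") for w d
  proof -
    obtain p q r s where w: "weyl_matrix n m w = (p, q, r, s)" by (cases "weyl_matrix n m w")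
    have "act w (wv 1 1) = wv 1 1 - comb d \<longleftrightarrow>
        real_of_int (p + q) = of_int (1 - (2 * fst d - int n * snd d)) \<and> real_of_int (r + s) = of_int (1 - (2 * snd d - int m * fst d))"
      using act_coords[of w "wv 1 1"] wt_coord_eqI[of "act w (wv 1 1)" "wv 1 1 - comb d"]
      by (auto simp: w comb_coords)
    then show ?thesis unfolding of_int_eq_iff w by simp
  qed
  show ?thesis
    unfolding rho_eq by (cases rule: nm_cases) (simp_all add: weyl_words_def denominator_terms_def eq del: act.simps)
qed

end

section \<open>Weights of the lattice of order ideals\<close>

lemma distributive_order_ideals: "distributive_lattice (poset_gorder (order_ideals P))"
proof -
  have L_lattice: "x \<in> order_ideals P \<Longrightarrow> y \<in> order_ideals P \<Longrightarrow> x \<union> y \<in> order_ideals P"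
    "x \<in> order_ideals P \<Longrightarrow> y \<in> order_ideals P \<Longrightarrow> x \<inter> y \<in> order_ideals P" for x y
    by (auto simp: order_ideals_def)
  let ?L = "order_ideals P"
  let ?G = "poset_gorder ?L"
  have po: "partial_order ?G"
    by unfold_locales (auto simp: poset_gorder_def)
  interpret G: partial_order ?G by (rule po)
  have lub: "least ?G (x \<union> y) (Upper ?G {x, y})" if "x \<in> ?L" "y \<in> ?L" for x y
    using L_lattice(1)[OF that] that by (auto simp: least_def Upper_def poset_gorder_def)
  have glb: "greatest ?G (x \<inter> y) (Lower ?G {x, y})" if "x \<in> ?L" "y \<in> ?L" for x y
    using L_lattice(2)[OF that] that by (auto simp: greatest_def Lower_def poset_gorder_def)
  have car: "carrier ?G = ?L" by (simp add: poset_gorder_def)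
  have lat: "Lattice.lattice ?G"
  proof unfold_locales
    fix x y assume "x \<in> carrier ?G" "y \<in> carrier ?G"
    then show "\<exists>s. least ?G s (Upper ?G {x, y})" using lub[of x y] car by blast
  next
    fix x y assume "x \<in> carrier ?G" "y \<in> carrier ?G"
    then show "\<exists>s. greatest ?G s (Lower ?G {x, y})" using glb[of x y] car by blast
  qed
  have j: "x \<squnion>\<^bsub>?G\<^esub> y = x \<union> y" if xy: "x \<in> ?L" "y \<in> ?L" for x y
    unfolding Lattice.join_def Lattice.sup_def
    by (rule G.least_unique[OF someI[of "\<lambda>s. least ?G s (Upper ?G {x, y})", OF lub[OF xy]] lub[OF xy]])
  have i: "x \<sqinter>\<^bsub>?G\<^esub> y = x \<inter> y" if xy: "x \<in> ?L" "y \<in> ?L" for x y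
    unfolding Lattice.meet_def Lattice.inf_def
    by (rule G.greatest_unique[OF someI[of "\<lambda>s. greatest ?G s (Lower ?G {x, y})", OF glb[OF xy]] glb[OF xy]])
  have "x \<sqinter>\<^bsub>?G\<^esub> (y \<squnion>\<^bsub>?G\<^esub> z) = (x \<sqinter>\<^bsub>?G\<^esub> y) \<squnion>\<^bsub>?G\<^esub> (x \<sqinter>\<^bsub>?G\<^esub> z)"
    if "x \<in> ?L" "y \<in> ?L" "z \<in> ?L" for x y z
    by (simp only: j[OF that(2,3)] i[OF that(1,2)] i[OF that(1,3)]
      i[OF that(1) L_lattice(1)[OF that(2,3)]] j[OF L_lattice(2)[OF that(1,2)] L_lattice(2)[OF that(1,3)]] Int_Un_distrib)
  then show ?thesis unfolding distributive_lattice_def car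
    using lat by blast
qed

locale structured_grid =
  rank_two_cartan \<Phi> \<alpha> \<beta> n m + colored_grid P chn col \<alpha> \<beta> M
  for \<Phi> :: "'v::euclidean_space set" and \<alpha> \<beta> :: 'v and n m :: nat
    and P :: "'p::order set" and chn :: "'p \<Rightarrow> nat" and col :: "'p \<Rightarrow> 'v" and M :: nat +
  assumes structured: "M_structured (order_ideals P) (ideal_edge_color col) \<alpha> \<beta>"
begin

abbreviation "ec \<equiv> ideal_edge_color col"

definition wtx :: "'p set \<Rightarrow> 'v" where "wtx = wt L ec \<alpha> \<beta>"

lemma cpar: "cpar \<alpha> = par" "cpar \<beta> = (\<not> par)"
  using colors(1) by (auto simp: cpar_def)

lemma wtx_eq: "x \<in> L \<Longrightarrow> wtx x = wv (of_int (wgt par (vec x))) (of_int (wgt (\<not> par) (vec x)))"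
  unfolding wtx_def wt_def comb_fund using color_weight_L[of x \<alpha>] color_weight_L[of x \<beta>] cpar by simp

lemma wtx_coords: "x \<in> L \<Longrightarrow> wa (wtx x) = of_int (wgt par (vec x))" "x \<in> L \<Longrightarrow> wb (wtx x) = of_int (wgt (\<not> par) (vec x))"
  by (simp_all add: wtx_eq)

lemma wtx_edge: "color_edge L ec i s t \<Longrightarrow> i \<in> {\<alpha>, \<beta>} \<Longrightarrow> wtx t = wtx s + i"
  using structured unfolding M_structured_def wtx_def by metis

text \<open>Both ideals are reached from the least ideal of their component, and the structure
  condition makes every edge on the way add \<open>i\<close>.\<close>

lemma wtx_component:
  assumes x: "x \<in> L" and y: "y \<in> L" and so: "same_off (cpar i) (vec x) (vec y)" and i: "i \<in> {\<alpha>, \<beta>}"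
  shows "wtx y = wtx x + of_int (tot (cpar i) (vec y) - tot (cpar i) (vec x)) *\<^sub>R i"
proof -
  define z where "z = idl (low (cpar i) (vec x))"
  have a: "wtx y = wtx z + of_int (tot (cpar i) (vec y) - tot (cpar i) (vec z)) *\<^sub>R i"
    if "y \<in> component (cpar i) x" for y
    using that
  proof (induction "card y" arbitrary: y rule: less_induct)
    case less
    show ?case
    proof (cases "y = z")
      case False
      then obtain s where s: "s \<in> component (cpar i) x" "color_edge L ec i s y"
        using component_pred[OF x less.prems _ i] unfolding z_def by blast
      note e = edge_same_off[OF s(2) i]
      have "card s < card y" using e(2) by simp
      from less.hyps[OF this s(1)] have "wtx y = wtx z + of_int (tot (cpar i) (vec s) - tot (cpar i) (vec z)) *\<^sub>R i + i"
        using wtx_edge[OF s(2) i] by simp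
      also have "\<dots> = wtx z + of_int (tot (cpar i) (vec y) - tot (cpar i) (vec z)) *\<^sub>R i"
        unfolding e(3) by (simp add: algebra_simps)
      finally show ?thesis .
    qed simp
  qed
  have "x \<in> component (cpar i) x" "y \<in> component (cpar i) x"
    using x y so same_off_refl by (simp_all add: component_def)
  note ax = a[OF this(1)] and ay = a[OF this(2)]
  show ?thesis unfolding ax ay by (simp add: algebra_simps)
qed

definition removed :: "'p set \<Rightarrow> int \<times> int" where
  "removed x = (tot par (vec P) - tot par (vec x), tot (\<not> par) (vec P) - tot (\<not> par) (vec x))"

lemma removed_nonneg: "x \<in> L \<Longrightarrow> 0 \<le> fst (removed x) \<and> 0 \<le> snd (removed x)"
proof -
  assume x: "x \<in> L"
  have "tot p (vec x) \<le> tot p (vec P)" for p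
    unfolding tot_def vec_P using vecs_len[OF vec_vecs[OF x]] by (intro sum_mono) simp
  then show ?thesis by (simp add: removed_def)
qed

lemma removed_card: "x \<in> L \<Longrightarrow> fst (removed x) + snd (removed x) = int (card P) - int (card x)"
  using card_tot[of x] card_tot[OF P_L] by (cases par) (simp_all add: removed_def)

lemma wtx_removed: "x \<in> L \<Longrightarrow> wtx x = wtx P - comb (removed x)"
proof (induction "card P - card x" arbitrary: x rule: less_induct)
  case less
  show ?case
  proof (cases "x = P")
    case True
    then show ?thesis by (simp add: removed_def comb_def)
  next
    case False
    then have "x < P" using ideal_subset[OF less.prems] by blast
    then obtain t where t: "covers_in L x t" using covers_in_above[OF finL less.prems P_L] by blast
    then obtain u where u: "t \<in> L" "u \<in> P - x" "t = insert u x" unfolding covers_L by blast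
    define i where "i = col u"
    have i: "i \<in> {\<alpha>, \<beta>}" using colors(2)[of u] u by (auto simp: i_def)
    have e: "color_edge L ec i x t" unfolding color_edge_L i_def using less.prems u by blast
    note ed = edge_same_off[OF e i]
    have "card t \<le> card P" using ideal_subset[OF u(1)] finP by (rule card_mono[rotated])
    then have "wtx t = wtx P - comb (removed t)" using ed(2) u(1) by (intro less.hyps) auto
    then have w: "wtx x = wtx P - comb (removed t) - i" using wtx_edge[OF e i] by (simp add: algebra_simps)
    have "removed x = removed t + (if i = \<alpha> then (1, 0) else (0, 1))"
    proof (cases "i = \<alpha>")
      case True
      then have "cpar i = par" using cpar by simp
      then show ?thesis using ed(3) tot_same_off[OF ed(1)] True by (simp add: removed_def)
    next
      case False
      then have "cpar i = (\<not> par)" using cpar i by auto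
      then show ?thesis using ed(3) tot_same_off[OF ed(1)] False by (simp add: removed_def)
    qed
    then have "comb (removed x) = comb (removed t) + i"
      using i colors(1) by (auto simp: comb_def algebra_simps)
    then show ?thesis using w by (simp add: algebra_simps)
  qed
qed

lemma coord_simple: "i \<in> {\<alpha>, \<beta>} \<Longrightarrow> x \<in> L \<Longrightarrow> wtx x \<bullet> coroot i = of_int (wgt (cpar i) (vec x))"
  using wtx_coords[of x] cpar by (auto simp: wa_def wb_def)

text \<open>The flip turns the coordinate \<open>w\<close> of color \<open>i\<close> into
  \<open>- w\<close>, hence changes the number of elements of that color by \<open>- w\<close>; by
  the structure condition the whole weight changes by \<open>- w\<close> times \<open>i\<close>, as
  under the reflection.\<close>

lemma refl_wtx:
  assumes "x \<in> L" "i \<in> {\<alpha>, \<beta>}"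
  shows "root_reflection i (wtx x) = wtx (idl (flip (cpar i) (vec x)))" "idl (flip (cpar i) (vec x)) \<in> L"
    "vec (idl (flip (cpar i) (vec x))) = flip (cpar i) (vec x)"
proof -
  note X = vec_vecs[OF assms(1)]
  note fl = flip[OF X, of "cpar i"]
  show y: "idl (flip (cpar i) (vec x)) \<in> L" and v: "vec (idl (flip (cpar i) (vec x))) = flip (cpar i) (vec x)"
    using idl_L[OF fl(1)] vec_idl[OF fl(1)] by auto
  have "tot (cpar i) (flip (cpar i) (vec x)) - tot (cpar i) (vec x) = - wgt (cpar i) (vec x)"
    using wgt_diff[OF fl(2)] fl(3) by simp
  then have "wtx (idl (flip (cpar i) (vec x))) = wtx x + of_int (- wgt (cpar i) (vec x)) *\<^sub>R i"
    using wtx_component[OF assms(1) y _ assms(2)] fl(2) v by simp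
  then show "root_reflection i (wtx x) = wtx (idl (flip (cpar i) (vec x)))"
    using coord_simple[OF assms(2,1)] by (simp add: root_reflection_def)
qed

lemma sum_refl_wtx:
  assumes "i \<in> {\<alpha>, \<beta>}"
  shows "(\<Sum>x\<in>L. E (root_reflection i (wtx x))) = (\<Sum>x\<in>L. E (wtx x) :: 'r::comm_ring_1)"
proof (rule sum.reindex_bij_witness[where i = "\<lambda>x. idl (flip (cpar i) (vec x))" and j = "\<lambda>x. idl (flip (cpar i) (vec x))"])
  fix x assume x: "x \<in> L"
  note r = refl_wtx[OF x assms]
  show "idl (flip (cpar i) (vec (idl (flip (cpar i) (vec x))))) = x"
    unfolding r(3) using flip(4)[OF vec_vecs[OF x]] idl_vec[OF x] by simp
  then show "idl (flip (cpar i) (vec (idl (flip (cpar i) (vec x))))) = x" .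
  show "idl (flip (cpar i) (vec x)) \<in> L" by (rule r(2))
  then show "idl (flip (cpar i) (vec x)) \<in> L" .
  show "E (wtx (idl (flip (cpar i) (vec x)))) = E (root_reflection i (wtx x))" by (simp only: r(1))
qed

lemma sum_act_wtx: "(\<Sum>x\<in>L. E (act w (wtx x))) = (\<Sum>x\<in>L. E (wtx x) :: 'r::comm_ring_1)"
proof (induction w arbitrary: E)
  case (Cons i w)
  have "(if i then \<alpha> else \<beta>) \<in> {\<alpha>, \<beta>}" by simp
  from sum_refl_wtx[OF this] show ?case
    using Cons[of "\<lambda>v. E (root_reflection (if i then \<alpha> else \<beta>) v)"] by (simp only: act.simps comp_apply)
qed simp

lemma act_wtx: "x \<in> L \<Longrightarrow> \<exists>y\<in>L. act w (wtx x) = wtx y"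
proof (induction w)
  case (Cons i w)
  then obtain y where y: "y \<in> L" "act w (wtx x) = wtx y" by blast
  have "(if i then \<alpha> else \<beta>) \<in> {\<alpha>, \<beta>}" by simp
  from refl_wtx[OF y(1) this] show ?case using y(2) by (metis act.simps(2) comp_apply)
qed auto

lemma act_add: "act w (u + v) = act w u + act w v"
  by (induction w) (simp_all add: refl_linear)

text \<open>Invariance of the weights lets the \<open>w\<close>-th summand use
  \<open>act w (wtx x)\<close> in place of \<open>wtx x\<close>, so the product becomes the sum of
  the alternating sums at \<open>rho + wtx x\<close>, which collapses to the maximal ideal.
  Multiplicativity is asked only at the arguments that occur, where exponents taken by floor are
  sure to add.\<close>

lemma alternating_identity:
  fixes E1 E2 E3 :: "'v \<Rightarrow> 'r::comm_ring_1"
  assumes two: "\<And>x::'r. x + x = 0 \<Longrightarrow> x = 0"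
    and mult: "\<And>w x. w \<in> set (weyl_words n) \<Longrightarrow> x \<in> L \<Longrightarrow>
      E1 (act w (rho \<alpha> \<beta>) + act w (wtx x)) = E2 (act w (rho \<alpha> \<beta>)) * E3 (act w (wtx x))"
  shows "alt E2 (rho \<alpha> \<beta>) * (\<Sum>x\<in>L. E3 (wtx x)) = alt E1 (rho \<alpha> \<beta> + wtx P)"
proof -
  let ?r = "rho \<alpha> \<beta>"
  have "alt E2 ?r * (\<Sum>x\<in>L. E3 (wtx x)) = (\<Sum>w\<leftarrow>weyl_words n. (- 1) ^ length w * E2 (act w ?r) * (\<Sum>x\<in>L. E3 (wtx x)))"
    unfolding alt_def by (simp only: sum_list_mult_const)
  also have "\<dots> = (\<Sum>w\<leftarrow>weyl_words n. \<Sum>x\<in>L. (- 1) ^ length w * E1 (act w (?r + wtx x)))"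
  proof (rule arg_cong[where f = sum_list], rule map_cong[OF HOL.refl])
    fix w assume w: "w \<in> set (weyl_words n)"
    have "(- 1) ^ length w * E2 (act w ?r) * (\<Sum>x\<in>L. E3 (wtx x))
        = (- 1) ^ length w * E2 (act w ?r) * (\<Sum>x\<in>L. E3 (act w (wtx x)))"
      by (simp only: sum_act_wtx)
    also have "\<dots> = (\<Sum>x\<in>L. (- 1) ^ length w * E1 (act w (?r + wtx x)))"
      unfolding sum_distrib_left by (rule sum.cong) (simp_all add: act_add mult[OF w] mult.assoc)
    finally show "(- 1) ^ length w * E2 (act w ?r) * (\<Sum>x\<in>L. E3 (wtx x)) = \<dots>" .
  qed
  also have "\<dots> = (\<Sum>x\<in>L. alt E1 (?r + wtx x))"
    unfolding alt_def
    by (simp only: sum_list_distinct_conv_sum_set[OF weyl_words_distinct(1)] sum.swap[of _ "set (weyl_words n)" L])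
  also have "\<dots> = (\<Sum>X\<in>vecs. alt E1 (?r + wtx (idl X)))"
  proof -
    have "(\<Sum>x\<in>L. alt E1 (?r + wtx x)) = (\<Sum>x\<in>L. alt E1 (?r + wtx (idl (vec x))))"
      by (rule sum.cong) (simp_all add: idl_vec)
    also have "\<dots> = (\<Sum>X\<in>vecs. alt E1 (?r + wtx (idl X)))"
      by (rule sum.reindex_bij_betw[OF bij_vec])
    finally show ?thesis .
  qed
  also have "\<dots> = alt E1 (?r + wtx (idl (\<lambda>j. card (C j))))"
  proof (rule alternating_sum[OF two])
    fix p X Y assume X: "X \<in> vecs" and Y: "Y \<in> vecs" and so: "same_off p X Y" and w: "wgt p Y = - wgt p X - 2"
    define b where "b \<longleftrightarrow> p = par"
    define i where "i = (if b then \<alpha> else \<beta>)"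
    have i: "i \<in> {\<alpha>, \<beta>}" "cpar i = p" using cpar by (auto simp: i_def b_def)
    have "tot p Y - tot p X = - (wgt p X + 1)" using wgt_diff[OF so] w by simp
    then have "wtx (idl Y) = wtx (idl X) + of_int (- (wgt p X + 1)) *\<^sub>R i"
      using wtx_component[OF idl_L[OF X] idl_L[OF Y] _ i(1)] so i(2) by (simp add: vec_idl X Y)
    \<comment> \<open>As \<rho> has coordinate 1, the passage from \<open>w\<close> to
      \<open>- w - 2\<close> is an ordinary reflection once \<rho> is added.\<close>
    moreover have "(?r + wtx (idl X)) \<bullet> coroot i = of_int (wgt p X) + 1"
    proof -
      have "?r \<bullet> coroot i = 1" using wv[of 1 1] i(1) by (auto simp: rho_eq wa_def wb_def)
      then show ?thesis using coord_simple[OF i(1) idl_L[OF X]] i(2) by (simp add: inner_add_left vec_idl X)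
    qed
    ultimately have "?r + wtx (idl Y) = root_reflection i (?r + wtx (idl X))"
      by (simp add: root_reflection_def algebra_simps)
    then show "alt E1 (?r + wtx (idl Y)) = - alt E1 (?r + wtx (idl X))"
      using alt_refl[of E1 b] unfolding i_def by simp
  qed
  also have "idl (\<lambda>j. card (C j)) = P" using idl_vec[OF P_L] by (simp only: vec_P)
  finally show ?thesis .
qed

end

section \<open>The group ring and the Weyl bialternant\<close>

lemma lookup_single_mult:
  fixes \<xi> :: "'v::euclidean_space \<Rightarrow>\<^sub>0 int"
  shows "Poly_Mapping.lookup (formal_exp a * \<xi>) k = Poly_Mapping.lookup \<xi> (k - a)"
proof -
  have ex: "\<xi> = (\<Sum>u\<in>Poly_Mapping.keys \<xi>. Poly_Mapping.single u (Poly_Mapping.lookup \<xi> u))"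
    by (rule poly_mapping_eqI) (auto simp: lookup_sum lookup_single when_def sum.delta in_keys_iff)
  have "formal_exp a * \<xi> = formal_exp a * (\<Sum>u\<in>Poly_Mapping.keys \<xi>. Poly_Mapping.single u (Poly_Mapping.lookup \<xi> u))"
    by (rule arg_cong[OF ex])
  also have "\<dots> = (\<Sum>u\<in>Poly_Mapping.keys \<xi>. Poly_Mapping.single (a + u) (Poly_Mapping.lookup \<xi> u))"
    by (simp add: sum_distrib_left formal_exp_def mult_single)
  also have "Poly_Mapping.lookup \<dots> k = (\<Sum>u\<in>Poly_Mapping.keys \<xi>. if u = k - a then Poly_Mapping.lookup \<xi> u else 0)"
    unfolding lookup_sum lookup_single when_def by (rule sum.cong) (auto simp: algebra_simps)
  also have "\<dots> = Poly_Mapping.lookup \<xi> (k - a)"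
    by (auto simp: sum.delta in_keys_iff)
  finally show ?thesis .
qed

lemma lookup_of_int_mult:
  fixes \<xi> :: "'v::euclidean_space \<Rightarrow>\<^sub>0 int"
  shows "Poly_Mapping.lookup (of_int s * \<xi>) k = s * Poly_Mapping.lookup \<xi> k"
proof -
  have nat: "Poly_Mapping.lookup (of_nat j * \<xi>) k = int j * Poly_Mapping.lookup \<xi> k" for j
    by (induct j) (simp_all add: algebra_simps lookup_add)
  show ?thesis
    by (cases s rule: int_diff_cases) (simp add: left_diff_distrib lookup_minus nat)
qed

lemma lookup_sum_list:
  "Poly_Mapping.lookup (\<Sum>x\<leftarrow>xs. f x) k = (\<Sum>x\<leftarrow>xs. Poly_Mapping.lookup (f x) k)"
  by (induction xs) (simp_all add: lookup_add)

lemma formal_exp_add: "formal_exp (u + v) = formal_exp u * formal_exp v"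
  by (simp add: formal_exp_def mult_single)

lemma exp_act_formal_exp: "exp_act \<sigma> (formal_exp \<mu>) = formal_exp (\<sigma> \<mu>)"
  by (simp add: exp_act_def formal_exp_def)

context rank_two_cartan begin

text \<open>The linear form with value 1 on both simple roots, that is, the pairing with half the
  sum of the positive coroots.\<close>

definition hgt :: "'v \<Rightarrow> real" where
  "hgt v = ((2 + real m) * wa v + (2 + real n) * wb v) / cdet"

lemma hgt_linear [simp]: "hgt (v + w) = hgt v + hgt w" "hgt (v - w) = hgt v - hgt w"
  by (simp_all add: hgt_def add_divide_distrib diff_divide_distrib algebra_simps)

lemma hgt_comb [simp]: "hgt (comb p) = of_int (fst p + snd p)"
proof -
  have "(2 + real m) * wa (comb p) + (2 + real n) * wb (comb p) = cdet * of_int (fst p + snd p)"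
    unfolding comb_coords cdet_def by (simp add: algebra_simps)
  then show ?thesis using cdet_pos by (simp add: hgt_def)
qed

lemma alt_rho:
  "alt E (rho \<alpha> \<beta>) = (\<Sum>(s, d)\<leftarrow>denominator_terms n. of_int s * E (rho \<alpha> \<beta> - comb d) :: 'r::comm_ring_1)"
proof -
  have "alt E (rho \<alpha> \<beta>)
      = (\<Sum>(s, u)\<leftarrow>map (\<lambda>w. ((- 1 :: int) ^ length w, act w (rho \<alpha> \<beta>))) (weyl_words n). of_int s * E u)"
    by (simp add: alt_def comp_def)
  also have "\<dots> = (\<Sum>(s, d)\<leftarrow>denominator_terms n. of_int s * E (rho \<alpha> \<beta> - comb d))"
    unfolding act_rho by (simp add: comp_def split_def)
  finally show ?thesis .
qed

lemma alternator_eq_alt: "alternator \<Phi> (formal_exp \<mu>) = alt formal_exp \<mu>"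
  unfolding alternator_def alt_weyl exp_act_formal_exp ..

lemma lookup_alt_rho:
  "Poly_Mapping.lookup (alt formal_exp (rho \<alpha> \<beta>) * \<xi>) (rho \<alpha> \<beta> + \<mu>)
     = (\<Sum>(s, d)\<leftarrow>denominator_terms n. s * Poly_Mapping.lookup \<xi> (\<mu> + comb d))"
proof -
  have "alt formal_exp (rho \<alpha> \<beta>) * \<xi>
      = (\<Sum>x\<leftarrow>denominator_terms n. of_int (fst x) * (formal_exp (rho \<alpha> \<beta> - comb (snd x)) * \<xi>))"
    by (simp add: alt_rho split_def sum_list_mult_const[symmetric] mult.assoc)
  moreover have "rho \<alpha> \<beta> + \<mu> - (rho \<alpha> \<beta> - comb d) = \<mu> + comb d" for d by simp
  ultimately show ?thesis
    by (simp only: lookup_sum_list lookup_of_int_mult lookup_single_mult split_def)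
qed

lemma comb_zero: "comb (0, 0) = 0"
  by (simp add: comb_def)

text \<open>The term \<open>e\<^sup>\<rho>\<close> is the highest one, so a highest weight of \<open>\<xi>\<close> cannot cancel.\<close>

lemma alt_rho_cancel:
  assumes "alt formal_exp (rho \<alpha> \<beta>) * \<xi> = 0"
  shows "\<xi> = 0"
proof (rule ccontr)
  assume "\<xi> \<noteq> 0"
  then have ne: "Poly_Mapping.keys \<xi> \<noteq> {}" by simp
  have "Max (hgt ` Poly_Mapping.keys \<xi>) \<in> hgt ` Poly_Mapping.keys \<xi>"
    using ne by (intro Max_in) auto
  then obtain \<mu> where \<mu>: "\<mu> \<in> Poly_Mapping.keys \<xi>" "hgt \<mu> = Max (hgt ` Poly_Mapping.keys \<xi>)" by auto
  have le: "hgt \<nu> \<le> hgt \<mu>" if "\<nu> \<in> Poly_Mapping.keys \<xi>" for \<nu>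
    unfolding \<mu>(2) using that by (intro Max_ge) auto
  have zero: "Poly_Mapping.lookup \<xi> (\<mu> + comb d) = 0" if "0 < fst d + snd d" for d
  proof (rule ccontr)
    assume "Poly_Mapping.lookup \<xi> (\<mu> + comb d) \<noteq> 0"
    then have "hgt (\<mu> + comb d) \<le> hgt \<mu>" by (intro le) (simp add: in_keys_iff)
    moreover have "(0::real) < of_int (fst d + snd d)" using that by (simp only: of_int_0_less_iff)
    ultimately show False by simp
  qed
  have "(\<Sum>(s, d)\<leftarrow>denominator_terms n. s * Poly_Mapping.lookup \<xi> (\<mu> + comb d)) = 0"
    unfolding lookup_alt_rho[symmetric] assms by simp
  moreover have "(\<Sum>(s, d)\<leftarrow>denominator_terms n. s * Poly_Mapping.lookup \<xi> (\<mu> + comb d)) = Poly_Mapping.lookup \<xi> \<mu>"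
    by (simp add: denominator_terms_def zero comb_zero)
  ultimately show False using \<mu>(1) by (simp add: in_keys_iff)
qed

end

lemma poly_mapping_two_torsion:
  fixes x :: "'v::euclidean_space \<Rightarrow>\<^sub>0 int"
  assumes "x + x = 0"
  shows "x = 0"
proof (rule poly_mapping_eqI)
  fix k
  have "Poly_Mapping.lookup x k + Poly_Mapping.lookup x k = 0"
    unfolding lookup_add[symmetric] assms by simp
  then show "Poly_Mapping.lookup x k = Poly_Mapping.lookup 0 k" by simp
qed

context structured_grid begin

lemma WGF_eq: "WGF L ec \<alpha> \<beta> = (\<Sum>x\<in>L. formal_exp (wtx x))"
  by (simp add: WGF_def wtx_def)

lemma wtx_lattice: "x \<in> L \<Longrightarrow> wtx x \<in> weight_lattice \<alpha> \<beta>"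
  unfolding weight_lattice_def comb_fund using wtx_eq by blast

lemma alt_rho_WGF: "alt formal_exp (rho \<alpha> \<beta>) * WGF L ec \<alpha> \<beta> = alt formal_exp (rho \<alpha> \<beta> + wtx P)"
  unfolding WGF_eq
proof (rule alternating_identity)
  fix x :: "'v \<Rightarrow>\<^sub>0 int" assume "x + x = 0"
  then show "x = 0" by (rule poly_mapping_two_torsion)
qed (rule formal_exp_add)

lemma WGF_group_ring: "WGF L ec \<alpha> \<beta> \<in> group_ring (weight_lattice \<alpha> \<beta>)"
  unfolding group_ring_def
proof (intro CollectI subsetI)
  fix k assume "k \<in> Poly_Mapping.keys (WGF L ec \<alpha> \<beta>)"
  then have "(\<Sum>x\<in>L. Poly_Mapping.lookup (formal_exp (wtx x)) k) \<noteq> 0"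
    by (simp add: in_keys_iff WGF_eq lookup_sum)
  then obtain x where "x \<in> L" "Poly_Mapping.lookup (formal_exp (wtx x)) k \<noteq> 0"
    by (rule sum.not_neutral_contains_not_neutral)
  then show "k \<in> weight_lattice \<alpha> \<beta>"
    using wtx_lattice[of x] by (auto simp: formal_exp_def lookup_single when_def split: if_splits)
qed

text \<open>Uniqueness in the defining description comes from \<open>alt_rho_cancel\<close>, applied
  to a difference.\<close>

lemma WGF_bialternant: "WGF L ec \<alpha> \<beta> = weyl_bialternant \<Phi> \<alpha> \<beta> (wtx P)"
  unfolding weyl_bialternant_def alternator_eq_alt
proof (rule the_equality[symmetric])
  show e: "WGF L ec \<alpha> \<beta> \<in> group_ring (weight_lattice \<alpha> \<beta>) \<and>
    alt formal_exp (rho \<alpha> \<beta>) * WGF L ec \<alpha> \<beta> = alt formal_exp (wtx P + rho \<alpha> \<beta>)"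
    using WGF_group_ring alt_rho_WGF by (simp add: add.commute)
  fix \<xi> assume "\<xi> \<in> group_ring (weight_lattice \<alpha> \<beta>) \<and>
    alt formal_exp (rho \<alpha> \<beta>) * \<xi> = alt formal_exp (wtx P + rho \<alpha> \<beta>)"
  then have "alt formal_exp (rho \<alpha> \<beta>) * (\<xi> - WGF L ec \<alpha> \<beta>) = 0"
    using e by (simp add: right_diff_distrib)
  then have "\<xi> - WGF L ec \<alpha> \<beta> = 0" by (rule alt_rho_cancel)
  then show "\<xi> = WGF L ec \<alpha> \<beta>" by simp
qed

definition cnt :: "nat \<Rightarrow> nat" where "cnt i = card {x \<in> L. card x = i}"

lemma RGF_eq: "RGF L = (\<Sum>i\<le>card P. monom (int (cnt i)) i)"
proof -
  have "{x \<in> L. rank_wrt (covers_in L) L x = i} = {x \<in> L. card x = i}" for i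
    by (rule Collect_cong, rule conj_cong[OF HOL.refl]) (simp only: rank_L(2))
  then show ?thesis unfolding RGF_def rank_L(3) by (simp add: cnt_def)
qed

lemma coeff_RGF: "coeff (RGF L) i = (if i \<le> card P then int (cnt i) else 0)"
  unfolding RGF_eq coeff_sum coeff_monom by (simp only: sum.delta finite_atMost atMost_iff)

lemma card_le: "x \<in> L \<Longrightarrow> card x \<le> card P"
  by (rule card_mono[OF finP ideal_subset])

lemma empty_L: "{} \<in> L"
  by (rule idealI) auto

lemma splitting: "splitting_distributive_lattice L ec \<alpha> \<beta> (weyl_bialternant \<Phi> \<alpha> \<beta> (wtx P))"
proof -
  have "ec s t \<in> {\<alpha>, \<beta>}" if st: "covers_in L s t" for s t
  proof -
    obtain u where "s \<in> L" "t \<in> L" "u \<in> P - s" "t = insert u s" using st unfolding covers_L by blast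
    then show ?thesis using colors(2)[of u] by (auto simp: ideal_edge_color_def insert_Diff_if)
  qed
  then show ?thesis
    unfolding splitting_distributive_lattice_def splitting_poset_def ranked_poset_def
    using finL rank_L(1) structured WGF_bialternant distributive_order_ideals[of P] by blast
qed

end

section \<open>Rank symmetry and unimodality\<close>

context rank_two_cartan begin

definition longest_word :: "bool list" where
  "longest_word = (if n = 0 then [False, True] else if n = 1 then [True, False, True]
     else if n = 2 then [False, True, False, True] else [False, True, False, True, False, True])"

text \<open>The longest element exchanges positive and negative coroots and so negates their half
  sum, even in type A2, where it is not minus the identity on weights.\<close>

lemma hgt_longest: "hgt (act longest_word v) = - hgt v"
proof -
  have e: "(2 + real m) * wa (act longest_word v) + (2 + real n) * wb (act longest_word v)
      = - ((2 + real m) * wa v + (2 + real n) * wb v)"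
    unfolding longest_word_def act_coords[THEN conjunct1] act_coords[THEN conjunct2]
    by (rule nm_cases) (simp_all add: algebra_simps)
  show ?thesis unfolding hgt_def e by (rule minus_divide_left[symmetric])
qed

text \<open>The invariant form in weight coordinates, scaled by half of \<open>cdet\<close> from the
  form that gives \<alpha> the square 2; this is why \<open>cdet\<close> appears in
  \<open>quad_diff\<close>.\<close>

definition quad :: "'v \<Rightarrow> real" where
  "quad v = wa v ^ 2 + real n * wa v * wb v + real (max 1 n) * wb v ^ 2"

lemma quad_refl: "quad (sa v) = quad v" "quad (sb v) = quad v"
proof -
  show "quad (sa v) = quad v" unfolding quad_def refl_coords
    by (rule nm_cases) (simp_all add: algebra_simps power2_eq_square)
  show "quad (sb v) = quad v" unfolding quad_def refl_coords
    by (rule nm_cases) (simp_all add: algebra_simps power2_eq_square)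
qed

lemma quad_act: "quad (act w v) = quad v"
proof (induction w)
  case (Cons i w)
  then show ?case by (cases i) (simp_all add: quad_refl)
qed simp

lemma quad_diff:
  "quad (v - comb p) = quad v - cdet * (wa v * of_int (fst p) + real (max 1 n) * wb v * of_int (snd p)
     - of_int (fst p) ^ 2 + real n * of_int (fst p) * of_int (snd p) - real (max 1 n) * of_int (snd p) ^ 2)"
  unfolding quad_def cdet_def wt_coord_linear comb_coords
  by (rule nm_cases) (simp_all add: algebra_simps power2_eq_square)

lemma comb_diff: "comb (p - q) = comb p - comb q"
  by (simp add: comb_def algebra_simps)

end

context structured_grid begin

lemma wgt_P_nonneg: "0 \<le> wgt p (vec P)"
proof -
  have "0 \<le> dev (vec P) j" for j
    using hi_len[of j] vecs_bounds[OF len_vecs, of j] unfolding vec_P dev_def by simp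
  then show ?thesis unfolding wgt_def by (intro sum_nonneg)
qed

definition top_coeff :: "bool \<Rightarrow> nat" where
  "top_coeff i = nat (wgt (if i then par else \<not> par) (vec P))"

lemma wtx_P: "wtx P = wv (real (top_coeff True)) (real (top_coeff False))"
  by (simp add: wtx_eq[OF P_L] top_coeff_def wgt_P_nonneg)

definition removed_count :: "int \<times> int \<Rightarrow> nat" where
  "removed_count p = card {x \<in> L. removed x = p}"

lemma removed_count_zero: "removed_count 0 = 1"
proof -
  have "{x \<in> L. removed x = 0} = {P}"
  proof (intro equalityI subsetI)
    fix x assume "x \<in> {x \<in> L. removed x = 0}"
    then have x: "x \<in> L" "removed x = 0" by blast+
    then have "card x = card P" using removed_card[OF x(1)] by simp
    then show "x \<in> {P}" using card_subset_eq[OF finP ideal_subset[OF x(1)]] by simp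
  qed (simp add: P_L removed_def zero_prod_def)
  then show ?thesis by (simp add: removed_count_def)
qed

lemma lookup_WGF: "Poly_Mapping.lookup (WGF L ec \<alpha> \<beta>) (wtx P - comb p) = int (removed_count p)"
proof -
  have 1: "Poly_Mapping.lookup (formal_exp (wtx x)) (wtx P - comb p) = (if removed x = p then 1 else 0)"
    if x: "x \<in> L" for x
  proof -
    have "wtx x = wtx P - comb p \<longleftrightarrow> removed x = p"
      unfolding wtx_removed[OF x] using comb_inj[of "removed x" p] by auto
    then show ?thesis by (simp only: formal_exp_def lookup_single when_def)
  qed
  have "Poly_Mapping.lookup (WGF L ec \<alpha> \<beta>) (wtx P - comb p) = (\<Sum>x\<in>L. if removed x = p then 1 else 0)"
    unfolding WGF_eq lookup_sum by (rule sum.cong) (simp_all add: 1)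
  also have "\<dots> = int (card {x \<in> L. removed x = p})"
    by (simp add: sum.inter_filter[OF finL, symmetric])
  finally show ?thesis by (simp add: removed_count_def)
qed

text \<open>The module with the weight of the maximal ideal as its highest weight; its matrix pairs
  the simple root of the second index with the coroot of the first.\<close>

interpretation MD: rank2_finite_module "\<lambda>i. real (top_coeff i)"
  "\<lambda>i j. if i = j then 2 else - real (if i then n else m)" top_coeff "\<lambda>i j. if i then n else m" n m
  by unfold_locales (use nm in \<open>auto split: if_splits\<close>)

text \<open>Off the orbit of \<open>\<lambda> + \<rho>\<close> the alternating sum vanishes; on the orbit the invariant
  quadratic form forces the Casimir eigenvalue to vanish.\<close>

lemma removed_count_denominator:
  "MD.cas p * (\<Sum>(s, d)\<leftarrow>denominator_terms n. of_int s * real (removed_count (p - d))) = 0"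
proof -
  define \<nu> where "\<nu> = rho \<alpha> \<beta> + wtx P"
  define S where "S = (\<Sum>(s, d)\<leftarrow>denominator_terms n. s * int (removed_count (p - d)))"
  have "(\<Sum>(s, d)\<leftarrow>xs. of_int s * real (removed_count (p - d)))
      = of_int (\<Sum>(s, d)\<leftarrow>xs. s * int (removed_count (p - d)))" for xs :: "(int \<times> int \<times> int) list"
    by (induction xs) auto
  then have real_S: "(\<Sum>(s, d)\<leftarrow>denominator_terms n. of_int s * real (removed_count (p - d))) = of_int S"
    unfolding S_def by blast
  have shift: "wtx P - comb p + comb d = wtx P - comb (p - d)" for d
    by (simp add: comb_diff)
  have "Poly_Mapping.lookup (alt formal_exp \<nu>) (rho \<alpha> \<beta> + (wtx P - comb p)) = S"
    unfolding \<nu>_def alt_rho_WGF[symmetric] lookup_alt_rho shift lookup_WGF S_def ..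
  then have S: "Poly_Mapping.lookup (alt formal_exp \<nu>) (\<nu> - comb p) = S"
    by (simp add: \<nu>_def algebra_simps)
  have "MD.cas p = 0" if "S \<noteq> 0"
  proof -
    have "\<exists>w. act w \<nu> = \<nu> - comb p"
    proof (rule ccontr)
      assume no: "\<nexists>w. act w \<nu> = \<nu> - comb p"
      have "Poly_Mapping.lookup ((- 1) ^ length w * formal_exp (act w \<nu>)) (\<nu> - comb p) = 0" for w
      proof -
        have "Poly_Mapping.lookup (of_int ((- 1) ^ length w) * formal_exp (act w \<nu>)) (\<nu> - comb p) = 0"
        proof -
          have "act w \<nu> \<noteq> \<nu> - comb p" using no by blast
          then show ?thesis unfolding lookup_of_int_mult by (simp only: formal_exp_def lookup_single when_def if_False mult_zero_right)
        qed
        then show ?thesis by simp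
      qed
      then have "S = 0" unfolding S[symmetric] alt_def lookup_sum_list by simp
      then show False using that by blast
    qed
    then obtain w where "act w \<nu> = \<nu> - comb p" ..
    then have "quad (\<nu> - comb p) = quad \<nu>" using quad_act[of w \<nu>] by simp
    moreover have "wa \<nu> = real (top_coeff True) + 1" "wb \<nu> = real (top_coeff False) + 1"
      by (simp_all add: \<nu>_def rho_eq wtx_P)
    ultimately have "cdet * MD.cas p = 0"
      unfolding quad_diff MD.cas_def MD.rt_def by (simp add: algebra_simps)
    then show ?thesis using cdet_pos by simp
  qed
  then show ?thesis unfolding real_S by auto
qed

lemma removed_count_reflect:
  assumes "removed_count p \<noteq> 0" and h: "MD.hw i p = - real k"
  shows "removed_count (p - MD.ray i (int k)) \<noteq> 0"
proof -
  have "{x \<in> L. removed x = p} \<noteq> {}"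
  proof
    assume "{x \<in> L. removed x = p} = {}"
    then show False using assms(1) by (simp only: removed_count_def card.empty)
  qed
  then obtain x where x: "x \<in> L" "removed x = p" by blast
  define r where "r = (if i then \<alpha> else \<beta>)"
  have r: "r \<in> {\<alpha>, \<beta>}" by (simp add: r_def)
  have "wtx x \<bullet> coroot r = - real k"
    using h unfolding wtx_removed[OF x(1)] x(2) r_def
    by (cases i) (simp_all add: MD.hw_coords inner_diff_left wa_def[symmetric] wb_def[symmetric] comb_coords wtx_P)
  then have "root_reflection r (wtx x) = wtx P - comb p + real k *\<^sub>R r"
    unfolding root_reflection_def by (simp add: wtx_removed[OF x(1)] x(2))
  also have "\<dots> = wtx P - comb (p - MD.ray i (int k))"
    unfolding comb_diff by (simp add: r_def comb_def MD.ray_def)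
  finally have e: "root_reflection r (wtx x) = \<dots>" .
  define y where "y = idl (flip (cpar r) (vec x))"
  have y: "y \<in> L" "wtx y = wtx P - comb (p - MD.ray i (int k))"
    unfolding y_def using refl_wtx(1,2)[OF x(1) r] e by (simp_all only:)
  then have "comb (removed y) = comb (p - MD.ray i (int k))" using wtx_removed[OF y(1)] y(2) by simp
  then have "y \<in> {x \<in> L. removed x = p - MD.ray i (int k)}" using comb_inj y(1) by blast
  moreover have "finite {x \<in> L. removed x = p - MD.ray i (int k)}" using finL by simp
  ultimately show ?thesis unfolding removed_count_def using card_0_eq by blast
qed

lemma removed_count_eq: "removed_count p = MD.mult p"
proof (rule MD.mult_eqI)
  show "removed_count 0 = 1" by (rule removed_count_zero)
  show "vanishes_off_cone (\<lambda>p. real (removed_count p))"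
    unfolding vanishes_off_cone_def
  proof (intro allI impI)
    fix p :: "int \<times> int" assume p: "fst p < 0 \<or> snd p < 0"
    have "removed x \<noteq> p" if "x \<in> L" for x using removed_nonneg[OF that] p by auto
    then have "{x \<in> L. removed x = p} = {}" by blast
    then show "real (removed_count p) = 0" by (simp only: removed_count_def card.empty of_nat_0)
  qed
next
  fix p i k assume "removed_count p \<noteq> 0" "MD.hw i p = - real k"
  then show "removed_count (p - MD.ray i (int k)) \<noteq> 0" by (rule removed_count_reflect)
next
  fix p
  show "MD.cas p * (\<Sum>(s, d)\<leftarrow>denominator_terms n. of_int s * real (removed_count (p - d))) = 0"
    by (rule removed_count_denominator)
qed

lemma sum_removed_count:
  "(\<Sum>x\<in>{0..k}. removed_count (x, k - x)) = card {y \<in> L. int (card P) - int (card y) = k}"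
proof -
  have "(\<Sum>x\<in>{0..k}. removed_count (x, k - x)) = card (\<Union>x\<in>{0..k}. {y \<in> L. removed y = (x, k - x)})"
    unfolding removed_count_def using finL by (intro card_UN_disjoint[symmetric]) auto
  also have "(\<Union>x\<in>{0..k}. {y \<in> L. removed y = (x, k - x)}) = {y \<in> L. int (card P) - int (card y) = k}"
  proof (rule Set.set_eqI)
    fix y
    show "y \<in> (\<Union>x\<in>{0..k}. {y \<in> L. removed y = (x, k - x)}) \<longleftrightarrow> y \<in> {y \<in> L. int (card P) - int (card y) = k}"
    proof (cases "y \<in> L")
      case True
      obtain u v where uv: "removed y = (u, v)" by (cases "removed y")
      have "0 \<le> u" "0 \<le> v" "u + v = int (card P) - int (card y)"
        using removed_nonneg[OF True] removed_card[OF True] by (simp_all add: uv)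
      then show ?thesis using True uv by auto
    qed simp
  qed
  finally show ?thesis .
qed

lemma hgt_wtx: "x \<in> L \<Longrightarrow> hgt (wtx x) = hgt (wtx P) - (real (card P) - real (card x))"
  using removed_card[of x] by (simp add: wtx_removed)

lemma card_hgt_symmetric: "card {x \<in> L. hgt (wtx x) = h} = card {x \<in> L. hgt (wtx x) = - h}"
proof -
  define E :: "'v \<Rightarrow> int" where "E v = (if hgt v = h then 1 else 0)" for v
  have "int (card {x \<in> L. hgt (wtx x) = h}) = (\<Sum>x\<in>L. E (wtx x))"
    unfolding E_def by (simp add: sum.inter_filter[OF finL, symmetric])
  also have "\<dots> = (\<Sum>x\<in>L. E (act longest_word (wtx x)))" by (rule sum_act_wtx[symmetric])
  also have "\<dots> = (\<Sum>x\<in>L. if hgt (wtx x) = - h then 1 else 0)"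
    unfolding E_def hgt_longest by (rule sum.cong) auto
  also have "\<dots> = int (card {x \<in> L. hgt (wtx x) = - h})"
    by (simp add: sum.inter_filter[OF finL, symmetric])
  finally show ?thesis by simp
qed

text \<open>The heights of the weights run from that of the empty ideal to that of \<open>P\<close>,
  which are \<open>card P\<close> apart, and they are symmetric about zero.\<close>

lemma hgt_wtx_P: "2 * hgt (wtx P) = real (card P)"
proof -
  have neg: "\<exists>y\<in>L. hgt (wtx y) = - hgt (wtx x)" if "x \<in> L" for x
  proof -
    define S T where "S = {z \<in> L. hgt (wtx z) = hgt (wtx x)}" and "T = {z \<in> L. hgt (wtx z) = - hgt (wtx x)}"
    have "x \<in> S" "finite S" using that finL by (simp_all add: S_def)
    then have "card S \<noteq> 0" using card_0_eq[of S] by blast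
    moreover have "card S = card T" unfolding S_def T_def by (rule card_hgt_symmetric)
    ultimately have "T \<noteq> {}" using card.empty by force
    then show ?thesis unfolding T_def by blast
  qed
  obtain y where y: "y \<in> L" "hgt (wtx y) = - hgt (wtx P)" using neg[OF P_L] by blast
  obtain z where z: "z \<in> L" "hgt (wtx z) = - hgt (wtx {})" using neg[OF empty_L] by blast
  have "real (card y) \<le> real (card P)" "0 \<le> real (card y)" "real (card z) \<le> real (card P)" "real (card ({} :: 'p set)) = 0"
    using card_le[OF y(1)] card_le[OF z(1)] by simp_all
  then show ?thesis
    using y(2) z(2) hgt_wtx[OF y(1)] hgt_wtx[OF z(1)] hgt_wtx[OF empty_L] by linarith
qed

lemma cnt_symmetric:
  assumes "i \<le> card P" shows "cnt (card P - i) = cnt i"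
proof -
  have "{x \<in> L. card x = j} = {x \<in> L. hgt (wtx x) = real j - real (card P) / 2}" for j
  proof (rule Collect_cong, rule conj_cong[OF HOL.refl])
    fix x assume "x \<in> L"
    then have "hgt (wtx x) = real (card x) - real (card P) / 2" using hgt_wtx[of x] hgt_wtx_P by linarith
    then show "(card x = j) = (hgt (wtx x) = real j - real (card P) / 2)" by simp
  qed
  then have c: "cnt j = card {x \<in> L. hgt (wtx x) = real j - real (card P) / 2}" for j
    by (simp only: cnt_def)
  have e: "real (card P - i) - real (card P) / 2 = - (real i - real (card P) / 2)"
    using assms by (simp add: of_nat_diff field_simps)
  show ?thesis unfolding c e by (rule card_hgt_symmetric[symmetric])
qed

text \<open>Levels of the module count the elements missing from \<open>P\<close>, so they run
  against cardinality; rank symmetry turns the inequality around.\<close>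

lemma cnt_increasing:
  assumes "2 * k < card P" shows "cnt k \<le> cnt (k + 1)"
proof -
  have lev: "cnt (card P - j) = (\<Sum>x\<in>{0..int j}. removed_count (x, int j - x))" if "j \<le> card P" for j
  proof -
    have "{y \<in> L. int (card P) - int (card y) = int j} = {y \<in> L. card y = card P - j}"
    proof (rule Collect_cong, rule conj_cong[OF HOL.refl])
      fix y assume "y \<in> L"
      then have "card y \<le> card P" by (rule card_le)
      then show "(int (card P) - int (card y) = int j) = (card y = card P - j)" using that by auto
    qed
    then show ?thesis unfolding sum_removed_count cnt_def by simp
  qed
  \<comment> \<open>The principal weight of the module is twice the height of its highest weight,
    hence \<open>card P\<close>; with \<open>cdet\<close> cleared, \<open>2 * k < card P\<close>
    becomes the condition of \<open>levels_unimodal\<close>.\<close>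
  have "cdet * (2 * hgt (wtx P)) = 2 * ((2 + real m) * wa (wtx P) + (2 + real n) * wb (wtx P))"
    using cdet_pos by (simp add: hgt_def)
  then have h: "cdet * real (card P) = 2 * ((2 + real m) * real (top_coeff True) + (2 + real n) * real (top_coeff False))"
    unfolding hgt_wtx_P by (simp add: wtx_P)
  have "(4 + 2 * real m) * real (top_coeff True) + (4 + 2 * real n) * real (top_coeff False)
      = 2 * ((2 + real m) * real (top_coeff True) + (2 + real n) * real (top_coeff False))"
    by (simp add: algebra_simps)
  also have "\<dots> = (4 - real (n * m)) * real (card P)"
    unfolding h[symmetric] cdet_def by simp
  finally have e: "(4 + 2 * real m) * real (top_coeff True) + (4 + 2 * real n) * real (top_coeff False)
      = (4 - real (n * m)) * real (card P)" .
  have "(\<Sum>x\<in>{0..int k}. removed_count (x, int k - x))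
      \<le> (\<Sum>x\<in>{0..int k + 1}. removed_count (x, int k + 1 - x))"
  proof (rule MD.levels_unimodal[OF removed_count_eq])
    have "2 * real k < real (card P)" using assms by linarith
    then have "2 * real k * (4 - real (n * m)) < real (card P) * (4 - real (n * m))"
      using cdet_pos unfolding cdet_def by (intro mult_strict_right_mono) simp_all
    then show "2 * real_of_int (int k) * (4 - real (n * m))
        < (4 + 2 * real m) * real (top_coeff True) + (4 + 2 * real n) * real (top_coeff False)"
      unfolding e by (simp only: of_int_of_nat_eq mult.commute[of "4 - real (n * m)"])
  qed simp
  then have "cnt (card P - k) \<le> cnt (card P - (k + 1))"
    using lev[of k] lev[of "k + 1"] assms by (simp add: add.commute)
  then show ?thesis using cnt_symmetric[of k] cnt_symmetric[of "k + 1"] assms by simp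
qed

lemma rank_symmetric_L: "rank_symmetric L"
  unfolding rank_symmetric_def rank_L(3) coeff_RGF using cnt_symmetric by simp

lemma rank_unimodal_L: "rank_unimodal L"
  unfolding rank_unimodal_def rank_L(3) coeff_RGF
\<comment> \<open>The middle is rounded up, so that \<open>2 * i < card P\<close> holds for every
  \<open>i\<close> below it.\<close>
proof (intro exI[of _ "(card P + 1) div 2"] conjI allI impI)
  fix i assume "i < (card P + 1) div 2"
  then show "(if i \<le> card P then int (cnt i) else 0) \<le> (if i + 1 \<le> card P then int (cnt (i + 1)) else 0)"
    using cnt_increasing[of i] by simp
next
  fix i assume i: "(card P + 1) div 2 \<le> i \<and> i < card P"
  define k where "k = card P - (i + 1)"
  have k: "2 * k < card P" "k + 1 = card P - i" using i by (auto simp: k_def)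
  have "cnt k = cnt (i + 1)" using cnt_symmetric[of "i + 1"] i by (simp add: k_def)
  moreover have "cnt (k + 1) = cnt i" unfolding k(2) using cnt_symmetric[of i] i by simp
  ultimately have "cnt (i + 1) \<le> cnt i" using cnt_increasing[OF k(1)] by simp
  then show "(if i + 1 \<le> card P then int (cnt (i + 1)) else 0) \<le> (if i \<le> card P then int (cnt i) else 0)"
    using i by simp
qed simp

end

section \<open>The product formula for the rank generating function\<close>

definition drop_terms :: "nat \<Rightarrow> (int \<times> nat \<times> nat) list" where
  "drop_terms n = (if n = 0 then [(1, 0, 0), (- 1, 1, 0), (- 1, 0, 1), (1, 1, 1)]
     else if n = 1 then [(1, 0, 0), (- 1, 1, 0), (- 1, 0, 1), (1, 2, 1), (1, 1, 2), (- 1, 2, 2)]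
     else if n = 2 then [(1, 0, 0), (- 1, 1, 0), (- 1, 0, 1), (1, 2, 1), (1, 1, 3), (- 1, 3, 3), (- 1, 2, 4), (1, 3, 4)]
     else [(1, 0, 0), (- 1, 1, 0), (- 1, 0, 1), (1, 2, 1), (1, 1, 4), (- 1, 4, 4), (- 1, 2, 6), (1, 5, 6), (1, 4, 9),
       (- 1, 6, 9), (- 1, 5, 10), (1, 6, 10)])"

text \<open>An entry \<open>(g, k, l)\<close> stands for the positive root with coordinates \<open>g\<close> and coroot
  \<open>k \<alpha>\<^sup>\<or> + l \<beta>\<^sup>\<or>\<close>.\<close>

definition pos_coroots :: "nat \<Rightarrow> ((int \<times> int) \<times> nat \<times> nat) list" where
  "pos_coroots n = [((1, 0), (1, 0)), ((0, 1), (0, 1))]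
     @ (if n = 0 then [] else if n = 1 then [((1, 1), (1, 1))]
        else if n = 2 then [((2, 1), (1, 1)), ((1, 1), (1, 2))]
        else [((3, 1), (1, 1)), ((3, 2), (1, 2)), ((1, 1), (1, 3)), ((2, 1), (2, 3))])"

text \<open>The Weyl denominator identity of the dual root system, with \<open>X\<close> and
  \<open>Y\<close> for the exponentials of the simple coroots.\<close>

lemma drop_identity:
  fixes X Y :: "'a::idom"
  assumes "n \<le> 3"
  shows "(\<Sum>(s, i, j)\<leftarrow>drop_terms n. of_int s * (X ^ i * Y ^ j)) = (\<Prod>(g, k, l)\<leftarrow>pos_coroots n. 1 - X ^ k * Y ^ l)"
proof -
  consider "n = 0" | "n = 1" | "n = 2" | "n = 3" using assms by linarith
  then show ?thesis
  proof cases
    case 1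
    then show ?thesis by (simp add: drop_terms_def pos_coroots_def algebra_simps)
  next
    case 2
    have "(\<Sum>(s, i, j)\<leftarrow>drop_terms n. of_int s * (X ^ i * Y ^ j)) = 1 - X - Y + X ^ 2 * Y + X * Y ^ 2 - X ^ 2 * Y ^ 2"
      by (simp add: 2 drop_terms_def algebra_simps)
    moreover have "(\<Prod>(g, k, l)\<leftarrow>pos_coroots n. 1 - X ^ k * Y ^ l) = (1 - X) * (1 - Y) * (1 - X * Y)"
      by (simp add: 2 pos_coroots_def mult.assoc)
    moreover have "1 - X - Y + X ^ 2 * Y + X * Y ^ 2 - X ^ 2 * Y ^ 2
        = (1 - X) * (1 - Y) * (1 - X * Y)" by algebra
    ultimately show ?thesis by simp
  next
    case 3
    have "(\<Sum>(s, i, j)\<leftarrow>drop_terms n. of_int s * (X ^ i * Y ^ j)) = 1 - X - Y + X ^ 2 * Y + X * Y ^ 3 - X ^ 3 * Y ^ 3 - X ^ 2 * Y ^ 4 + X ^ 3 * Y ^ 4"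
      by (simp add: 3 drop_terms_def algebra_simps)
    moreover have "(\<Prod>(g, k, l)\<leftarrow>pos_coroots n. 1 - X ^ k * Y ^ l) = (1 - X) * (1 - Y) * (1 - X * Y) * (1 - X * Y ^ 2)"
      by (simp add: 3 pos_coroots_def mult.assoc)
    moreover have "1 - X - Y + X ^ 2 * Y + X * Y ^ 3 - X ^ 3 * Y ^ 3 - X ^ 2 * Y ^ 4 + X ^ 3 * Y ^ 4
        = (1 - X) * (1 - Y) * (1 - X * Y) * (1 - X * Y ^ 2)" by algebra
    ultimately show ?thesis by simp
  next
    case 4
    have "(\<Sum>(s, i, j)\<leftarrow>drop_terms n. of_int s * (X ^ i * Y ^ j)) = 1 - X - Y + X ^ 2 * Y + X * Y ^ 4 - X ^ 4 * Y ^ 4 - X ^ 2 * Y ^ 6 + X ^ 5 * Y ^ 6 + X ^ 4 * Y ^ 9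
        - X ^ 6 * Y ^ 9 - X ^ 5 * Y ^ 10 + X ^ 6 * Y ^ 10"
      by (simp add: 4 drop_terms_def algebra_simps)
    moreover have "(\<Prod>(g, k, l)\<leftarrow>pos_coroots n. 1 - X ^ k * Y ^ l) = (1 - X) * (1 - Y) * (1 - X * Y) * (1 - X * Y ^ 2) * (1 - X * Y ^ 3) * (1 - X ^ 2 * Y ^ 3)"
      by (simp add: 4 pos_coroots_def mult.assoc)
    moreover have "1 - X - Y + X ^ 2 * Y + X * Y ^ 4 - X ^ 4 * Y ^ 4 - X ^ 2 * Y ^ 6 + X ^ 5 * Y ^ 6 + X ^ 4 * Y ^ 9
        - X ^ 6 * Y ^ 9 - X ^ 5 * Y ^ 10 + X ^ 6 * Y ^ 10
        = (1 - X) * (1 - Y) * (1 - X * Y) * (1 - X * Y ^ 2) * (1 - X * Y ^ 3) * (1 - X ^ 2 * Y ^ 3)" by algebra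
    ultimately show ?thesis by simp
  qed
qed

lemma prod_list_divide:
  "(\<Prod>x\<leftarrow>xs. f x) / (\<Prod>x\<leftarrow>xs. g x) = (\<Prod>x\<leftarrow>xs. f x / g x :: 'a::field)"
  by (induction xs) (simp_all flip: times_divide_times_eq)

lemma to_fract_power: "to_fract (p ^ k) = to_fract p ^ k"
  by (induction k) simp_all

lemma to_fract_of_nat: "to_fract (of_nat k) = of_nat k"
  by (induction k) simp_all

lemma to_fract_sum: "to_fract (\<Sum>x\<in>A. f x) = (\<Sum>x\<in>A. to_fract (f x))"
  by (induction A rule: infinite_finite_induct) simp_all

lemma to_fract_monom: "to_fract (monom (int c) i) = of_nat c * qvar ^ i"
proof -
  have "monom (int c) i = of_nat c * [:0, 1:] ^ i"
    by (simp add: monom_altdef of_nat_poly)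
  then show ?thesis by (simp add: to_fract_power to_fract_of_nat qvar_def)
qed

lemma qvar_neq_0: "qvar \<noteq> 0"
  by (simp add: qvar_def)

lemma qvar_power_neq_1:
  assumes "0 < k" shows "1 - qvar ^ k \<noteq> 0"
proof
  assume "1 - qvar ^ k = 0"
  then have "qvar ^ k = 1" by (metis right_minus_eq)
  then have "to_fract ([:0, 1 :: int:] ^ k) = to_fract 1" by (simp only: to_fract_power to_fract_1 flip: qvar_def)
  then have "[:0, 1:] ^ k = (1 :: int poly)" by (simp only: to_fract_eq_iff)
  then have "degree ([:0, 1:] ^ k :: int poly) = 0" by simp
  then show False using assms by (simp add: degree_linear_power)
qed

context rank_two_cartan begin

lemma n_le_3: "n \<le> 3"
  using nm by auto

lemma hgt_diff: "hgt v - hgt u = ((2 + real m) * (wa v - wa u) + (2 + real n) * (wb v - wb u)) / cdet"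
  unfolding hgt_def diff_divide_distrib[symmetric] by (simp add: algebra_simps)

text \<open>An entry of \<open>drop_terms\<close> is thus a sign together with the coordinates, in
  simple coroots, of the half sum of positive coroots minus a Weyl conjugate of it.\<close>

lemma hgt_drops:
  "map (\<lambda>w. ((- 1 :: int) ^ length w, hgt v - hgt (act w v))) (weyl_words n)
     = map (\<lambda>(s, i, j). (s, real i * wa v + real j * wb v)) (drop_terms n)"
  unfolding hgt_diff act_coords[THEN conjunct1] act_coords[THEN conjunct2] cdet_def
  by (rule nm_cases) (simp_all add: weyl_words_def drop_terms_def field_simps)

lemma alt_q:
  assumes "wa v = real A" "wb v = real B"
  shows "alt (\<lambda>u. qvar powi \<lfloor>hgt v - hgt u\<rfloor>) v = (\<Prod>(g, k, l)\<leftarrow>pos_coroots n. 1 - qvar ^ (k * A + l * B))"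
proof -
  have fl: "qvar powi \<lfloor>real i * real A + real j * real B\<rfloor> = (qvar ^ A) ^ i * (qvar ^ B) ^ j" for i j
  proof -
    have "real i * real A + real j * real B = of_int (int (i * A + j * B))" by simp
    then have "qvar powi \<lfloor>real i * real A + real j * real B\<rfloor> = qvar ^ (i * A + j * B)"
      by (simp only: floor_of_int power_int_of_nat)
    then show ?thesis by (simp add: power_add power_mult[symmetric] mult.commute)
  qed
  have "alt (\<lambda>u. qvar powi \<lfloor>hgt v - hgt u\<rfloor>) v
      = (\<Sum>(s, t)\<leftarrow>map (\<lambda>w. ((- 1 :: int) ^ length w, hgt v - hgt (act w v))) (weyl_words n). of_int s * qvar powi \<lfloor>t\<rfloor>)"
    by (simp add: alt_def comp_def)
  also have "\<dots> = (\<Sum>(s, i, j)\<leftarrow>drop_terms n. of_int s * ((qvar ^ A) ^ i * (qvar ^ B) ^ j))"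
    unfolding hgt_drops assms by (simp only: map_map comp_def split_def fst_conv snd_conv fl)
  also have "\<dots> = (\<Prod>(g, k, l)\<leftarrow>pos_coroots n. 1 - (qvar ^ A) ^ k * (qvar ^ B) ^ l)"
    by (rule drop_identity[OF n_le_3])
  finally show ?thesis by (simp add: power_add power_mult[symmetric] mult.commute)
qed

lemma hgt_drop_int:
  assumes "w \<in> set (weyl_words n)" "wa v = real A" "wb v = real B"
  obtains k :: int where "hgt v - hgt (act w v) = of_int k"
proof -
  have "((- 1 :: int) ^ length w, hgt v - hgt (act w v))
      \<in> set (map (\<lambda>w. ((- 1 :: int) ^ length w, hgt v - hgt (act w v))) (weyl_words n))"
    using assms(1) by force
  then obtain i j :: nat where "hgt v - hgt (act w v) = real i * real A + real j * real B"
    unfolding hgt_drops assms(2,3) by auto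
  then have "hgt v - hgt (act w v) = of_int (int (i * A + j * B))" by simp
  then show thesis by (rule that)
qed

lemma coroot_comb:
  assumes g: "(g, k, l) \<in> set (pos_coroots n)"
  shows "v \<bullet> coroot (comb g) = real k * wa v + real l * wb v"
proof -
  consider "g = (1, 0)" "k = 1" "l = 0" | "g = (0, 1)" "k = 0" "l = 1" | "n \<noteq> 0" by (cases "n = 0") (use g in \<open>auto simp: pos_coroots_def\<close>)
  then show ?thesis
  proof cases
    case 3
    then have m1: "m = 1" using nm by auto
    have pos: "\<alpha> \<bullet> \<alpha> > 0" "\<beta> \<bullet> \<beta> > 0" using root_neq_0 simple_facts by auto
    have va: "v \<bullet> \<alpha> = wa v * (\<alpha> \<bullet> \<alpha>) / 2" and vb: "v \<bullet> \<beta> = wb v * (\<beta> \<bullet> \<beta>) / 2"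
      using pos by (simp_all add: wa_def wb_def coroot_def)
    have ab: "\<alpha> \<bullet> \<beta> = - real n * (\<alpha> \<bullet> \<alpha>) / 2"
      using pos wa_beta by (simp add: wa_def coroot_def inner_commute field_simps)
    have ba: "\<alpha> \<bullet> \<beta> = - (\<beta> \<bullet> \<beta>) / 2"
      using pos wb_alpha by (simp add: wb_def coroot_def m1 field_simps)
    have bb: "\<beta> \<bullet> \<beta> = real n * (\<alpha> \<bullet> \<alpha>)" using ab ba by simp
    obtain x y where xy: "g = (x, y)" by (cases g)
    \<comment> \<open>\<open>Q\<close> and \<open>D\<close> are
      \<open>2 * (v \<bullet> comb g)\<close> and the square of \<open>comb g\<close>, both divided
      by the square of \<alpha>; every inner product has been expressed through that square and
      \<open>n\<close>.\<close>
    define D where "D = real_of_int x ^ 2 - real n * of_int x * of_int y + real n * of_int y ^ 2"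
    define Q where "Q = of_int x * wa v + real n * of_int y * wb v"
    have "2 * (v \<bullet> comb g) = (\<alpha> \<bullet> \<alpha>) * Q"
      unfolding xy comb_def fst_conv snd_conv inner_add_right inner_scaleR_right va vb bb Q_def by (simp add: algebra_simps)
    moreover have "comb g \<bullet> comb g = (\<alpha> \<bullet> \<alpha>) * D"
      unfolding xy comb_def fst_conv snd_conv inner_add_right inner_add_left inner_scaleR_right inner_scaleR_left
        inner_commute[of \<beta> \<alpha>] ab bb D_def
      by (simp add: algebra_simps power2_eq_square)
    ultimately have "v \<bullet> coroot (comb g) = ((\<alpha> \<bullet> \<alpha>) * Q) / ((\<alpha> \<bullet> \<alpha>) * D)"
      by (simp add: coroot_def)
    then have "v \<bullet> coroot (comb g) = Q / D" using pos by simp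
    moreover have "n = 1 \<or> n = 2 \<or> n = 3" using nm 3 by auto
    then have "Q / D = real k * wa v + real l * wb v"
      using g unfolding xy Q_def D_def by (elim disjE) (auto simp: pos_coroots_def field_simps)
    ultimately show ?thesis by simp
  qed (simp_all add: comb_def wa_def wb_def)
qed

lemma prod_positive_roots:
  fixes F :: "'v \<Rightarrow> 'r::comm_monoid_mult"
  shows "(\<Prod>\<gamma>\<in>positive_roots \<Phi> \<alpha> \<beta>. F \<gamma>) = (\<Prod>(g, k, l)\<leftarrow>pos_coroots n. F (comb g))"
proof -
  have "inj_on comb (pos_coords n)" by (rule inj_onI) (simp add: comb_inj)
  then have "(\<Prod>\<gamma>\<in>positive_roots \<Phi> \<alpha> \<beta>. F \<gamma>) = (\<Prod>g\<in>pos_coords n. F (comb g))"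
    unfolding positive_roots_eq by (simp add: prod.reindex)
  also have "\<dots> = (\<Prod>(g, k, l)\<leftarrow>pos_coroots n. F (comb g))"
    by (rule nm_cases) (simp_all add: pos_coords_def pos_coroots_def ac_simps)
  finally show ?thesis .
qed

text \<open>The lower left entry of the Cartan matrix alone tells the four types apart.\<close>

lemma cartan_type:
  "type_A1A1 \<alpha> \<beta> \<Longrightarrow> n = 0" "type_A2 \<alpha> \<beta> \<Longrightarrow> n = 1" "type_C2 \<alpha> \<beta> \<Longrightarrow> n = 2" "type_G2 \<alpha> \<beta> \<Longrightarrow> n = 3"
proof -
  have e: "cartan_matrix \<alpha> \<beta> $ 2 $ 1 = - real n"
    using wa_beta by (simp add: cartan_matrix_def wa_def)
  show "type_A1A1 \<alpha> \<beta> \<Longrightarrow> n = 0" "type_A2 \<alpha> \<beta> \<Longrightarrow> n = 1" "type_C2 \<alpha> \<beta> \<Longrightarrow> n = 2" "type_G2 \<alpha> \<beta> \<Longrightarrow> n = 3"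
    using e by (simp_all add: type_A1A1_def type_A2_def type_C2_def type_G2_def)
qed

end

context structured_grid begin

lemma sum_card: "(\<Sum>x\<in>L. g (card x)) = (\<Sum>i\<le>card P. of_nat (cnt i) * g i :: 'r::comm_semiring_1)"
proof -
  have "(\<Sum>i\<in>{..card P}. \<Sum>x\<in>{x \<in> L. card x = i}. g (card x)) = (\<Sum>x\<in>L. g (card x))"
    using card_le by (intro sum.group[OF finL]) auto
  moreover have "(\<Sum>x\<in>{x \<in> L. card x = i}. g (card x)) = of_nat (cnt i) * g i" for i
    unfolding cnt_def by simp
  ultimately show ?thesis by simp
qed

text \<open>The alternating identity measures the drop from the top and so produces coranks; rank
  symmetry converts them to ranks.\<close>

lemma to_fract_RGF: "to_fract (RGF L) = (\<Sum>x\<in>L. qvar ^ (card P - card x))"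
proof -
  have "(\<Sum>x\<in>L. qvar ^ (card P - card x)) = (\<Sum>i\<le>card P. of_nat (cnt i) * qvar ^ (card P - i))"
    by (rule sum_card)
  also have "\<dots> = (\<Sum>i\<le>card P. of_nat (cnt i) * qvar ^ i)"
    by (rule sum.reindex_bij_witness[of _ "\<lambda>i. card P - i" "\<lambda>i. card P - i"]) (auto simp: cnt_symmetric)
  finally show ?thesis by (simp only: RGF_eq to_fract_sum to_fract_monom)
qed

text \<open>The principal specialization: the alternating identity is evaluated at
  \<open>qvar\<close> raised to the drop in height. Both alternating sums factor by
  \<open>alt_q\<close>, and the generating function is their quotient.\<close>

lemma RGF_product:
  "to_fract (RGF L) = (\<Prod>(g, k, l)\<leftarrow>pos_coroots n.
     (1 - qvar ^ (k * (top_coeff True + 1) + l * (top_coeff False + 1))) / (1 - qvar ^ (k + l)))"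
proof -
  let ?r = "rho \<alpha> \<beta>" and ?A = "top_coeff True + 1" and ?B = "top_coeff False + 1"
  have r: "wa ?r = real 1" "wb ?r = real 1" by (simp_all add: rho_eq)
  have rP: "wa (?r + wtx P) = real ?A" "wb (?r + wtx P) = real ?B" by (simp_all add: rho_eq wtx_P)
  have "alt (\<lambda>u. qvar powi \<lfloor>hgt ?r - hgt u\<rfloor>) ?r * (\<Sum>x\<in>L. qvar powi \<lfloor>hgt (wtx P) - hgt (wtx x)\<rfloor>)
      = alt (\<lambda>u. qvar powi \<lfloor>hgt (?r + wtx P) - hgt u\<rfloor>) (?r + wtx P)"
  proof (rule alternating_identity)
    fix x :: "int poly fract" assume "x + x = 0"
    then have "2 * x = 0" by simp
    moreover have "(2 :: int poly fract) \<noteq> 0"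
    proof -
      have "to_fract (of_nat 2 :: int poly) \<noteq> 0" by simp
      then show ?thesis by (simp only: to_fract_of_nat of_nat_numeral not_False_eq_True)
    qed
    ultimately show "x = 0" by simp
  next
    fix w x assume w: "w \<in> set (weyl_words n)" and x: "x \<in> L"
    obtain k where k: "hgt ?r - hgt (act w ?r) = of_int k" by (rule hgt_drop_int[OF w r])
    obtain y where y: "y \<in> L" "act w (wtx x) = wtx y" using act_wtx[OF x] by blast
    have l: "hgt (wtx P) - hgt (act w (wtx x)) = of_int (int (card P) - int (card y))"
      unfolding y(2) using hgt_wtx[OF y(1)] by simp
    have "hgt (?r + wtx P) - hgt (act w ?r + act w (wtx x)) = of_int (k + (int (card P) - int (card y)))"
      using k l by simp
    then show "qvar powi \<lfloor>hgt (?r + wtx P) - hgt (act w ?r + act w (wtx x))\<rfloor>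
        = qvar powi \<lfloor>hgt ?r - hgt (act w ?r)\<rfloor> * qvar powi \<lfloor>hgt (wtx P) - hgt (act w (wtx x))\<rfloor>"
      unfolding k l by (simp only: floor_of_int power_int_add[OF disjI1[OF qvar_neq_0]])
  qed
  moreover have "(\<Sum>x\<in>L. qvar powi \<lfloor>hgt (wtx P) - hgt (wtx x)\<rfloor>) = to_fract (RGF L)"
    unfolding to_fract_RGF
  proof (rule sum.cong[OF HOL.refl])
    fix x assume x: "x \<in> L"
    have "hgt (wtx P) - hgt (wtx x) = of_int (int (card P - card x))"
      using hgt_wtx[OF x] card_le[OF x] by (simp add: of_nat_diff)
    then show "qvar powi \<lfloor>hgt (wtx P) - hgt (wtx x)\<rfloor> = qvar ^ (card P - card x)"
      by (simp only: floor_of_int power_int_of_nat)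
  qed
  ultimately have e: "(\<Prod>(g, k, l)\<leftarrow>pos_coroots n. 1 - qvar ^ (k * 1 + l * 1)) * to_fract (RGF L)
      = (\<Prod>(g, k, l)\<leftarrow>pos_coroots n. 1 - qvar ^ (k * ?A + l * ?B))"
    unfolding alt_q[OF r] alt_q[OF rP] by simp
  have nz: "(\<Prod>(g, k, l)\<leftarrow>pos_coroots n. 1 - qvar ^ (k + l)) \<noteq> 0"
  proof
    assume "(\<Prod>(g, k, l)\<leftarrow>pos_coroots n. 1 - qvar ^ (k + l)) = 0"
    then have "0 \<in> (\<lambda>(g, k, l). 1 - qvar ^ (k + l)) ` set (pos_coroots n)"
      by (simp only: prod_list_zero_iff set_map)
    then obtain x where x: "0 = (case x of (g, k, l) \<Rightarrow> 1 - qvar ^ (k + l))" "x \<in> set (pos_coroots n)"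
      by (rule imageE)
    obtain g k l where xe: "x = (g, k, l)" by (rule prod_cases3)
    note gl = x[unfolded xe prod.case]
    have "0 < k + l" using gl(2) by (auto simp: pos_coroots_def split: if_splits)
    from qvar_power_neq_1[OF this] gl(1)[symmetric] show False by (rule notE)
  qed
  have "to_fract (RGF L) = (\<Prod>(g, k, l)\<leftarrow>pos_coroots n. 1 - qvar ^ (k * ?A + l * ?B))
      / (\<Prod>(g, k, l)\<leftarrow>pos_coroots n. 1 - qvar ^ (k + l))"
    using e nz by (simp add: field_simps)
  then show ?thesis unfolding split_def prod_list_divide .
qed

lemma RGF_roots:
  "to_fract (RGF L) = (\<Prod>\<gamma>\<in>positive_roots \<Phi> \<alpha> \<beta>.
     (1 - qvar powi \<lfloor>(wtx P + rho \<alpha> \<beta>) \<bullet> coroot \<gamma>\<rfloor>) / (1 - qvar powi \<lfloor>rho \<alpha> \<beta> \<bullet> coroot \<gamma>\<rfloor>))"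
  unfolding prod_positive_roots RGF_product
proof (rule arg_cong[where f = prod_list], rule map_cong[OF HOL.refl], safe)
  fix x y :: int and k l :: nat assume g: "((x, y), k, l) \<in> set (pos_coroots n)"
  have "(wtx P + rho \<alpha> \<beta>) \<bullet> coroot (comb (x, y)) = of_int (int (k * (top_coeff True + 1) + l * (top_coeff False + 1)))"
    unfolding coroot_comb[OF g] by (simp add: wtx_P rho_eq algebra_simps)
  moreover have "rho \<alpha> \<beta> \<bullet> coroot (comb (x, y)) = of_int (int (k + l))"
    unfolding coroot_comb[OF g] by (simp add: rho_eq)
  ultimately show "(1 - qvar ^ (k * (top_coeff True + 1) + l * (top_coeff False + 1))) / (1 - qvar ^ (k + l))
      = (1 - qvar powi \<lfloor>(wtx P + rho \<alpha> \<beta>) \<bullet> coroot (comb (x, y))\<rfloor>) / (1 - qvar powi \<lfloor>rho \<alpha> \<beta> \<bullet> coroot (comb (x, y))\<rfloor>)"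
    by (simp only: floor_of_int power_int_of_nat)
qed

end

theorem theorem1p1:
  fixes \<Phi> :: "'v::euclidean_space set" and \<alpha> \<beta> lam :: 'v and a b :: int
    and P :: "'p::order set" and chn :: "'p \<Rightarrow> nat" and col :: "'p \<Rightarrow> 'v"
    and L :: "'p set set" and ec :: "'p set \<Rightarrow> 'p set \<Rightarrow> 'v" and mx :: "'p set"
    and q :: "int poly fract"
  assumes rank_two: "DIM('v) = 2"
    and root_sys: "root_system \<Phi>"
    and simple: "simple_roots \<Phi> \<alpha> \<beta>"
    and alpha_short: "\<alpha> \<bullet> \<beta> \<noteq> 0 \<longrightarrow> norm \<alpha> \<le> norm \<beta>"
    and grid: "two_color_grid_poset P chn {\<alpha>, \<beta>} col"
    and L: "L = order_ideals P"
    and ec: "ec = ideal_edge_color col"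
    and mx: "maximal_in L mx"
    and lam_wt: "lam = wt L ec \<alpha> \<beta> mx"
    and lam_coeffs: "lam = of_int a *\<^sub>R fund_weight \<alpha> \<beta> + of_int b *\<^sub>R fund_weight \<beta> \<alpha>"
    and max_prop: "max_property P chn col"
    and structured: "M_structured L ec \<alpha> \<beta>"
    and q: "q = qvar"
  shows "dominant \<alpha> \<beta> lam
    \<and> splitting_distributive_lattice L ec \<alpha> \<beta> (weyl_bialternant \<Phi> \<alpha> \<beta> lam)
    \<and> WGF L ec \<alpha> \<beta> = weyl_bialternant \<Phi> \<alpha> \<beta> lam
    \<and> rank_symmetric L
    \<and> rank_unimodal L
    \<and> to_fract (RGF L) =
        (\<Prod>\<gamma>\<in>positive_roots \<Phi> \<alpha> \<beta>.
           (1 - q powi \<lfloor>(lam + rho \<alpha> \<beta>) \<bullet> coroot \<gamma>\<rfloor>) / (1 - q powi \<lfloor>rho \<alpha> \<beta> \<bullet> coroot \<gamma>\<rfloor>))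
    \<and> (type_A1A1 \<alpha> \<beta> \<longrightarrow> to_fract (RGF L) =
        ((1 - q powi (a + 1)) * (1 - q powi (b + 1)))
        / ((1 - q) * (1 - q)))
    \<and> (type_A2 \<alpha> \<beta> \<longrightarrow> to_fract (RGF L) =
        ((1 - q powi (a + 1)) * (1 - q powi (b + 1)) * (1 - q powi (a + b + 2)))
        / ((1 - q) * (1 - q) * (1 - q ^ 2)))
    \<and> (type_C2 \<alpha> \<beta> \<longrightarrow> to_fract (RGF L) =
        ((1 - q powi (a + 1)) * (1 - q powi (b + 1)) * (1 - q powi (a + b + 2))
          * (1 - q powi (a + 2 * b + 3)))
        / ((1 - q) * (1 - q) * (1 - q ^ 2) * (1 - q ^ 3)))
    \<and> (type_G2 \<alpha> \<beta> \<longrightarrow> to_fract (RGF L) =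
        ((1 - q powi (a + 1)) * (1 - q powi (b + 1)) * (1 - q powi (a + b + 2))
          * (1 - q powi (a + 2 * b + 3)) * (1 - q powi (a + 3 * b + 4))
          * (1 - q powi (2 * a + 3 * b + 5)))
        / ((1 - q) * (1 - q) * (1 - q ^ 2) * (1 - q ^ 3) * (1 - q ^ 4) * (1 - q ^ 5)))"
proof -
  interpret R: rank_two_roots \<Phi> \<alpha> \<beta> by unfold_locales fact+
  obtain n m where nm: "R.wa \<beta> = - real n" "R.wb \<alpha> = - real m" "(n, m) \<in> {(0, 0), (1, 1), (2, 1), (3, 1)}"
    by (rule R.cartan_values)
  obtain M where M: "chain_function P M chn"
    using grid unfolding two_color_grid_poset_def grid_poset_def by blast
  interpret S: structured_grid \<Phi> \<alpha> \<beta> n m P chn col M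
    by unfold_locales (fact nm grid M max_prop structured[unfolded L ec])+
  have mxP: "mx = P"
    using mx S.P_L S.ideal_subset unfolding maximal_in_def L by (metis psubsetI)
  have lam: "lam = S.wtx P" unfolding lam_wt mxP L ec S.wtx_def ..
  \<comment> \<open>The weight coordinates of \<open>lam + rho\<close>, which accounts for the
    constants 1 to 5 in the exponents.\<close>
  define A B where "A = S.top_coeff True + 1" and "B = S.top_coeff False + 1"
  have "S.wv (of_int a) (of_int b) = S.wv (real (S.top_coeff True)) (real (S.top_coeff False))"
    using lam_coeffs lam unfolding S.comb_fund S.wtx_P by simp
  then have "of_int a = real (S.top_coeff True)" "of_int b = real (S.top_coeff False)"
    by (metis S.wv)+
  then have ab: "a = int (S.top_coeff True)" "b = int (S.top_coeff False)" by linarith+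
  have dom: "dominant \<alpha> \<beta> lam"
    unfolding dominant_def nat_combs_def lam S.comb_fund S.wtx_P by blast
  have pw: "q powi (a + 1) = q ^ A" "q powi (b + 1) = q ^ B" "q powi (a + b + 2) = q ^ (A + B)"
    "q powi (a + 2 * b + 3) = q ^ (A + 2 * B)" "q powi (a + 3 * b + 4) = q ^ (A + 3 * B)"
    "q powi (2 * a + 3 * b + 5) = q ^ (2 * A + 3 * B)"
  proof -
    have "a + 1 = int A" "b + 1 = int B" "a + b + 2 = int (A + B)" "a + 2 * b + 3 = int (A + 2 * B)"
      "a + 3 * b + 4 = int (A + 3 * B)" "2 * a + 3 * b + 5 = int (2 * A + 3 * B)"
      by (simp_all add: ab A_def B_def)
    then show "q powi (a + 1) = q ^ A" "q powi (b + 1) = q ^ B" "q powi (a + b + 2) = q ^ (A + B)"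
      "q powi (a + 2 * b + 3) = q ^ (A + 2 * B)" "q powi (a + 3 * b + 4) = q ^ (A + 3 * B)"
      "q powi (2 * a + 3 * b + 5) = q ^ (2 * A + 3 * B)"
      by (simp_all only: power_int_of_nat)
  qed
  note prod = S.RGF_product[folded A_def B_def L q]
  have "to_fract (RGF L) = ((1 - q ^ A) * (1 - q ^ B)) / ((1 - q) * (1 - q))" if "type_A1A1 \<alpha> \<beta>"
    unfolding prod S.cartan_type(1)[OF that] pos_coroots_def by simp
  moreover have "to_fract (RGF L) = ((1 - q ^ A) * (1 - q ^ B) * (1 - q ^ (A + B))) / ((1 - q) * (1 - q) * (1 - q ^ 2))"
    if "type_A2 \<alpha> \<beta>"
    unfolding prod S.cartan_type(2)[OF that] pos_coroots_def by (simp add: mult.assoc numeral_2_eq_2)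
  moreover have "to_fract (RGF L) = ((1 - q ^ A) * (1 - q ^ B) * (1 - q ^ (A + B)) * (1 - q ^ (A + 2 * B)))
      / ((1 - q) * (1 - q) * (1 - q ^ 2) * (1 - q ^ 3))" if "type_C2 \<alpha> \<beta>"
    unfolding prod S.cartan_type(3)[OF that] pos_coroots_def by (simp add: mult.assoc eval_nat_numeral)
  moreover have "to_fract (RGF L) = ((1 - q ^ A) * (1 - q ^ B) * (1 - q ^ (A + B)) * (1 - q ^ (A + 2 * B))
        * (1 - q ^ (A + 3 * B)) * (1 - q ^ (2 * A + 3 * B)))
      / ((1 - q) * (1 - q) * (1 - q ^ 2) * (1 - q ^ 3) * (1 - q ^ 4) * (1 - q ^ 5))" if "type_G2 \<alpha> \<beta>"
    unfolding prod S.cartan_type(4)[OF that] pos_coroots_def by (simp add: mult.assoc eval_nat_numeral)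
  ultimately show ?thesis
    unfolding pw using dom S.splitting S.WGF_bialternant S.rank_symmetric_L S.rank_unimodal_L S.RGF_roots
    unfolding L ec lam q by blast
qed

end
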